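(* Let $n\geqslant 2$, let $D$ be a bounded domain in $\mathbb{R}^n$, let $D'$ be a domain in $\overline{\mathbb{R}^n}$, let $\delta>0$, let $A\subset D$ be a continuum, and let $Q:\mathbb{R}^n\to[0,\infty]$ be a Lebesgue measurable function with $Q(x)=0$ for $x\notin D$. Let $\mathfrak{S}_{\delta,A,Q}(D,D')$ be the family of all homeomorphisms $g:D'\to D$ of $D'$ onto $D$ such that $f=g^{-1}:D\to D'$ is a ring $Q$-homeomorphism in $\overline{D}$ and $h(f(A))\geqslant\delta$. Suppose that $D$ is locally connected on its boundary, $\partial D'$ is weakly flat, and no connected component of $\partial D'$ degenerates to a point. If $Q\in L^1(D)$, then each $g\in\mathfrak{S}_{\delta,A,Q}(D,D')$ has a continuous extension $\overline{g}:\overline{D'}\to\overline{D}$ with $\overline{g}|_{D'}=g$ and $\overline{g}(\overline{D'})=\overline{D}$. Moreover, the family $\mathfrak{S}_{\delta,A,Q}(\overline{D},\overline{D'})$ consisting of all the extended mappings $\overline{g}:\overline{D'}\to\overline{D}$ is equicontinuous in $\overline{D'}$, where $\overline{D'}$ carries the chordal metric $h$ and $\overline{D}$ carries the Euclidean metric; that is, for every $y_0\in\overline{D'}$ and every $\varepsilon>0$ there is $\delta_*>0$ such that $|\overline{g}(y)-\overline{g}(y_0)|<\varepsilon$ for all $\overline{g}$ in this family and all $y\in\overline{D'}$ with $h(y,y_0)<\delta_*$.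
   Context: Notation: $\overline{\mathbb{R}^n}=\mathbb{R}^n\cup\{\infty\}$; boundaries and closures of sets are taken in $\overline{\mathbb{R}^n}$; $m$ is Lebesgue measure in $\mathbb{R}^n$; a continuum is a compact connected set. The chordal metric is $h(x,y)=\frac{|x-y|}{\sqrt{1+|x|^2}\sqrt{1+|y|^2}}$ for $x\neq\infty\neq y$, and $h(x,\infty)=\frac{1}{\sqrt{1+|x|^2}}$. For $E\subset\overline{\mathbb{R}^n}$, $h(E)=\sup_{x,y\in E}h(x,y)$ is the chordal diameter of $E$. Modulus: for a family $\Gamma$ of paths, $M(\Gamma)=\inf_\rho\int_{\mathbb{R}^n}\rho^n\,dm$, the infimum being over all Borel functions $\rho:\mathbb{R}^n\to[0,\infty]$ such that $\int_\gamma\rho\,ds\geqslant 1$ for every locally rectifiable $\gamma\in\Gamma$ (the conformal modulus in the sense of Väisälä; paths passing through $\infty$ are disregarded). For sets $E,F,D\subset\overline{\mathbb{R}^n}$, $\Gamma(E,F,D)$ is the family of all paths (continuous maps) $\gamma:[0,1]\to\overline{\mathbb{R}^n}$ with $\gamma(0)\in E$, $\gamma(1)\in F$ and $\gamma(t)\in D$ for all $t\in(0,1)$. For a mapping $f$ of $D$, $f(\Gamma)$ denotes the family of images under $f$ of the paths of $\Gamma$ (for $\Gamma=\Gamma(S_1,S_2,D)$ with endpoints of a path possibly outside $D$, the image is taken of the part of the path lying in $D$). Ring $Q$-mappings: for $x_0\in\overline{D}$, $x_0\neq\infty$, put $S_i=S(x_0,r_i)=\{x\in\mathbb{R}^n:|x-x_0|=r_i\}$,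 $i=1,2$, and $A(x_0,r_1,r_2)=\{x\in\mathbb{R}^n:r_1<|x-x_0|<r_2\}$. A mapping $f:D\to\overline{\mathbb{R}^n}$ is a ring $Q$-mapping at $x_0$ if $$M(f(\Gamma(S_1,S_2,D)))\leqslant\int_{A(x_0,r_1,r_2)\cap D}Q(x)\,\eta^n(|x-x_0|)\,dm(x)$$ for all $0<r_1<r_2<d_0:=\sup_{x\in D}|x-x_0|$ and every measurable function $\eta:(r_1,r_2)\to[0,\infty]$ with $\int_{r_1}^{r_2}\eta(r)\,dr\geqslant 1$. For $E\subseteq\overline{D}$, $f$ is a ring $Q$-mapping in $E$ if it is a ring $Q$-mapping at every $x_0\in E$; if in addition $f$ is a homeomorphism (onto its image), it is called a ring $Q$-homeomorphism in $E$. A domain $D$ is locally connected at $x_0\in\partial D$ if for every neighborhood $U$ of $x_0$ there is a neighborhood $V\subset U$ of $x_0$ such that $V\cap D$ is connected; $D$ is locally connected on its boundary if this holds at every $x_0\in\partial D$. The boundary of a domain $G$ is weakly flat at $x_0\in\partial G$ if for every $P>0$ and every neighborhood $U$ of $x_0$ there is a neighborhood $V\subset U$ of $x_0$ such that $M(\Gamma(E,F,G))>P$ for all continua $E,F\subset G$ each of which intersects both $\partial U$ and $\partial V$. The boundary $\partial G$ is weakly flat if it is weakly flat at every point of $\partial G$. *)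

theory Defs
  imports "HOL-Analysis.Analysis"
begin

section \<open>The extended space with its chordal metric\<close>

datatype 'a onept = Fin (the_fin: 'a) | Infty

fun chordal :: "'a::real_inner onept \<Rightarrow> 'a onept \<Rightarrow> real" where
  "chordal (Fin x) (Fin y) = norm (x - y) / (sqrt (1 + (norm x)\<^sup>2) * sqrt (1 + (norm y)\<^sup>2))"
| "chordal (Fin x) Infty = 1 / sqrt (1 + (norm x)\<^sup>2)"
| "chordal Infty (Fin y) = 1 / sqrt (1 + (norm y)\<^sup>2)"
| "chordal Infty Infty = 0"

text \<open>Stereographic projection to the sphere of diameter one with south pole at the origin; the
  chordal metric is the Euclidean distance of the projected points.\<close>

fun stereo :: "'a::real_inner onept \<Rightarrow> 'a \<times> real" where
  "stereo (Fin x) = (x /\<^sub>R (1 + (norm x)\<^sup>2), (norm x)\<^sup>2 / (1 + (norm x)\<^sup>2))"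
| "stereo Infty = (0, 1)"

lemma chordal_Fin_stereo:
  fixes x y :: "'a::real_inner"
  shows "chordal (Fin x) (Fin y) = dist (stereo (Fin x)) (stereo (Fin y))"
proof -
  define X where "X = (norm x)\<^sup>2"
  define Y where "Y = (norm y)\<^sup>2"
  define c where "c = inner x y"
  have X: "0 \<le> X" "inner x x = X" and Y: "0 \<le> Y" "inner y y = Y"
    by (auto simp: X_def Y_def power2_norm_eq_inner)
  have p: "1 + X > 0" "1 + Y > 0" using X Y by auto
  have c': "inner y x = c" by (simp add: c_def inner_commute)
  have "(dist (stereo (Fin x)) (stereo (Fin y)))\<^sup>2
      = (norm (x /\<^sub>R (1 + X) - y /\<^sub>R (1 + Y)))\<^sup>2 + (X / (1 + X) - Y / (1 + Y))\<^sup>2"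
    by (simp add: dist_norm norm_prod_def X_def Y_def)
  also have "(norm (x /\<^sub>R (1 + X) - y /\<^sub>R (1 + Y)))\<^sup>2
      = X / (1 + X)\<^sup>2 + Y / (1 + Y)\<^sup>2 - 2 * c / ((1 + X) * (1 + Y))"
    using p by (simp add: power2_norm_eq_inner inner_diff_left inner_diff_right X Y c' flip: c_def)
      (simp add: divide_simps power2_eq_square, simp add: algebra_simps)
  also have "\<dots> + (X / (1 + X) - Y / (1 + Y))\<^sup>2 = (X + Y - 2 * c) / ((1 + X) * (1 + Y))"
  proof -
    have e: "X / (1 + X)\<^sup>2 + (X / (1 + X))\<^sup>2 = X / (1 + X)"
      "Y / (1 + Y)\<^sup>2 + (Y / (1 + Y))\<^sup>2 = Y / (1 + Y)"
      using p by (simp_all add: divide_simps power2_eq_square) (simp_all add: algebra_simps)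
    have "X / (1 + X)\<^sup>2 + Y / (1 + Y)\<^sup>2 - 2 * c / ((1 + X) * (1 + Y)) + (X / (1 + X) - Y / (1 + Y))\<^sup>2
       = X / (1 + X) + Y / (1 + Y) - 2 * c / ((1 + X) * (1 + Y)) - 2 * (X / (1 + X)) * (Y / (1 + Y))"
      using e power2_diff[of "X / (1 + X)" "Y / (1 + Y)"] by linarith
    also have "\<dots> = (X + Y - 2 * c) / ((1 + X) * (1 + Y))"
      using p by (simp add: divide_simps) (simp add: algebra_simps)
    finally show ?thesis .
  qed
  also have "X + Y - 2 * c = (norm (x - y))\<^sup>2"
    by (simp add: power2_norm_eq_inner inner_diff_left inner_diff_right X Y c' flip: c_def)
  also have "\<dots> / ((1 + X) * (1 + Y)) = (chordal (Fin x) (Fin y))\<^sup>2"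
    using p by (simp add: power_divide power_mult_distrib flip: X_def Y_def)
  finally show ?thesis
    by (metis chordal.simps(1) divide_nonneg_nonneg mult_nonneg_nonneg norm_ge_zero
        power2_eq_imp_eq real_sqrt_ge_zero zero_le_dist zero_le_power2 add_nonneg_nonneg zero_le_one)
qed

lemma chordal_Infty_stereo:
  fixes x :: "'a::real_inner"
  shows "1 / sqrt (1 + (norm x)\<^sup>2) = dist (stereo (Fin x)) (stereo Infty)"
proof -
  define X where "X = (norm x)\<^sup>2"
  have p: "1 + X > 0" by (simp add: X_def add_pos_nonneg)
  have e: "X / (1 + X) - 1 = - (1 / (1 + X))" using p by (simp add: field_simps)
  have "(dist (stereo (Fin x)) (stereo Infty))\<^sup>2 = (norm x / (1 + X))\<^sup>2 + (X / (1 + X) - 1)\<^sup>2"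
    using p by (simp add: dist_norm norm_prod_def divide_inverse_commute flip: X_def)
  also have "\<dots> = (X + 1) / (1 + X)\<^sup>2"
    unfolding e by (simp add: power_divide add_divide_distrib flip: X_def)
  also have "\<dots> = 1 / (1 + X)"
    using p by (simp add: power2_eq_square add.commute)
  also have "\<dots> = (1 / sqrt (1 + X))\<^sup>2"
    using p by (simp add: power_divide)
  finally have "dist (stereo (Fin x)) (stereo Infty) = 1 / sqrt (1 + X)"
    by (rule power2_eq_imp_eq) (use p in auto)
  then show ?thesis by (simp add: X_def)
qed

lemma chordal_stereo: "chordal p q = dist (stereo p) (stereo q)"
  by (cases p; cases q)
    (simp_all only: chordal_Fin_stereo chordal.simps(2,3,4) chordal_Infty_stereo dist_commute dist_self)

lemma chordal_eq_0: "chordal p q = 0 \<longleftrightarrow> p = q"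
proof -
  have "1 + (norm x)\<^sup>2 > 0" for x :: 'a by (simp add: add_pos_nonneg)
  then have "sqrt (1 + (norm x)\<^sup>2) \<noteq> 0" for x :: 'a
    by (metis less_irrefl real_sqrt_gt_zero)
  then show ?thesis by (cases p; cases q) auto
qed

instantiation onept :: (real_inner) metric_space
begin

definition dist_onept :: "'a onept \<Rightarrow> 'a onept \<Rightarrow> real" where
  "dist_onept = chordal"

definition uniformity_onept :: "('a onept \<times> 'a onept) filter" where
  "uniformity_onept = (INF e\<in>{0<..}. principal {(x, y). dist x y < e})"

definition open_onept :: "'a onept set \<Rightarrow> bool" where
  "open_onept U \<longleftrightarrow> (\<forall>x\<in>U. eventually (\<lambda>(x', y). x' = x \<longrightarrow> y \<in> U) uniformity)"

instance
proof
  fix x y z :: "'a onept"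
  show "dist x y = 0 \<longleftrightarrow> x = y"
    by (simp add: dist_onept_def chordal_eq_0)
  show "dist x y \<le> dist x z + dist y z"
    by (simp add: dist_onept_def chordal_stereo dist_triangle2)
qed (rule uniformity_onept_def open_onept_def)+

end


section \<open>Curves, line integrals and the modulus\<close>

text \<open>A curve is given by its parameter interval together with a map whose values outside that
  interval are irrelevant.\<close>

type_synonym 'b curve = "real set \<times> (real \<Rightarrow> 'b)"

definition curve_length :: "(real \<Rightarrow> 'b::metric_space) \<Rightarrow> real \<Rightarrow> real \<Rightarrow> ennreal" where
  "curve_length c a b =
    (SUP ts\<in>{ts. sorted ts \<and> set ts \<subseteq> {a..b}}.
      \<Sum>i<length ts - 1. ennreal (dist (c (ts ! i)) (c (ts ! Suc i))))"

text \<open>The arc length parametrisation of the subcurve over \<open>[a, b]\<close>. The choice of \<open>t\<close> is immaterial,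
  as the curve is constant wherever its length does not grow.\<close>

definition arclength_param :: "(real \<Rightarrow> 'b::metric_space) \<Rightarrow> real \<Rightarrow> real \<Rightarrow> real \<Rightarrow> 'b" where
  "arclength_param c a b s = c (SOME t. t \<in> {a..b} \<and> curve_length c a t = ennreal s)"

definition rect_line_integral ::
    "('b::metric_space \<Rightarrow> ennreal) \<Rightarrow> (real \<Rightarrow> 'b) \<Rightarrow> real \<Rightarrow> real \<Rightarrow> ennreal" where
  "rect_line_integral \<rho> c a b =
    (\<integral>\<^sup>+ s \<in> {0..enn2real (curve_length c a b)}. \<rho> (arclength_param c a b s) \<partial>lborel)"

text \<open>Curves through infinity are not locally rectifiable; thus they do not restrict admissibility.\<close>

definition locally_rectifiable :: "'a::metric_space onept curve \<Rightarrow> bool" where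
  "locally_rectifiable = (\<lambda>(I, c). c ` I \<subseteq> range Fin \<and>
    (\<forall>a\<in>I. \<forall>b\<in>I. a \<le> b \<longrightarrow> curve_length (the_fin \<circ> c) a b < \<infinity>))"

text \<open>For parameter intervals that need not be closed, the line integral is the supremum of the line
  integrals over the compact subcurves.\<close>

definition line_integral :: "('a::metric_space \<Rightarrow> ennreal) \<Rightarrow> 'a onept curve \<Rightarrow> ennreal" where
  "line_integral \<rho> = (\<lambda>(I, c).
    SUP (a, b)\<in>{(a, b). a \<in> I \<and> b \<in> I \<and> a \<le> b}. rect_line_integral \<rho> (the_fin \<circ> c) a b)"

definition admissible :: "'a::metric_space onept curve set \<Rightarrow> ('a \<Rightarrow> ennreal) set" where
  "admissible \<Gamma> = {\<rho>. \<rho> \<in> borel_measurable borel \<and>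
    (\<forall>\<gamma>\<in>\<Gamma>. locally_rectifiable \<gamma> \<longrightarrow> line_integral \<rho> \<gamma> \<ge> 1)}"

definition modulus :: "'a::euclidean_space onept curve set \<Rightarrow> ennreal" where
  "modulus \<Gamma> = (INF \<rho>\<in>admissible \<Gamma>. \<integral>\<^sup>+ x. \<rho> x ^ DIM('a) \<partial>lborel)"

definition joining :: "'b::topological_space set \<Rightarrow> 'b set \<Rightarrow> 'b set \<Rightarrow> 'b curve set" where
  "joining E F D = {({0..1}, c) |c. path c \<and> pathstart c \<in> E \<and> pathfinish c \<in> F \<and>
    (\<forall>t\<in>{0<..<1}. c t \<in> D)}"

text \<open>The image of a curve under a map defined on \<open>D\<close> is that of its part lying in \<open>D\<close>; for curves
  from \<open>joining\<close> only end points can get lost.\<close>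

definition image_curves :: "('b \<Rightarrow> 'c) \<Rightarrow> 'b set \<Rightarrow> 'b curve set \<Rightarrow> 'c curve set" where
  "image_curves f D \<Gamma> = (\<lambda>(I, c). ({t\<in>I. c t \<in> D}, f \<circ> c)) ` \<Gamma>"


section \<open>Ring mappings\<close>

definition ring_Q_mapping_at ::
    "('a::euclidean_space \<Rightarrow> ennreal) \<Rightarrow> 'a set \<Rightarrow> ('a \<Rightarrow> 'a onept) \<Rightarrow> 'a \<Rightarrow> bool" where
  "ring_Q_mapping_at Q D f x0 \<longleftrightarrow>
    (\<forall>r1 r2 (\<eta> :: real \<Rightarrow> ennreal).
      0 < r1 \<and> r1 < r2 \<and> ereal r2 < (SUP x\<in>D. ereal (norm (x - x0))) \<and>
      \<eta> \<in> borel_measurable (lebesgue_on {r1<..<r2}) \<and>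
      (\<integral>\<^sup>+ r. \<eta> r \<partial>lebesgue_on {r1<..<r2}) \<ge> 1 \<longrightarrow>
      modulus (image_curves f D (joining (sphere x0 r1) (sphere x0 r2) D))
      \<le> (\<integral>\<^sup>+ x \<in> {x. r1 < norm (x - x0) \<and> norm (x - x0) < r2} \<inter> D.
            Q x * \<eta> (norm (x - x0)) ^ DIM('a) \<partial>lebesgue))"

definition ring_Q_mapping_in ::
    "('a::euclidean_space \<Rightarrow> ennreal) \<Rightarrow> 'a set \<Rightarrow> ('a \<Rightarrow> 'a onept) \<Rightarrow> 'a set \<Rightarrow> bool" where
  "ring_Q_mapping_in Q D f E \<longleftrightarrow> (\<forall>x0\<in>E. ring_Q_mapping_at Q D f x0)"

definition ring_Q_homeomorphism_in ::
    "('a::euclidean_space \<Rightarrow> ennreal) \<Rightarrow> 'a set \<Rightarrow> ('a \<Rightarrow> 'a onept) \<Rightarrow> 'a set \<Rightarrow> bool" where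
  "ring_Q_homeomorphism_in Q D f E \<longleftrightarrow>
    (\<exists>g. homeomorphism D (f ` D) f g) \<and> ring_Q_mapping_in Q D f E"


section \<open>Domains, continua and boundary regularity\<close>

definition is_domain :: "'b::topological_space set \<Rightarrow> bool" where
  "is_domain D \<longleftrightarrow> open D \<and> connected D \<and> D \<noteq> {}"

definition continuum :: "'b::topological_space set \<Rightarrow> bool" where
  "continuum K \<longleftrightarrow> compact K \<and> connected K"

definition locally_connected_at :: "'b::topological_space set \<Rightarrow> 'b \<Rightarrow> bool" where
  "locally_connected_at D x0 \<longleftrightarrow>
    (\<forall>U. open U \<and> x0 \<in> U \<longrightarrow> (\<exists>V. open V \<and> x0 \<in> V \<and> V \<subseteq> U \<and> connected (V \<inter> D)))"

definition locally_connected_on_boundary :: "'b::topological_space set \<Rightarrow> bool" where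
  "locally_connected_on_boundary D \<longleftrightarrow> (\<forall>x0\<in>frontier D. locally_connected_at D x0)"

definition weakly_flat_at :: "'a::euclidean_space onept set \<Rightarrow> 'a onept \<Rightarrow> bool" where
  "weakly_flat_at G x0 \<longleftrightarrow>
    (\<forall>P::real. \<forall>U. P > 0 \<and> open U \<and> x0 \<in> U \<longrightarrow>
      (\<exists>V. open V \<and> x0 \<in> V \<and> V \<subseteq> U \<and>
        (\<forall>E F. continuum E \<and> continuum F \<and> E \<subseteq> G \<and> F \<subseteq> G \<and>
           E \<inter> frontier U \<noteq> {} \<and> E \<inter> frontier V \<noteq> {} \<and>
           F \<inter> frontier U \<noteq> {} \<and> F \<inter> frontier V \<noteq> {} \<longrightarrow>
           modulus (joining E F G) > ennreal P)))"

definition weakly_flat_boundary :: "'a::euclidean_space onept set \<Rightarrow> bool" where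
  "weakly_flat_boundary G \<longleftrightarrow> (\<forall>x0\<in>frontier G. weakly_flat_at G x0)"


section \<open>The families of inverse mappings\<close>

text \<open>The diameter of a subset of the extended space is its chordal diameter.\<close>

definition inverse_family ::
    "real \<Rightarrow> 'a::euclidean_space set \<Rightarrow> ('a \<Rightarrow> ennreal) \<Rightarrow> 'a set \<Rightarrow> 'a onept set
      \<Rightarrow> ('a onept \<Rightarrow> 'a) set" where
  "inverse_family \<delta> A Q D D' =
    {g. \<exists>f. homeomorphism D' D g f \<and> ring_Q_homeomorphism_in Q D f (closure D) \<and>
          diameter (f ` A) \<ge> \<delta>}"

definition continuous_extension ::
    "'b::topological_space set \<Rightarrow> ('b \<Rightarrow> 'c::topological_space) \<Rightarrow> ('b \<Rightarrow> 'c) \<Rightarrow> bool" where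
  "continuous_extension S g gb \<longleftrightarrow> continuous_on (closure S) gb \<and> (\<forall>y\<in>S. gb y = g y)"

definition extended_inverse_family ::
    "real \<Rightarrow> 'a::euclidean_space set \<Rightarrow> ('a \<Rightarrow> ennreal) \<Rightarrow> 'a set \<Rightarrow> 'a onept set
      \<Rightarrow> ('a onept \<Rightarrow> 'a) set" where
  "extended_inverse_family \<delta> A Q D D' =
    {gb. \<exists>g\<in>inverse_family \<delta> A Q D D'. continuous_extension D' g gb}"

end

theory Submission
  imports Defs
begin

text \<open>
  Write \<open>f = g\<inverse>\<close>. Covering the bounded domain \<open>D\<close> by finitely many small balls and using the ring
  condition with a constant weight, the images under \<open>f\<close> of sets at a given distance are joined by curve
  families whose modulus is bounded independently of \<open>f\<close>. On the other hand, continua crossing a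
  ring whose inner neighborhood shrinks to \<open>y0\<close> are joined by curve families of large modulus: by weak
  flatness for \<open>y0\<close> in the boundary of \<open>D'\<close>, and by a capacity estimate for \<open>y0\<close> inside \<open>D'\<close>. Thus, if
  \<open>u\<close> and \<open>u'\<close> are close to \<open>y0\<close> while \<open>g u\<close> and \<open>g u'\<close> are apart, it suffices to put \<open>g u\<close> and \<open>g u'\<close>
  into continua that are apart and whose images leave a fixed neighborhood of \<open>y0\<close>. For interior \<open>y0\<close>
  take segments on opposite rays running towards the boundary of \<open>D\<close>; for boundary points take
  continua that reach \<open>A\<close>, since \<open>f(A)\<close> keeps away from \<open>y0\<close>.

  For the capacity estimate, space is foliated by the double cones over the discs of radius \<open>r\<close>
  orthogonal to a unit vector \<open>e\<close>. Two points of a cone are joined by paths through a random point of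
  an annulus; averaging shows that an admissible function has \<open>n\<close>-th power integral at least \<open>c / r\<close> on
  the cone, and integration over \<open>r\<close> gives the logarithm of the ratio of the radii.
\<close>

section \<open>The one-point compactification\<close>

text \<open>All bounds must be fixed before \<open>f\<close> is known. Given \<open>y0\<close>, a
  neighborhood \<open>U\<close> that the image continua have to leave and a distance \<eta> of the
  continua are found for the whole family; \<eta> determines the modulus bound \<open>C\<close>, and
  only then does weak flatness supply the inner neighborhood \<open>V\<close>.

  The main obstacle is a boundary point \<open>y0\<close>: a lower bound on the diameter of
  \<open>f(A)\<close> does not by itself prevent \<open>f(A)\<close> from coming close to
  \<open>y0\<close> for some members of the family. Here the boundary component of \<open>y0\<close>
  is used: it contains a second point, which the pieces of \<open>D'\<close> trapped near
  \<open>y0\<close> cannot approach. The resulting contradiction concerns one fixed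
  \<open>f\<close>, so the constants occurring in it may depend on \<open>f\<close>.

  The other obstacle is to lead two points to \<open>A\<close> along continua whose distance is
  bounded below uniformly in the points. Local connectedness on the boundary gives this near each
  pair of points of the closure of \<open>D\<close>, and compactness does the rest.\<close>

lemma dist_onept_stereo: "dist p q = dist (stereo p) (stereo q)"
  by (simp add: dist_onept_def chordal_stereo)

lemma continuous_on_stereo: "continuous_on S (stereo :: 'a::real_inner onept \<Rightarrow> _)"
  unfolding continuous_on_iff by (metis dist_onept_stereo)

lemma dist_Fin_le: "dist (Fin x) (Fin y) \<le> norm (x - y)" for x y :: "'a::real_inner"
proof -
  have "1 \<le> sqrt (1 + (norm x)\<^sup>2) * sqrt (1 + (norm y)\<^sup>2)"
    using mult_mono[of 1 "sqrt (1 + (norm x)\<^sup>2)" 1 "sqrt (1 + (norm y)\<^sup>2)"] by simp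
  then show ?thesis
    unfolding dist_onept_def by (simp add: divide_le_eq mult_left_le)
      (metis mult.right_neutral mult_left_mono norm_ge_zero)
qed

lemma continuous_on_Fin [continuous_intros]: "continuous_on S (Fin :: 'a::real_inner \<Rightarrow> _)"
  unfolding continuous_on_iff by (metis dist_Fin_le dist_norm le_less_trans)

text \<open>Inverse stereographic projection recovers a finite point as the horizontal part divided
  by one minus the height, an expression continuous away from the pole.\<close>

lemma continuous_on_the_fin: "continuous_on (range Fin) (the_fin :: 'a::real_inner onept \<Rightarrow> 'a)"
proof -
  have pos: "1 + (norm x)\<^sup>2 > 0" for x :: 'a by (simp add: add_pos_nonneg)
  have h: "1 - snd (stereo (Fin x)) = inverse (1 + (norm x)\<^sup>2)" for x :: 'a
    using pos[of x] by (simp add: field_simps)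
  have eq: "the_fin u = fst (stereo u) /\<^sub>R (1 - snd (stereo u))"
    if u: "u \<in> range Fin" for u :: "'a onept"
  proof -
    obtain x where x: "u = Fin x" using u by blast
    show ?thesis unfolding x h using pos[of x] by simp
  qed
  have "continuous_on (range Fin) (\<lambda>u :: 'a onept. fst (stereo u) /\<^sub>R (1 - snd (stereo u)))"
  proof (intro continuous_intros continuous_on_stereo ballI)
    fix u :: "'a onept" assume "u \<in> range Fin"
    then obtain x where x: "u = Fin x" by blast
    show "1 - snd (stereo u) \<noteq> 0" unfolding x h using pos[of x] by simp
  qed
  then show ?thesis
    by (rule continuous_on_eq) (rule eq[symmetric])
qed

lemma range_Fin: "range Fin = - {Infty}"
  by (auto intro: onept.exhaust)

lemma open_Fin_image: "open W \<Longrightarrow> open (Fin ` W)" for W :: "'a::real_inner set"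
proof -
  assume "open W"
  have "Fin ` W = the_fin -` W \<inter> range Fin" by force
  moreover have "open (range Fin :: 'a onept set)" by (simp add: range_Fin open_Compl)
  ultimately show ?thesis
    using continuous_open_preimage[OF continuous_on_the_fin _ \<open>open W\<close>]
    by (simp add: Int_commute)
qed

lemma closed_Fin_image: "compact K \<Longrightarrow> closed (Fin ` K)" for K :: "'a::real_inner set"
  by (simp add: compact_continuous_image compact_imp_closed continuous_on_Fin)

lemma open_Fin_obtain:
  fixes q :: "'a::real_inner"
  assumes "open N" "Fin q \<in> N"
  obtains s where "s > 0" "Fin ` cball q s \<subseteq> N"
proof -
  have "open (Fin -` N)"
    using assms(1) continuous_on_Fin[of "UNIV :: 'a set"] by (simp add: continuous_on_open_vimage)
  then obtain s where "s > 0" "cball q s \<subseteq> Fin -` N"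
    using assms(2) open_contains_cball by blast
  then show thesis using that by blast
qed

lemma open_Infty_obtain:
  fixes N :: "'a::real_inner onept set"
  assumes "open N" "Infty \<in> N"
  obtains R where "R > 0" "\<And>x. norm x \<ge> R \<Longrightarrow> Fin x \<in> N"
proof -
  obtain e where e: "e > 0" "ball Infty e \<subseteq> N"
    using assms open_contains_ball by blast
  \<comment> \<open>The chordal distance of \<open>Fin x\<close> from \<open>Infty\<close> is
    \<open>1 / sqrt (1 + (norm x)\<^sup>2)\<close>, hence smaller than
    \<open>1 / norm x\<close>.\<close>
  have "Fin x \<in> N" if "norm x \<ge> 1 / e" for x
  proof -
    have "1 / e < sqrt (1 + (norm x)\<^sup>2)"
      using e(1) that by (intro real_less_rsqrt) (simp add: power_mono add_strict_increasing)
    then have "dist Infty (Fin x) < e"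
      using e(1) by (simp add: dist_onept_def field_simps add_pos_nonneg)
    then show ?thesis using e(2) by auto
  qed
  then show thesis using e(1) that[of "1 / e"] by simp
qed

text \<open>In terms of the horizontal part \<open>v\<close> and the height \<open>h\<close> the
  sphere is \<open>(norm v)\<^sup>2 = h * (1 - h)\<close>, so away from the pole
  \<open>h / (1 - h)\<close> is the squared norm of the preimage; the pole comes from
  \<open>Infty\<close>.\<close>

lemma range_stereo: "range stereo = sphere (0, 1 / 2) (1 / 2 :: real)"
proof (intro subset_antisym subsetI)
  fix P :: "'a \<times> real"
  assume "P \<in> range stereo"
  then obtain u where u: "P = stereo u" by blast
  show "P \<in> sphere (0, 1 / 2) (1 / 2)"
  proof (cases u)
    case (Fin x)
    define X where "X = (norm x)\<^sup>2"
    have p: "1 + X > 0" by (simp add: X_def add_pos_nonneg)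
    have "(norm x / (1 + X))\<^sup>2 + (1 / 2 - X / (1 + X))\<^sup>2 = (1 / 2)\<^sup>2"
    proof -
      define i where "i = 1 / (1 + X)"
      have "X / (1 + X) = 1 - i" "(norm x / (1 + X))\<^sup>2 = (1 - i) * i"
        using p by (simp_all add: i_def power_divide flip: X_def) (simp_all add: field_simps power2_eq_square)
      then show ?thesis by (simp only:) (simp add: power2_eq_square algebra_simps)
    qed
    then have "sqrt ((norm x / (1 + X))\<^sup>2 + (1 / 2 - X / (1 + X))\<^sup>2) = 1 / 2"
      by simp
    moreover have "norm (- (x /\<^sub>R (1 + X))) = norm x / (1 + X)"
      using p by (simp add: divide_inverse_commute)
    ultimately show ?thesis
      unfolding u Fin by (simp only: stereo.simps mem_sphere dist_norm norm_Pair diff_Pair diff_0 norm_minus_cancel flip: X_def)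
        (simp add: power2_abs)
  qed (simp add: u dist_norm norm_prod_def)
next
  fix P :: "'a \<times> real"
  assume "P \<in> sphere (0, 1 / 2) (1 / 2)"
  then obtain v h where P: "P = (v, h)" and "norm (- v, 1 / 2 - h) = 1 / 2"
    by (cases P) (auto simp: dist_norm)
  then have "sqrt ((norm v)\<^sup>2 + (1 / 2 - h)\<^sup>2) = 1 / 2"
    by (simp add: norm_Pair)
  then have "(norm v)\<^sup>2 + (1 / 2 - h)\<^sup>2 = (1 / 2)\<^sup>2"
    by (metis real_sqrt_pow2 sum_power2_ge_zero)
  then have e: "(norm v)\<^sup>2 = h * (1 - h)" by (simp add: power2_eq_square algebra_simps)
  show "P \<in> range stereo"
  proof (cases "h = 1")
    case True
    then have "P = stereo Infty" using e P by simp
    then show ?thesis by blast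
  next
    case False
    define x where "x = v /\<^sub>R (1 - h)"
    have "(norm x)\<^sup>2 = (norm v)\<^sup>2 / (1 - h)\<^sup>2"
      by (simp add: x_def power_mult_distrib power_divide divide_inverse_commute power_inverse)
    also have "\<dots> = h / (1 - h)"
      unfolding e using False by (simp add: power2_eq_square)
    finally have n: "(norm x)\<^sup>2 = h / (1 - h)" .
    then have n1: "1 + (norm x)\<^sup>2 = inverse (1 - h)" using False by (simp add: field_simps)
    have "P = stereo (Fin x)"
      unfolding stereo.simps n1 unfolding n using False by (simp add: P x_def)
    then show ?thesis by blast
  qed
qed

text \<open>The space is an isometric copy of a sphere. Compactness later turns local estimates on
  the closure of \<open>D'\<close> into uniform ones and makes the images of the extended mappings
  closed.\<close>

lemma compact_onept: "compact (UNIV :: 'a::euclidean_space onept set)"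
proof -
  have inj: "inj (stereo :: 'a onept \<Rightarrow> _)"
    by (intro injI) (metis dist_eq_0_iff dist_onept_stereo)
  have "continuous_on (range stereo) (inv (stereo :: 'a onept \<Rightarrow> _))"
    unfolding continuous_on_iff using inj by (metis dist_onept_stereo inv_f_f imageE)
  moreover have "compact (range (stereo :: 'a onept \<Rightarrow> _))"
    by (simp add: range_stereo)
  ultimately have "compact (inv stereo ` range (stereo :: 'a onept \<Rightarrow> _))"
    by (rule compact_continuous_image)
  then show ?thesis using inj by (simp add: image_inv_f_f)
qed

section \<open>Arc length and line integrals\<close>

text \<open>A recursive form of the index sum in \<open>curve_length\<close>, so that concatenating
  partitions and inserting nodes become inductions over lists.\<close>

fun polygon_length :: "(real \<Rightarrow> 'b::metric_space) \<Rightarrow> real list \<Rightarrow> ennreal" where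
  "polygon_length c (x # y # zs) = ennreal (dist (c x) (c y)) + polygon_length c (y # zs)"
| "polygon_length c _ = 0"

lemma polygon_length_eq_sum:
  "polygon_length c ts = (\<Sum>i<length ts - 1. ennreal (dist (c (ts ! i)) (c (ts ! Suc i))))"
  by (induction c ts rule: polygon_length.induct) (simp_all add: sum.lessThan_Suc_shift del: sum.lessThan_Suc sum_ennreal)

lemma curve_length_polygon:
  "curve_length c a b = (SUP ts\<in>{ts. sorted ts \<and> set ts \<subseteq> {a..b}}. polygon_length c ts)"
  unfolding curve_length_def polygon_length_eq_sum ..

lemma polygon_length_le: "sorted ts \<Longrightarrow> set ts \<subseteq> {a..b} \<Longrightarrow> polygon_length c ts \<le> curve_length c a b"
  unfolding curve_length_polygon by (intro SUP_upper) simp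

lemma curve_length_leI:
  "(\<And>ts. sorted ts \<Longrightarrow> set ts \<subseteq> {a..b} \<Longrightarrow> polygon_length c ts \<le> B) \<Longrightarrow> curve_length c a b \<le> B"
  unfolding curve_length_polygon by (intro SUP_least) simp

lemma polygon_length_append:
  assumes "xs \<noteq> []" "ys \<noteq> []"
  shows "polygon_length c (xs @ ys) =
    polygon_length c xs + ennreal (dist (c (last xs)) (c (hd ys))) + polygon_length c ys"
  using assms(1)
proof (induction xs)
  case (Cons x xs)
  obtain y zs where ys: "ys = y # zs" using assms(2) by (cases ys) auto
  show ?case
  proof (cases xs)
    case (Cons x' xs')
    then show ?thesis using Cons.IH by (simp add: add_ac)
  qed (simp add: ys)
qed simp

lemma polygon_length_append_ge: "polygon_length c xs + polygon_length c ys \<le> polygon_length c (xs @ ys)"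
proof (cases "xs = [] \<or> ys = []")
  case False
  then show ?thesis
    by (simp add: polygon_length_append add.commute add_increasing2 add_left_mono add.assoc)
qed auto

lemma polygon_length_insert: "polygon_length c (xs @ ys) \<le> polygon_length c (xs @ m # ys)"
proof (cases "xs = [] \<or> ys = []")
  case True
  then show ?thesis
    using polygon_length_append_ge[of c xs "m # ys"] polygon_length_append_ge[of c "[m]" ys] by auto
next
  case False
  then obtain y zs where ys: "ys = y # zs" by (cases ys) auto
  have "ennreal (dist (c (last xs)) (c y)) \<le> ennreal (dist (c (last xs)) (c m)) + ennreal (dist (c m) (c y))"
    by (simp add: dist_triangle flip: ennreal_plus)
  then show ?thesis
    using False by (simp add: polygon_length_append ys add_left_mono add_right_mono flip: add.assoc)
qed

lemma polygon_length_cong: "(\<And>t. t \<in> set ts \<Longrightarrow> c t = d t) \<Longrightarrow> polygon_length c ts = polygon_length d ts"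
  by (induction c ts rule: polygon_length.induct) auto

lemma polygon_length_map: "polygon_length (c \<circ> \<phi>) ts = polygon_length c (map \<phi> ts)"
  by (induction "c \<circ> \<phi>" ts rule: polygon_length.induct) auto

lemma curve_length_cong:
  assumes "\<And>t. t \<in> {a..b} \<Longrightarrow> c t = d t"
  shows "curve_length c a b = curve_length d a b"
  unfolding curve_length_polygon
  by (intro SUP_cong refl polygon_length_cong) (use assms in auto)

lemma curve_length_compose_le:
  assumes "mono_on {a..b} \<phi>"
  shows "curve_length (c \<circ> \<phi>) a b \<le> curve_length c (\<phi> a) (\<phi> b)"
proof (rule curve_length_leI)
  fix ts assume ts: "sorted ts" "set ts \<subseteq> {a..b}"
  have "sorted (map \<phi> ts)"
    unfolding sorted_map
    by (rule sorted_wrt_mono_rel[OF _ ts(1)]) (use ts assms in \<open>auto simp: mono_on_def subset_iff\<close>)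
  moreover have "set (map \<phi> ts) \<subseteq> {\<phi> a..\<phi> b}"
    using ts assms unfolding mono_on_def by fastforce
  ultimately show "polygon_length (c \<circ> \<phi>) ts \<le> curve_length c (\<phi> a) (\<phi> b)"
    unfolding polygon_length_map by (rule polygon_length_le)
qed

lemma curve_length_dist_le:
  assumes "a \<le> b"
  shows "ennreal (dist (c a) (c b)) \<le> curve_length c a b"
  using polygon_length_le[of "[a, b]" a b c] assms by simp

lemma curve_length_refl [simp]: "curve_length c a a = 0"
proof -
  have "polygon_length c ts = 0" if "set ts \<subseteq> {a..a}" for ts
    using that by (induction c ts rule: polygon_length.induct) auto
  then show ?thesis
    using curve_length_leI[of a a c 0] by simp
qed

lemma sorted_eq_filter_append:
  "sorted ts \<Longrightarrow> ts = filter (\<lambda>t. t \<le> m) ts @ filter (\<lambda>t. \<not> t \<le> m) ts" for m :: real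
proof (induction ts)
  case (Cons a ts)
  show ?case
  proof (cases "a \<le> m")
    case False
    then have "filter (\<lambda>t. t \<le> m) (a # ts) = []" "filter (\<lambda>t. \<not> t \<le> m) (a # ts) = a # ts"
      using Cons.prems by (auto simp: filter_empty_conv filter_id_conv)
    then show ?thesis by simp
  qed (use Cons in simp)
qed simp

lemma curve_length_add:
  assumes "a \<le> m" "m \<le> b"
  shows "curve_length c a b = curve_length c a m + curve_length c m b"
proof (rule antisym)
  show "curve_length c a b \<le> curve_length c a m + curve_length c m b"
  proof (rule curve_length_leI)
    fix ts assume ts: "sorted ts" "set ts \<subseteq> {a..b}"
    define xs where "xs = filter (\<lambda>t. t \<le> m) ts"
    define ys where "ys = filter (\<lambda>t. \<not> t \<le> m) ts"
    have eq: "ts = xs @ ys"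
      using sorted_eq_filter_append[OF ts(1)] by (simp add: xs_def ys_def)
    have xs: "sorted (xs @ [m])" "set (xs @ [m]) \<subseteq> {a..m}"
      using ts assms by (auto simp: xs_def sorted_append sorted_wrt_filter)
    have ys: "sorted (m # ys)" "set (m # ys) \<subseteq> {m..b}"
      using ts assms by (auto simp: ys_def sorted_wrt_filter)
    have "polygon_length c ts \<le> polygon_length c (xs @ m # ys)"
      unfolding eq by (rule polygon_length_insert)
    \<comment> \<open>The node \<open>m\<close> is doubled, so that each half of the partition
      contains it.\<close>
    also have "\<dots> \<le> polygon_length c ((xs @ [m]) @ m # ys)"
      using polygon_length_insert[of c "xs" "m # ys" m] by simp
    also have "\<dots> = polygon_length c (xs @ [m]) + polygon_length c (m # ys)"
      by (subst polygon_length_append) auto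
    also have "\<dots> \<le> curve_length c a m + curve_length c m b"
      by (intro add_mono polygon_length_le xs ys)
    finally show "polygon_length c ts \<le> curve_length c a m + curve_length c m b" .
  qed
next
  have *: "polygon_length c xs + polygon_length c ys \<le> curve_length c a b"
    if "sorted xs" "set xs \<subseteq> {a..m}" "sorted ys" "set ys \<subseteq> {m..b}" for xs ys
  proof -
    have "sorted (xs @ ys)" "set (xs @ ys) \<subseteq> {a..b}"
      using that assms by (force simp: sorted_append)+
    then show ?thesis
      using polygon_length_append_ge polygon_length_le order_trans by blast
  qed
  have ne: "{ts. sorted ts \<and> set ts \<subseteq> {u..v}} \<noteq> {}" for u v :: real
    by (rule ex_in_conv[THEN iffD1]) (rule exI[of _ "[]"], simp)
  let ?P = "\<lambda>u v. {ts. sorted ts \<and> set ts \<subseteq> {u..v}}"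
  have "curve_length c a m + curve_length c m b =
      (SUP xs\<in>?P a m. polygon_length c xs + curve_length c m b)"
    unfolding curve_length_polygon[of c a m] by (rule ennreal_SUP_add_left[OF ne, symmetric])
  also have "\<dots> \<le> curve_length c a b"
  proof (rule SUP_least)
    fix xs assume xs: "xs \<in> ?P a m"
    have "polygon_length c xs + curve_length c m b =
        (SUP ys\<in>?P m b. polygon_length c xs + polygon_length c ys)"
      unfolding curve_length_polygon[of c m b] by (rule ennreal_SUP_add_right[OF ne])
    also have "\<dots> \<le> curve_length c a b"
      by (rule SUP_least) (use * xs in auto)
    finally show "polygon_length c xs + curve_length c m b \<le> curve_length c a b" .
  qed
  finally show "curve_length c a m + curve_length c m b \<le> curve_length c a b" .
qed

text \<open>\<open>S\<close> consists of the nodes of a polygon whose length is within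
  \<open>e\<close> of the supremum. An arc with no node in its interior can therefore exceed its
  chord only by \<open>e\<close>. This is the source of the continuity of arc length.\<close>

lemma curve_length_gap:
  assumes fin: "curve_length c a b < \<infinity>" and "e > 0"
  obtains S where "finite S" "\<And>u v. a \<le> u \<Longrightarrow> u \<le> v \<Longrightarrow> v \<le> b \<Longrightarrow> {u<..<v} \<inter> S = {} \<Longrightarrow>
    curve_length c u v \<le> ennreal (dist (c u) (c v)) + ennreal e"
proof (cases "curve_length c a b = 0")
  case True
  show thesis
  proof (rule that[of "{}"])
    fix u v assume "a \<le> u" "u \<le> v" "v \<le> b"
    then have "curve_length c u v \<le> curve_length c a b"
      using curve_length_add[of a u b c] curve_length_add[of u v b c]
      by (metis add_increasing add_increasing2 order_refl order_trans zero_le)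
    then show "curve_length c u v \<le> ennreal (dist (c u) (c v)) + ennreal e" using True by simp
  qed simp
next
  case False
  define l where "l = curve_length c a b"
  have "l - ennreal e < l"
    using False fin \<open>e > 0\<close> by (simp add: l_def ennreal_between ennreal_less_zero_iff zero_less_iff_neq_zero)
  then obtain ts where ts: "sorted ts" "set ts \<subseteq> {a..b}" "l - ennreal e < polygon_length c ts"
    unfolding l_def curve_length_polygon[of c a b] less_SUP_iff by auto
  show thesis
  proof (rule that[of "set ts"])
    fix u v assume uv: "a \<le> u" "u \<le> v" "v \<le> b" "{u<..<v} \<inter> set ts = {}"
    define xs where "xs = filter (\<lambda>t. t \<le> u) ts"
    define ys where "ys = filter (\<lambda>t. \<not> t \<le> u) ts"
    have eq: "ts = xs @ ys"
      using sorted_eq_filter_append[OF ts(1)] by (simp add: xs_def ys_def)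
    have xs: "sorted (xs @ [u])" "set (xs @ [u]) \<subseteq> {a..u}"
      using ts uv by (auto simp: xs_def sorted_append sorted_wrt_filter)
    have "v \<le> t" if "t \<in> set ys" for t
      using that uv(4) unfolding ys_def by (auto simp: disjoint_iff not_le not_less)
    then have ys: "sorted (v # ys)" "set (v # ys) \<subseteq> {v..b}"
      using ts uv by (auto simp: ys_def sorted_wrt_filter)
    have "polygon_length c ts \<le> polygon_length c (xs @ u # ys)"
      unfolding eq by (rule polygon_length_insert)
    also have "\<dots> \<le> polygon_length c ((xs @ [u]) @ v # ys)"
      using polygon_length_insert[of c "xs @ [u]" ys v] by simp
    also have "\<dots> = polygon_length c (xs @ [u]) + ennreal (dist (c u) (c v)) + polygon_length c (v # ys)"
      by (subst polygon_length_append) auto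
    also have "\<dots> \<le> curve_length c a u + ennreal (dist (c u) (c v)) + curve_length c v b"
      by (intro add_mono order_refl polygon_length_le xs ys)
    finally have 1: "polygon_length c ts \<le> curve_length c a u + ennreal (dist (c u) (c v)) + curve_length c v b" .
    have 2: "l = curve_length c a u + curve_length c u v + curve_length c v b"
      using curve_length_add[of a u b c] curve_length_add[of u v b c] uv by (simp add: l_def add.assoc)
    \<comment> \<open>All three pieces are finite, so the comparison can be made in the reals, where
      common summands cancel.\<close>
    define A B C where "A = enn2real (curve_length c a u)" and "B = enn2real (curve_length c u v)"
      and "C = enn2real (curve_length c v b)"
    have "curve_length c a u \<noteq> top" "curve_length c u v \<noteq> top" "curve_length c v b \<noteq> top"
      using fin 2 by (auto simp: l_def)
    then have eqs: "curve_length c a u = ennreal A" "curve_length c u v = ennreal B" "curve_length c v b = ennreal C"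
      and nn: "A \<ge> 0" "B \<ge> 0" "C \<ge> 0"
      by (simp_all add: A_def B_def C_def less_top)
    have "l - ennreal e < ennreal (A + dist (c u) (c v) + C)"
      using ts(3) 1 eqs nn by (simp flip: ennreal_plus)
    moreover have "l = ennreal (A + B + C)" using 2 eqs nn by (simp flip: ennreal_plus)
    ultimately have "ennreal (A + B + C - e) < ennreal (A + dist (c u) (c v) + C)"
      using \<open>e > 0\<close> by (simp add: ennreal_minus)
    then have "B \<le> dist (c u) (c v) + e"
      using ennreal_leI[of "A + dist (c u) (c v) + C" "A + B + C - e"] by (intro leI notI) (simp add: not_le)
    then show "curve_length c u v \<le> ennreal (dist (c u) (c v)) + ennreal e"
      using \<open>e > 0\<close> by (simp add: eqs ennreal_leI flip: ennreal_plus)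
  qed simp
qed


lemma curve_length_mono:
  assumes "a \<le> a'" "b' \<le> b"
  shows "curve_length c a' b' \<le> curve_length c a b"
  using assms by (intro curve_length_leI polygon_length_le) auto

lemma polygon_length_lipschitz:
  assumes lip: "\<And>u v. a \<le> u \<Longrightarrow> u \<le> v \<Longrightarrow> v \<le> b \<Longrightarrow> dist (c u) (c v) \<le> M * (v - u)" and "0 \<le> M"
    and "sorted (t # ts)" "set (t # ts) \<subseteq> {a..b}"
  shows "polygon_length c (t # ts) \<le> ennreal (M * (b - t))"
  using assms(3,4)
proof (induction ts arbitrary: t)
  case (Cons u ts)
  have "polygon_length c (t # u # ts) \<le> ennreal (M * (u - t)) + ennreal (M * (b - u))"
    using Cons by (auto intro!: add_mono ennreal_leI lip)
  also have "\<dots> = ennreal (M * (b - t))"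
    using Cons.prems \<open>0 \<le> M\<close> by (subst ennreal_plus[symmetric]) (auto simp: algebra_simps mult_left_mono)
  finally show ?case .
qed simp

lemma curve_length_lipschitz:
  assumes lip: "\<And>u v. a \<le> u \<Longrightarrow> u \<le> v \<Longrightarrow> v \<le> b \<Longrightarrow> dist (c u) (c v) \<le> M * (v - u)"
    and "0 \<le> M"
  shows "curve_length c a b \<le> ennreal (M * (b - a))"
proof (rule curve_length_leI)
  fix ts assume ts: "sorted ts" "set ts \<subseteq> {a..b}"
  show "polygon_length c ts \<le> ennreal (M * (b - a))"
  proof (cases ts)
    case (Cons u us)
    have "polygon_length c ts \<le> ennreal (M * (b - u))"
      using ts unfolding Cons by (intro polygon_length_lipschitz[OF lip \<open>0 \<le> M\<close>])
    also have "\<dots> \<le> ennreal (M * (b - a))"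
      using ts \<open>0 \<le> M\<close> by (intro ennreal_leI mult_left_mono) (auto simp: Cons)
    finally show ?thesis .
  qed simp
qed

section \<open>Arc length as a parameter on rectifiable curves\<close>

locale rectifiable_curve =
  fixes c :: "real \<Rightarrow> 'b::metric_space" and a b :: real
  assumes le: "a \<le> b" and cont: "continuous_on {a..b} c" and fin: "curve_length c a b < \<infinity>"
begin

definition arclen :: "real \<Rightarrow> real" where
  "arclen t = enn2real (curve_length c a t)"

lemma sub: "a \<le> u \<Longrightarrow> u \<le> v \<Longrightarrow> v \<le> b \<Longrightarrow> rectifiable_curve c u v"
  using le_less_trans[OF curve_length_mono[of a u v b c] fin]
  by unfold_locales (auto intro: continuous_on_subset[OF cont])

lemma arclen_eq: "t \<le> b \<Longrightarrow> curve_length c a t = ennreal (arclen t)"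
  using le_less_trans[OF curve_length_mono[of a a t b c] fin] by (simp add: arclen_def)

lemma arc_diff:
  assumes "a \<le> u" "u \<le> v" "v \<le> b"
  shows "curve_length c u v = ennreal (arclen v - arclen u)" "arclen u \<le> arclen v"
proof -
  interpret uv: rectifiable_curve c u v using assms by (rule sub)
  have nn: "0 \<le> uv.arclen v" "0 \<le> arclen u" by (simp_all add: uv.arclen_def arclen_def)
  then have "ennreal (arclen v) = ennreal (arclen u + uv.arclen v)"
    using curve_length_add[of a u v c] assms by (simp add: arclen_eq uv.arclen_eq)
  then have "arclen v = arclen u + uv.arclen v"
    using nn by (subst (asm) ennreal_inj) (auto simp: arclen_def)
  then show "curve_length c u v = ennreal (arclen v - arclen u)" "arclen u \<le> arclen v"
    using nn by (simp_all add: uv.arclen_eq)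
qed

lemma dist_le_arc: "a \<le> u \<Longrightarrow> u \<le> v \<Longrightarrow> v \<le> b \<Longrightarrow> dist (c u) (c v) \<le> arclen v - arclen u"
  using curve_length_dist_le[of u v c] arc_diff[of u v] by (simp add: ennreal_le_iff)

lemma dist_le_abs_arc:
  assumes "u \<in> {a..b}" "v \<in> {a..b}"
  shows "dist (c u) (c v) \<le> \<bar>arclen u - arclen v\<bar>"
proof (cases "u \<le> v")
  case True
  then show ?thesis using dist_le_arc[of u v] assms by simp
next
  case False
  then show ?thesis using dist_le_arc[of v u] assms by (simp add: dist_commute)
qed

lemma arc_a [simp]: "arclen a = 0"
  by (simp add: arclen_def)

lemma arc_nonneg: "0 \<le> arclen t"
  by (simp add: arclen_def)

text \<open>If \<open>y\<close> is close to \<open>x\<close>, no node of a nearly optimal polygon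
  lies strictly between them, so the increment of arc length is at most the chord plus
  \<open>e / 2\<close>; the chord is small since the curve is continuous.\<close>

lemma continuous_on_arc: "continuous_on {a..b} arclen"
proof (unfold continuous_on_iff, intro ballI allI impI)
  fix x e :: real assume x: "x \<in> {a..b}" and e: "0 < e"
  obtain S where S: "finite S" "\<And>u v. a \<le> u \<Longrightarrow> u \<le> v \<Longrightarrow> v \<le> b \<Longrightarrow> {u<..<v} \<inter> S = {} \<Longrightarrow>
      curve_length c u v \<le> ennreal (dist (c u) (c v)) + ennreal (e / 2)"
    using curve_length_gap[OF fin, of "e / 2"] e by auto
  obtain d1 where d1: "d1 > 0" "\<And>y. y \<in> {a..b} \<Longrightarrow> dist y x < d1 \<Longrightarrow> dist (c y) (c x) < e / 2"
    using cont x e unfolding continuous_on_iff by (meson half_gt_zero)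
  \<comment> \<open>The point \<open>x\<close> may itself be a node. This does no harm, as
    \<open>x\<close> is an end point of the open interval in question.\<close>
  obtain d2 where d2: "d2 > 0" "\<And>y. y \<in> S \<Longrightarrow> y \<noteq> x \<Longrightarrow> d2 \<le> dist x y"
    using finite_set_avoid[OF S(1), of x] by blast
  show "\<exists>d>0. \<forall>y\<in>{a..b}. dist y x < d \<longrightarrow> dist (arclen y) (arclen x) < e"
  proof (intro exI conjI ballI impI)
    show "0 < min d1 d2" using d1 d2 by simp
    fix y assume y: "y \<in> {a..b}" and d: "dist y x < min d1 d2"
    define u v where "u = min x y" and "v = max x y"
    have uv: "a \<le> u" "u \<le> v" "v \<le> b" using x y by (auto simp: u_def v_def)
    have "{u<..<v} \<inter> S = {}"
      using d2(2) d by (fastforce simp: u_def v_def dist_real_def min_def max_def split: if_splits)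
    then have "ennreal (arclen v - arclen u) \<le> ennreal (dist (c u) (c v) + e / 2)"
      using S(2)[OF uv] arc_diff[OF uv] e by simp
    then have "arclen v - arclen u \<le> dist (c u) (c v) + e / 2"
      using e by (subst (asm) ennreal_le_iff) auto
    also have "dist (c u) (c v) < e / 2"
    proof -
      have "dist (c y) (c x) < e / 2" using d1(2)[OF y] d by simp
      then show ?thesis by (cases "x \<le> y") (simp_all add: u_def v_def dist_commute)
    qed
    finally have "arclen v - arclen u < e" by simp
    moreover have "arclen u \<le> arclen v" using arc_diff(2)[OF uv] .
    ultimately show "dist (arclen y) (arclen x) < e"
      by (auto simp: u_def v_def dist_real_def min_def max_def split: if_splits)
  qed
qed

lemma arc_image: "arclen ` {a..b} = {0..arclen b}"
proof (intro subset_antisym subsetI)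
  fix s assume "s \<in> {0..arclen b}"
  then show "s \<in> arclen ` {a..b}"
    using IVT'[of arclen a s b] le continuous_on_arc by auto
qed (use arc_diff(2) arc_nonneg in auto)

lemma arclength_param_arc:
  assumes t: "t \<in> {a..b}"
  shows "arclength_param c a b (arclen t) = c t"
proof -
  define t' where "t' = (SOME t'. t' \<in> {a..b} \<and> curve_length c a t' = ennreal (arclen t))"
  have t': "t' \<in> {a..b} \<and> curve_length c a t' = ennreal (arclen t)"
    unfolding t'_def by (rule someI[of _ t]) (use t arclen_eq in auto)
  then have "arclen t' = arclen t" by (simp add: arclen_def arc_nonneg)
  then have "dist (c t) (c t') \<le> 0"
    using dist_le_abs_arc[of t t'] t t' by simp
  then show ?thesis unfolding arclength_param_def t'_def[symmetric] by simp
qed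

lemma arclength_param_dist:
  assumes "s \<in> {0..arclen b}" "s' \<in> {0..arclen b}"
  shows "dist (arclength_param c a b s) (arclength_param c a b s') \<le> dist s s'"
proof -
  obtain t t' where t: "t \<in> {a..b}" "s = arclen t" and t': "t' \<in> {a..b}" "s' = arclen t'"
    using assms arc_image by (metis imageE)
  then show ?thesis
    using dist_le_abs_arc[of t t'] arclength_param_arc by (simp add: dist_real_def)
qed

lemma measurable_arclength_param:
  fixes \<rho> :: "'b \<Rightarrow> ennreal"
  assumes "\<rho> \<in> borel_measurable borel"
  shows "(\<lambda>s. \<rho> (arclength_param c a b s) * indicator {0..arclen b} s) \<in> borel_measurable borel"
proof -
  have "continuous_on {0..arclen b} (arclength_param c a b)"
    unfolding continuous_on_iff using arclength_param_dist
    by (intro ballI allI impI) (rule exI, rule conjI, assumption, blast intro: le_less_trans)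
  then have "arclength_param c a b \<in> borel_measurable (restrict_space borel {0..arclen b})"
    by (rule borel_measurable_continuous_on_restrict)
  from measurable_compose[OF this assms] show ?thesis
    by (subst (asm) borel_measurable_restrict_space_iff_ennreal) auto
qed

text \<open>Any \<open>q\<close> that reproduces the curve along its arc length may replace the
  chosen parametrisation; in this way subcurves and reparametrised curves are compared with the
  original one.\<close>

lemma rect_line_integral_eq:
  assumes "\<And>t. t \<in> {a..b} \<Longrightarrow> q (arclen t) = c t"
  shows "rect_line_integral \<rho> c a b = (\<integral>\<^sup>+ s \<in> {0..arclen b}. \<rho> (q s) \<partial>lborel)"
  unfolding rect_line_integral_def arclen_def[symmetric]
proof (intro nn_integral_cong)
  fix s
  show "\<rho> (arclength_param c a b s) * indicator {0..arclen b} s = \<rho> (q s) * indicator {0..arclen b} s"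
  proof (cases "s \<in> {0..arclen b}")
    case True
    then obtain t where "t \<in> {a..b}" "s = arclen t" using arc_image by (metis imageE)
    then show ?thesis using assms arclength_param_arc by simp
  qed simp
qed

lemma rect_line_integral_ge:
  assumes "\<And>t. t \<in> {a..b} \<Longrightarrow> k \<le> \<rho> (c t)"
  shows "k * ennreal (dist (c a) (c b)) \<le> rect_line_integral \<rho> c a b"
proof -
  have "k * ennreal (dist (c a) (c b)) \<le> k * ennreal (arclen b)"
    using dist_le_arc[of a b] le by (intro mult_left_mono ennreal_leI) auto
  also have "\<dots> = (\<integral>\<^sup>+ s \<in> {0..arclen b}. k \<partial>lborel)"
    using arc_nonneg by (simp add: nn_integral_cmult_indicator)
  also have "\<dots> \<le> (\<integral>\<^sup>+ s \<in> {0..arclen b}. \<rho> (arclength_param c a b s) \<partial>lborel)"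
  proof (intro nn_integral_mono)
    fix s
    show "k * indicator {0..arclen b} s \<le> \<rho> (arclength_param c a b s) * indicator {0..arclen b} s"
    proof (cases "s \<in> {0..arclen b}")
      case True
      then obtain t where "t \<in> {a..b}" "s = arclen t" using arc_image by (metis imageE)
      then show ?thesis using assms[of t] arclength_param_arc[of t] by (simp add: mult_right_mono)
    qed simp
  qed
  finally show ?thesis by (simp add: rect_line_integral_def arclen_def)
qed

text \<open>In terms of arc length all three are integrals of one function \<open>h\<close>, over
  \<open>{0..arclen b}\<close> and over two parts of it. The parts share a point, so the splitting
  is claimed as an inequality.\<close>

lemma rect_line_integral_split:
  assumes m: "a \<le> m" "m \<le> b" and \<rho>: "\<rho> \<in> borel_measurable borel"
  shows "rect_line_integral \<rho> c a b \<le> rect_line_integral \<rho> c a m + rect_line_integral \<rho> c m b"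
    and "rect_line_integral \<rho> c a m \<le> rect_line_integral \<rho> c a b"
    and "rect_line_integral \<rho> c m b \<le> rect_line_integral \<rho> c a b"
proof -
  interpret am: rectifiable_curve c a m using m by (intro sub) auto
  interpret mb: rectifiable_curve c m b using m by (intro sub) auto
  define h where "h s = \<rho> (arclength_param c a b s) * indicator {0..arclen b} s" for s
  have h: "h \<in> borel_measurable borel"
    using measurable_arclength_param[OF \<rho>] unfolding h_def .
  have arcs: "mb.arclen b = arclen b - arclen m" "arclen m \<le> arclen b" "0 \<le> arclen m"
    using m arc_diff[of m b] by (auto simp: am.arclen_def arclen_def mb.arclen_def)
  have mbt: "mb.arclen t + arclen m = arclen t" if "t \<in> {m..b}" for t
    using that arc_diff[of m t] m by (simp add: mb.arclen_def)
  have ab: "rect_line_integral \<rho> c a b = (\<integral>\<^sup>+ s \<in> {0..arclen b}. h s \<partial>lborel)"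
    unfolding rect_line_integral_def arclen_def[symmetric] h_def
    by (intro nn_integral_cong) (auto split: split_indicator)
  have am: "rect_line_integral \<rho> c a m = (\<integral>\<^sup>+ s \<in> {0..arclen m}. h s \<partial>lborel)"
  proof -
    have "rect_line_integral \<rho> c a m = (\<integral>\<^sup>+ s \<in> {0..arclen m}. \<rho> (arclength_param c a b s) \<partial>lborel)"
      by (intro am.rect_line_integral_eq) (use m arclength_param_arc in auto)
    also have "\<dots> = (\<integral>\<^sup>+ s \<in> {0..arclen m}. h s \<partial>lborel)"
      unfolding h_def using arcs by (intro nn_integral_cong) (auto split: split_indicator)
    finally show ?thesis .
  qed
  \<comment> \<open>The arc length of the second half starts anew at \<open>m\<close>, hence the
    shift by \<open>arclen m\<close>.\<close>
  have mb: "rect_line_integral \<rho> c m b = (\<integral>\<^sup>+ s \<in> {arclen m..arclen b}. h s \<partial>lborel)"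
  proof -
    have "rect_line_integral \<rho> c m b =
        (\<integral>\<^sup>+ s \<in> {0..mb.arclen b}. \<rho> (arclength_param c a b (s + arclen m)) \<partial>lborel)"
      by (intro mb.rect_line_integral_eq) (use m arclength_param_arc mbt in auto)
    also have "\<dots> = (\<integral>\<^sup>+ s. h (arclen m + 1 * s) * indicator {arclen m..arclen b} (arclen m + 1 * s) \<partial>lborel)"
      unfolding arcs h_def using arcs
      by (intro nn_integral_cong) (auto split: split_indicator simp: add.commute)
    also have "\<dots> = (\<integral>\<^sup>+ s \<in> {arclen m..arclen b}. h s \<partial>lborel)"
      using nn_integral_real_affine[of "\<lambda>s. h s * indicator {arclen m..arclen b} s" 1 "arclen m"] h by simp
    finally show ?thesis .
  qed
  have "rect_line_integral \<rho> c a b \<le>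
      (\<integral>\<^sup>+ s. h s * indicator {0..arclen m} s + h s * indicator {arclen m..arclen b} s \<partial>lborel)"
    unfolding ab by (intro nn_integral_mono) (auto split: split_indicator)
  also have "\<dots> = rect_line_integral \<rho> c a m + rect_line_integral \<rho> c m b"
    unfolding am mb using h by (intro nn_integral_add) auto
  finally show "rect_line_integral \<rho> c a b \<le> rect_line_integral \<rho> c a m + rect_line_integral \<rho> c m b" .
  show "rect_line_integral \<rho> c a m \<le> rect_line_integral \<rho> c a b"
    "rect_line_integral \<rho> c m b \<le> rect_line_integral \<rho> c a b"
    unfolding ab am mb using arcs by (intro nn_integral_mono; auto split: split_indicator)+
qed

end

text \<open>Arc length is invariant under increasing affine maps: the two inequalities come from
  monotone substitution, by the map and by its inverse.\<close>

lemma rect_line_integral_affine: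
  fixes c :: "real \<Rightarrow> 'b::metric_space"
  assumes "rectifiable_curve c (k * a + m) (k * b + m)" and k: "0 < k" and "a \<le> b"
    and d: "\<And>t. t \<in> {a..b} \<Longrightarrow> d t = c (k * t + m)"
  shows "rectifiable_curve d a b"
    and "rect_line_integral \<rho> d a b = rect_line_integral \<rho> c (k * a + m) (k * b + m)"
proof -
  let ?\<phi> = "\<lambda>t. k * t + m" and ?\<psi> = "\<lambda>s. (s - m) / k"
  interpret c: rectifiable_curve c "k * a + m" "k * b + m" by fact
  have len: "curve_length d u v = curve_length c (?\<phi> u) (?\<phi> v)" if "a \<le> u" "v \<le> b" for u v
  proof -
    have "curve_length d u v = curve_length (c \<circ> ?\<phi>) u v"
      using that d by (intro curve_length_cong) auto
    also have "\<dots> = curve_length c (?\<phi> u) (?\<phi> v)"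
    proof (rule antisym)
      show "curve_length (c \<circ> ?\<phi>) u v \<le> curve_length c (?\<phi> u) (?\<phi> v)"
        using k by (intro curve_length_compose_le) (auto intro!: mono_onI)
      have "(c \<circ> ?\<phi>) \<circ> ?\<psi> = c" using k by auto
      then show "curve_length c (?\<phi> u) (?\<phi> v) \<le> curve_length (c \<circ> ?\<phi>) u v"
        using curve_length_compose_le[of "?\<phi> u" "?\<phi> v" ?\<psi> "c \<circ> ?\<phi>"] k
        by (auto simp: mono_on_def divide_right_mono)
    qed
    finally show ?thesis .
  qed
  have "continuous_on {a..b} (\<lambda>t. c (?\<phi> t))"
    by (rule continuous_on_compose2[OF c.cont]) (use k in \<open>auto intro!: continuous_intros\<close>)
  then have "continuous_on {a..b} d"
    by (rule continuous_on_eq) (simp add: d)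
  then show "rectifiable_curve d a b"
    using \<open>a \<le> b\<close> c.fin len[of a b] by unfold_locales auto
  then interpret d: rectifiable_curve d a b .
  have arclen: "d.arclen t = c.arclen (?\<phi> t)" if "t \<in> {a..b}" for t
    using that len by (simp add: d.arclen_def c.arclen_def)
  have "rect_line_integral \<rho> d a b =
      (\<integral>\<^sup>+ s \<in> {0..d.arclen b}. \<rho> (arclength_param c (?\<phi> a) (?\<phi> b) s) \<partial>lborel)"
  proof (rule d.rect_line_integral_eq)
    fix t assume t: "t \<in> {a..b}"
    then have "?\<phi> t \<in> {?\<phi> a..?\<phi> b}" using k by simp
    then show "arclength_param c (?\<phi> a) (?\<phi> b) (d.arclen t) = d t"
      by (subst arclen[OF t], subst d[OF t]) (rule c.arclength_param_arc)
  qed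
  then show "rect_line_integral \<rho> d a b = rect_line_integral \<rho> c (k * a + m) (k * b + m)"
    using \<open>a \<le> b\<close> by (simp add: arclen rect_line_integral_def flip: c.arclen_def)
qed


text \<open>Cover \<open>X\<close> by countably many almost disjoint intervals with total length at
  most that of \<open>X\<close> plus \<open>e'\<close>; each is sent into an interval at most
  \<open>M\<close> times as long. A measurable \<open>B\<close> inside the image takes the place of
  the image, so that the measurability of the latter is not at issue.\<close>

lemma emeasure_mono_lipschitz_image:
  fixes \<sigma> :: "real \<Rightarrow> real"
  assumes "a \<le> b" and M: "0 \<le> M"
    and mono: "\<And>u v. a \<le> u \<Longrightarrow> u \<le> v \<Longrightarrow> v \<le> b \<Longrightarrow> \<sigma> u \<le> \<sigma> v"
    and lip: "\<And>u v. a \<le> u \<Longrightarrow> u \<le> v \<Longrightarrow> v \<le> b \<Longrightarrow> \<sigma> v - \<sigma> u \<le> M * (v - u)"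
    and X: "X \<in> sets borel" "X \<subseteq> {a..b}" and B: "B \<in> sets borel" "B \<subseteq> \<sigma> ` X"
  shows "emeasure lborel B \<le> ennreal M * emeasure lborel X"
proof (rule ennreal_le_epsilon)
  fix e :: real assume e: "0 < e"
  \<comment> \<open>Dividing by \<open>M + 1\<close> also covers \<open>M = 0\<close>.\<close>
  define e' where "e' = e / (M + 1)"
  have e': "0 < e'" "M * e' \<le> e" using e M by (auto simp: e'_def field_simps)
  have Xm: "X \<in> lmeasurable"
    using X bounded_subset[OF bounded_closed_interval X(2)] by (intro bounded_set_imp_lmeasurable) auto
  obtain \<D> where D: "countable \<D>" "\<And>K. K \<in> \<D> \<Longrightarrow> K \<subseteq> cbox a b \<and> K \<noteq> {} \<and> (\<exists>c d. K = cbox c d)"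
      "pairwise (\<lambda>A B. interior A \<inter> interior B = {}) \<D>"
      "X \<subseteq> \<Union>\<D>" "\<Union>\<D> \<in> lmeasurable" "measure lebesgue (\<Union>\<D>) \<le> measure lebesgue X + e'"
  proof (rule measurable_outer_intervals_bounded[OF Xm _ e'(1), of a b])
    show "X \<subseteq> cbox a b" using X(2) by simp
  qed (rule that; assumption)
  define I where "I i = (if i \<in> to_nat_on \<D> ` \<D> then from_nat_into \<D> i else {})" for i
  have I_to: "I (to_nat_on \<D> K) = K" if "K \<in> \<D>" for K
    using that D(1) by (simp add: I_def)
  have I_cases: "I i \<in> \<D> \<and> to_nat_on \<D> (I i) = i \<or> I i = {}" for i
    using D(1) by (auto simp: I_def)
  have I_box: "\<exists>c d. I i = {c..d} \<and> (c \<le> d \<longrightarrow> a \<le> c \<and> d \<le> b)" for i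
  proof (cases "I i = {}")
    case True
    then show ?thesis by (intro exI[of _ 1] exI[of _ 0]) auto
  next
    case False
    then show ?thesis using D(2)[of "I i"] I_cases[of i] by (metis atLeastatMost_subset_iff cbox_interval)
  qed
  then obtain l r where lr: "\<And>i. I i = {l i..r i}" "\<And>i. l i \<le> r i \<Longrightarrow> a \<le> l i \<and> r i \<le> b"
    by metis
  define J where "J i = (if l i \<le> r i then {\<sigma> (l i)..\<sigma> (r i)} else {})" for i
  \<comment> \<open>The intervals of the cover may share end points; their interiors are disjoint
    and have the same length.\<close>
  have len: "emeasure lborel (J i) \<le> ennreal M * emeasure lborel (interior (I i))" for i
  proof (cases "l i \<le> r i")
    case True
    have "emeasure lborel (J i) = ennreal (\<sigma> (r i) - \<sigma> (l i))"
      using True mono lr(2)[OF True] by (simp add: J_def)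
    also have "\<dots> \<le> ennreal (M * (r i - l i))"
      using True lr(2)[OF True] by (intro ennreal_leI lip) auto
    also have "\<dots> = ennreal M * emeasure lborel (interior (I i))"
      using True M by (simp add: lr(1) ennreal_mult)
    finally show ?thesis .
  qed (simp add: J_def)
  have "B \<subseteq> (\<Union>i. J i)"
  proof
    fix s assume "s \<in> B"
    then obtain t where t: "t \<in> X" "s = \<sigma> t" using B by blast
    then obtain K where K: "K \<in> \<D>" "t \<in> K" using D by blast
    define i where "i = to_nat_on \<D> K"
    have "t \<in> {l i..r i}" using K I_to[OF K(1)] lr(1)[of i] by (simp add: i_def)
    then have "s \<in> J i" using lr(2)[of i] mono t by (auto simp: J_def)
    then show "s \<in> (\<Union>i. J i)" by blast
  qed
  then have "emeasure lborel B \<le> emeasure lborel (\<Union>i. J i)"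
    by (intro emeasure_mono) (auto simp: J_def)
  also have "\<dots> \<le> (\<Sum>i. emeasure lborel (J i))"
    by (intro emeasure_subadditive_countably) (auto simp: J_def)
  also have "\<dots> \<le> (\<Sum>i. ennreal M * emeasure lborel (interior (I i)))"
    by (intro suminf_le len) auto
  also have "\<dots> = ennreal M * (\<Sum>i. emeasure lborel (interior (I i)))"
    by simp
  also have "(\<Sum>i. emeasure lborel (interior (I i))) = emeasure lborel (\<Union>i. interior (I i))"
  proof (rule suminf_emeasure)
    show "disjoint_family (\<lambda>i. interior (I i))"
      unfolding disjoint_family_on_def
    proof (intro ballI impI)
      fix i j :: nat assume "i \<noteq> j"
      then show "interior (I i) \<inter> interior (I j) = {}"
        using I_cases[of i] I_cases[of j] D(3) unfolding pairwise_def by (metis Int_empty_left Int_empty_right interior_empty)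
    qed
  qed auto
  also have "\<dots> = emeasure lebesgue (\<Union>i. interior (I i))"
    by simp
  also have "\<dots> \<le> emeasure lebesgue (\<Union>\<D>)"
    using I_cases interior_subset D(5) by (intro emeasure_mono) (blast, auto)
  also have "\<dots> \<le> emeasure lborel X + ennreal e'"
  proof -
    have "emeasure lebesgue (\<Union>\<D>) = ennreal (measure lebesgue (\<Union>\<D>))"
      using D(5) by (rule emeasure_eq_measure2)
    also have "\<dots> \<le> ennreal (measure lebesgue X + e')" using D(6) by (rule ennreal_leI)
    also have "\<dots> = emeasure lebesgue X + ennreal e'"
      using e' Xm by (simp add: emeasure_eq_measure2)
    finally show ?thesis using X by simp
  qed
  finally have "emeasure lborel B \<le> ennreal M * (emeasure lborel X + ennreal e')"
    by (simp add: mult_left_mono)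
  also have "\<dots> = ennreal M * emeasure lborel X + ennreal (M * e')"
    using M e' by (simp add: distrib_left ennreal_mult)
  also have "\<dots> \<le> ennreal M * emeasure lborel X + ennreal e"
    using e' by (intro add_left_mono ennreal_leI)
  finally show "emeasure lborel B \<le> ennreal M * emeasure lborel X + ennreal e" .
qed

text \<open>No differentiation is involved. By the covering estimate above, the arc length measure
  on \<open>{0..arclen b}\<close> is at most \<open>M\<close> times the push-forward of the
  parameter measure under the arc length function, on every Borel set; integrating \<rho> along the
  curve preserves the inequality.\<close>

lemma rect_line_integral_lipschitz:
  fixes c :: "real \<Rightarrow> 'b::metric_space"
  assumes "a \<le> b" and M: "0 \<le> M"
    and lip: "\<And>u v. a \<le> u \<Longrightarrow> u \<le> v \<Longrightarrow> v \<le> b \<Longrightarrow> dist (c u) (c v) \<le> M * (v - u)"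
    and \<rho>: "\<rho> \<in> borel_measurable borel"
  shows "rectifiable_curve c a b"
    and "rect_line_integral \<rho> c a b \<le> ennreal M * (\<integral>\<^sup>+ t \<in> {a..b}. \<rho> (c t) \<partial>lborel)"
proof -
  have "M-lipschitz_on {a..b} c"
  proof (rule lipschitz_onI)
    fix u v assume "u \<in> {a..b}" "v \<in> {a..b}"
    then show "dist (c u) (c v) \<le> M * dist u v"
      using lip[of u v] lip[of v u] by (cases "u \<le> v") (simp_all add: dist_commute dist_real_def)
  qed (rule M)
  then have "continuous_on {a..b} c" by (rule lipschitz_on_continuous_on)
  moreover have len: "curve_length c u v \<le> ennreal (M * (v - u))" if "a \<le> u" "v \<le> b" for u v
    using that M lip by (intro curve_length_lipschitz) auto
  ultimately show "rectifiable_curve c a b"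
    using \<open>a \<le> b\<close> le_less_trans[OF len[of a b]] by unfold_locales auto
  then interpret rectifiable_curve c a b .
  \<comment> \<open>Clamping the parameter to the interval makes arc length a continuous function on
    the whole line.\<close>
  define \<sigma> where "\<sigma> t = arclen (max a (min b t))" for t
  have "continuous_on UNIV \<sigma>"
    unfolding \<sigma>_def by (rule continuous_on_compose2[OF continuous_on_arc])
      (use \<open>a \<le> b\<close> in \<open>auto intro!: continuous_intros\<close>)
  then have [measurable]: "\<sigma> \<in> borel_measurable borel"
    by (rule borel_measurable_continuous_onI)
  have \<sigma>: "\<sigma> t = arclen t" if "t \<in> {a..b}" for t
    using that by (simp add: \<sigma>_def)
  define h where "h s = \<rho> (arclength_param c a b s) * indicator {0..arclen b} s" for s
  have h [measurable]: "h \<in> borel_measurable borel"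
    using measurable_arclength_param[OF \<rho>] unfolding h_def .
  let ?L = "{0..arclen b}"
  let ?N1 = "density lborel (indicator ?L)"
  let ?N2 = "distr (density lborel (\<lambda>t. ennreal M * indicator {a..b} t)) borel \<sigma>"
  have "?N1 \<le> ?N2"
  proof (subst le_measure)
    show "\<forall>B\<in>sets ?N1. emeasure ?N1 B \<le> emeasure ?N2 B"
    proof
      fix B assume "B \<in> sets ?N1"
      then have [measurable]: "B \<in> sets borel" by simp
      define X where "X = {a..b} \<inter> \<sigma> -` B"
      have X: "X \<in> sets borel"
        unfolding X_def using measurable_sets[of \<sigma> borel borel B] by auto
      have "emeasure ?N1 B = emeasure lborel (?L \<inter> B)"
      proof -
        have "emeasure ?N1 B = (\<integral>\<^sup>+ t. indicator ?L t * indicator B t \<partial>lborel)"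
          by (intro emeasure_density) simp_all
        also have "\<dots> = (\<integral>\<^sup>+ t. indicator (?L \<inter> B) t \<partial>lborel)"
          by (intro nn_integral_cong) (simp add: indicator_inter_arith)
        finally show ?thesis by (simp add: nn_integral_indicator)
      qed
      also have "\<dots> \<le> ennreal M * emeasure lborel X"
      proof (rule emeasure_mono_lipschitz_image[OF \<open>a \<le> b\<close> M])
        show "?L \<inter> B \<subseteq> \<sigma> ` X"
        proof
          fix s assume s: "s \<in> ?L \<inter> B"
          then obtain t where "t \<in> {a..b}" "s = arclen t" using arc_image by (metis IntD1 imageE)
          then show "s \<in> \<sigma> ` X" using s \<sigma>[of t] by (intro image_eqI[of _ _ t]) (auto simp: X_def)
        qed
        fix u v assume uv: "a \<le> u" "u \<le> v" "v \<le> b"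
        show "\<sigma> u \<le> \<sigma> v" using arc_diff(2)[OF uv] uv by (simp add: \<sigma>)
        have "ennreal (arclen v - arclen u) \<le> ennreal (M * (v - u))"
          using len[of u v] uv arc_diff[OF uv] by simp
        then show "\<sigma> v - \<sigma> u \<le> M * (v - u)" using M uv by (simp add: \<sigma>)
      qed (use X in \<open>auto simp: X_def\<close>)
      also have "\<dots> = emeasure ?N2 B"
      proof -
        have \<sigma>B: "\<sigma> -` B \<in> sets borel"
          using measurable_sets[of \<sigma> borel borel B] by simp
        have "emeasure ?N2 B = emeasure (density lborel (\<lambda>t. ennreal M * indicator {a..b} t)) (\<sigma> -` B)"
          by (subst emeasure_distr) simp_all
        also have "\<dots> = (\<integral>\<^sup>+ t. ennreal M * indicator {a..b} t * indicator (\<sigma> -` B) t \<partial>lborel)"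
          using \<sigma>B by (intro emeasure_density) simp_all
        also have "\<dots> = (\<integral>\<^sup>+ t. ennreal M * indicator X t \<partial>lborel)"
          by (intro nn_integral_cong) (simp add: X_def indicator_inter_arith mult.assoc)
        also have "\<dots> = ennreal M * emeasure lborel X"
          using X by (simp add: nn_integral_cmult_indicator)
        finally show ?thesis by simp
      qed
      finally show "emeasure ?N1 B \<le> emeasure ?N2 B" .
    qed
  qed simp
  then have le: "nn_integral ?N1 h \<le> nn_integral ?N2 h"
    by (intro nn_integral_mono_measure) simp_all
  have "rect_line_integral \<rho> c a b = nn_integral ?N1 h"
    unfolding rect_line_integral_def arclen_def[symmetric]
    by (subst nn_integral_density) (auto simp: h_def intro!: nn_integral_cong split: split_indicator)
  also note le
  also have "nn_integral ?N2 h = (\<integral>\<^sup>+ t. ennreal M * (indicator {a..b} t * h (\<sigma> t)) \<partial>lborel)"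
    by (subst nn_integral_distr) (auto simp: nn_integral_density mult.assoc)
  also have "\<dots> = ennreal M * (\<integral>\<^sup>+ t. indicator {a..b} t * h (\<sigma> t) \<partial>lborel)"
    by (rule nn_integral_cmult) measurable
  also have "(\<integral>\<^sup>+ t. indicator {a..b} t * h (\<sigma> t) \<partial>lborel) = (\<integral>\<^sup>+ t \<in> {a..b}. \<rho> (c t) \<partial>lborel)"
  proof (rule nn_integral_cong)
    fix t
    show "indicator {a..b} t * h (\<sigma> t) = \<rho> (c t) * indicator {a..b} t"
    proof (cases "t \<in> {a..b}")
      case True
      then show ?thesis
        using arclength_param_arc[of t] imageI[of t "{a..b}" arclen] unfolding arc_image by (simp add: h_def \<sigma>)
    qed simp
  qed
  finally show "rect_line_integral \<rho> c a b \<le> ennreal M * (\<integral>\<^sup>+ t \<in> {a..b}. \<rho> (c t) \<partial>lborel)" .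
qed

section \<open>Foliation of space by double cones\<close>

locale slicing =
  fixes e q :: "'a::euclidean_space"
  assumes e: "e \<in> Basis" and dim: "2 \<le> DIM('a)"
begin

definition flat :: "'a \<Rightarrow> 'a" where
  "flat x = x - (x \<bullet> e) *\<^sub>R e"

text \<open>The sphere of radius \<open>r\<close> for this norm is the surface of the double cone
  over the disc of radius \<open>r\<close> in the hyperplane orthogonal to \<open>e\<close>, with
  apices \<open>r *\<^sub>R e\<close> and \<open>- r *\<^sub>R e\<close>.\<close>

definition cone_norm :: "'a \<Rightarrow> real" where
  "cone_norm x = \<bar>x \<bullet> e\<bar> + norm (flat x)"

text \<open>For \<open>s = 1\<close> and \<open>s = - 1\<close> these are the two halves of the
  double cone around \<open>q\<close>, written as graphs over the disc. They depend on
  \<open>flat w\<close> only and meet where \<open>norm (flat w) = r\<close>.\<close>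

definition sheet :: "real \<Rightarrow> real \<Rightarrow> 'a \<Rightarrow> 'a" where
  "sheet r s w = q + flat w + (s * (r - norm (flat w))) *\<^sub>R e"

text \<open>Integrals over the hyperplane orthogonal to \<open>e\<close> are written as integrals
  over this slab of thickness one, so that only Lebesgue measure on the whole space is needed; the
  \<open>e\<close>-coordinate is a dummy variable.\<close>

definition slab :: "'a set" where
  "slab = {w. 0 \<le> w \<bullet> e \<and> w \<bullet> e \<le> 1}"

text \<open>The intermediate points of the random paths. They keep away from the axis, so that
  stretching by a factor of at most two carries them to the rim.\<close>

definition annulus :: "real \<Rightarrow> 'a set" where
  "annulus r = {z \<in> slab. r / 2 \<le> norm (flat z) \<and> norm (flat z) \<le> r}"

definition sheet_integral :: "('a \<Rightarrow> ennreal) \<Rightarrow> real \<Rightarrow> real \<Rightarrow> ennreal" where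
  "sheet_integral F r s =
    (\<integral>\<^sup>+ w \<in> {w \<in> slab. norm (flat w) \<le> r}. F (sheet r s w) \<partial>lborel)"

lemma ee [simp]: "e \<bullet> e = 1" "norm e = 1"
  using e by (simp_all add: inner_Basis)

lemma flat_e [simp]: "flat x \<bullet> e = 0"
  by (simp add: flat_def inner_diff_left)

lemma flat_simps [simp]:
  "flat (x + y) = flat x + flat y" "flat (x - y) = flat x - flat y" "flat (k *\<^sub>R x) = k *\<^sub>R flat x"
  "flat e = 0" "flat (flat x) = flat x" "flat 0 = 0"
  by (simp_all add: flat_def algebra_simps inner_add_left inner_diff_left)

lemma continuous_on_flat [continuous_intros]: "continuous_on S f \<Longrightarrow> continuous_on S (\<lambda>x. flat (f x))"
  unfolding flat_def by (intro continuous_intros)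

lemma measurable_flat [measurable]: "flat \<in> borel_measurable borel"
  by (intro borel_measurable_continuous_onI continuous_on_flat continuous_on_id)

lemma measurable_sheet [measurable]:
  assumes [measurable]: "f \<in> borel_measurable M" "g \<in> borel_measurable M"
  shows "(\<lambda>x. sheet (f x) s (g x)) \<in> borel_measurable M"
  unfolding sheet_def by measurable

lemma measurable_slab [measurable]: "slab \<in> sets borel"
  unfolding slab_def by measurable

lemma measurable_annulus [measurable]: "annulus r \<in> sets borel"
  unfolding annulus_def by measurable

lemma nn_integral_translate:
  fixes F :: "'a \<Rightarrow> ennreal"
  assumes [measurable]: "F \<in> borel_measurable borel"
  shows "(\<integral>\<^sup>+ w. F (c + w) \<partial>lborel) = (\<integral>\<^sup>+ w. F w \<partial>lborel)"
proof -
  have "(\<integral>\<^sup>+ w. F w \<partial>lborel) = (\<integral>\<^sup>+ w. F w \<partial>distr lborel borel ((+) c))"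
    by (simp add: lborel_distr_plus)
  also have "\<dots> = (\<integral>\<^sup>+ w. F (c + w) \<partial>lborel)"
    by (rule nn_integral_distr) auto
  finally show ?thesis by simp
qed

text \<open>Only the directions orthogonal to \<open>e\<close> are dilated, which gives the Jacobian
  of the hyperplane; the \<open>e\<close>-coordinate is kept, so the slab is preserved.\<close>

lemma nn_integral_flat_scale:
  fixes F :: "'a \<Rightarrow> ennreal"
  assumes [measurable]: "F \<in> borel_measurable borel" and t: "0 < t"
  shows "(\<integral>\<^sup>+ w. F w \<partial>lborel) =
    ennreal (t ^ (DIM('a) - 1)) * (\<integral>\<^sup>+ z. F (flat u + t *\<^sub>R flat z + (z \<bullet> e) *\<^sub>R e) \<partial>lborel)"
proof -
  define c where "c j = (if j = e then 1 else t)" for j :: 'a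
  have T: "(\<Sum>j\<in>Basis. (c j * (z \<bullet> j)) *\<^sub>R j) = t *\<^sub>R flat z + (z \<bullet> e) *\<^sub>R e" for z
  proof (rule euclidean_eqI)
    fix b :: 'a assume b: "b \<in> Basis"
    have "(\<Sum>j\<in>Basis. (c j * (z \<bullet> j)) *\<^sub>R j) \<bullet> b = c b * (z \<bullet> b)"
      using b by (simp add: inner_sum_left inner_Basis if_distrib cong: if_cong)
    also have "\<dots> = (t *\<^sub>R flat z + (z \<bullet> e) *\<^sub>R e) \<bullet> b"
      using b e by (cases "b = e") (simp_all add: c_def flat_def inner_add_left inner_diff_left inner_Basis)
    finally show "(\<Sum>j\<in>Basis. (c j * (z \<bullet> j)) *\<^sub>R j) \<bullet> b = (t *\<^sub>R flat z + (z \<bullet> e) *\<^sub>R e) \<bullet> b" .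
  qed
  have "(\<Prod>j\<in>Basis. \<bar>c j\<bar>) = \<bar>c e\<bar> * (\<Prod>j\<in>Basis - {e}. \<bar>c j\<bar>)"
    using e by (intro prod.remove) auto
  also have "(\<Prod>j\<in>Basis - {e}. \<bar>c j\<bar>) = (\<Prod>j\<in>Basis - {e}. t)"
    using t by (intro prod.cong) (auto simp: c_def)
  also have "\<bar>c e\<bar> * \<dots> = t ^ (DIM('a) - 1)"
    using e by (simp add: c_def card_Diff_singleton)
  finally have prod: "(\<Prod>j\<in>Basis. \<bar>c j\<bar>) = t ^ (DIM('a) - 1)" .
  let ?T = "\<lambda>z. flat u + (\<Sum>j\<in>Basis. (c j * (z \<bullet> j)) *\<^sub>R j)"
  have "lborel = density (distr lborel borel ?T) (\<lambda>_. ennreal (\<Prod>j\<in>Basis. \<bar>c j\<bar>))"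
    by (rule lborel_affine_euclidean) (use t in \<open>auto simp: c_def\<close>)
  then have "(\<integral>\<^sup>+ w. F w \<partial>lborel) =
      (\<integral>\<^sup>+ w. F w \<partial>density (distr lborel borel ?T) (\<lambda>_. ennreal (\<Prod>j\<in>Basis. \<bar>c j\<bar>)))"
    by simp
  also have "\<dots> = (\<integral>\<^sup>+ w. ennreal (t ^ (DIM('a) - 1)) * F w \<partial>distr lborel borel ?T)"
    unfolding prod by (subst nn_integral_density) auto
  also have "\<dots> = ennreal (t ^ (DIM('a) - 1)) * (\<integral>\<^sup>+ z. F (?T z) \<partial>lborel)"
    by (subst nn_integral_distr) (auto simp: nn_integral_cmult)
  finally show ?thesis unfolding T by (simp add: add.assoc)
qed

lemma sheet_integral_measurable:
  assumes [measurable]: "F \<in> borel_measurable borel"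
  shows "(\<lambda>r. sheet_integral F r s) \<in> borel_measurable borel"
  unfolding sheet_integral_def slab_def by measurable

text \<open>The sheets with varying \<open>r\<close> foliate the space; a fixed point of the disc moves parallel to \<open>e\<close>.\<close>

lemma nn_integral_sheet_integral_le:
  assumes [measurable]: "F \<in> borel_measurable borel" and s: "\<bar>s\<bar> = 1"
  shows "(\<integral>\<^sup>+ r. sheet_integral F r s \<partial>lborel) \<le> (\<integral>\<^sup>+ x. F x \<partial>lborel)"
proof -
  have "(\<integral>\<^sup>+ r. sheet_integral F r s \<partial>lborel) \<le>
      (\<integral>\<^sup>+ r. \<integral>\<^sup>+ w. F (sheet r s w) * indicator slab w \<partial>lborel \<partial>lborel)"
    unfolding sheet_integral_def by (intro nn_integral_mono) (auto split: split_indicator)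
  also have "\<dots> = (\<integral>\<^sup>+ w. \<integral>\<^sup>+ r. F (sheet r s w) * indicator slab w \<partial>lborel \<partial>lborel)"
    by (rule lborel_pair.Fubini') measurable
  \<comment> \<open>For fixed \<open>w\<close> the point of the sheet moves along \<open>e\<close>
    with unit speed in \<open>r\<close>. Shifting \<open>r\<close> and, for \<open>s = - 1\<close>,
    reflecting it removes the height of the cone and restores the \<open>e\<close>-coordinate of
    \<open>w\<close>.\<close>
  also have "\<dots> = (\<integral>\<^sup>+ w. \<integral>\<^sup>+ r. F (q + w + r *\<^sub>R e) * indicator slab w \<partial>lborel \<partial>lborel)"
  proof (rule nn_integral_cong)
    fix w :: 'a
    have "(\<integral>\<^sup>+ r. F (q + w + r *\<^sub>R e) * indicator slab w \<partial>lborel) =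
      ennreal \<bar>s\<bar> * (\<integral>\<^sup>+ r. F (q + w + ((- s * norm (flat w) - w \<bullet> e) + s * r) *\<^sub>R e) * indicator slab w \<partial>lborel)"
      by (rule nn_integral_real_affine) (use s in auto)
    also have "(\<lambda>r. q + w + ((- s * norm (flat w) - w \<bullet> e) + s * r) *\<^sub>R e) = (\<lambda>r. sheet r s w)"
      by (rule ext) (simp add: sheet_def flat_def algebra_simps)
    finally show "(\<integral>\<^sup>+ r. F (sheet r s w) * indicator slab w \<partial>lborel) =
        (\<integral>\<^sup>+ r. F (q + w + r *\<^sub>R e) * indicator slab w \<partial>lborel)"
      using s by (simp add: fun_eq_iff)
  qed
  also have "\<dots> = (\<integral>\<^sup>+ r. \<integral>\<^sup>+ w. F (q + w + r *\<^sub>R e) * indicator slab w \<partial>lborel \<partial>lborel)"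
    by (rule lborel_pair.Fubini'[symmetric]) measurable
  also have "\<dots> = (\<integral>\<^sup>+ r. \<integral>\<^sup>+ w. F w * indicator slab (w - q - r *\<^sub>R e) \<partial>lborel \<partial>lborel)"
  proof (rule nn_integral_cong)
    fix r :: real
    have "(\<integral>\<^sup>+ w. F w * indicator slab (w - q - r *\<^sub>R e) \<partial>lborel) =
        (\<integral>\<^sup>+ w. F ((q + r *\<^sub>R e) + w) * indicator slab ((q + r *\<^sub>R e) + w - q - r *\<^sub>R e) \<partial>lborel)"
      by (rule nn_integral_translate[symmetric]) measurable
    then show "(\<integral>\<^sup>+ w. F (q + w + r *\<^sub>R e) * indicator slab w \<partial>lborel) =
        (\<integral>\<^sup>+ w. F w * indicator slab (w - q - r *\<^sub>R e) \<partial>lborel)"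
      by (simp add: algebra_simps)
  qed
  also have "\<dots> = (\<integral>\<^sup>+ w. \<integral>\<^sup>+ r. F w * indicator slab (w - q - r *\<^sub>R e) \<partial>lborel \<partial>lborel)"
    by (rule lborel_pair.Fubini') measurable
  \<comment> \<open>A given point lies in the slab translated by \<open>q + r *\<^sub>R e\<close>
    for a set of \<open>r\<close> of length one.\<close>
  also have "\<dots> = (\<integral>\<^sup>+ w. F w \<partial>lborel)"
  proof (rule nn_integral_cong)
    fix w :: 'a
    have "(\<integral>\<^sup>+ r. F w * indicator slab (w - q - r *\<^sub>R e) \<partial>lborel) =
        (\<integral>\<^sup>+ r. F w * indicator {(w - q) \<bullet> e - 1..(w - q) \<bullet> e} r \<partial>lborel)"
      by (intro nn_integral_cong) (auto simp: slab_def inner_diff_left split: split_indicator)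
    also have "\<dots> = F w" by (simp add: nn_integral_cmult_indicator)
    finally show "(\<integral>\<^sup>+ r. F w * indicator slab (w - q - r *\<^sub>R e) \<partial>lborel) = F w" .
  qed
  finally show ?thesis .
qed

lemma emeasure_annulus: "0 < r \<Longrightarrow> emeasure lborel (annulus r) = ennreal (r ^ (DIM('a) - 1)) * emeasure lborel (annulus 1)"
proof -
  assume r: "0 < r"
  have "emeasure lborel (annulus r) = (\<integral>\<^sup>+ w. indicator (annulus r) w \<partial>lborel)"
    by (simp add: nn_integral_indicator)
  also have "\<dots> = ennreal (r ^ (DIM('a) - 1)) *
      (\<integral>\<^sup>+ z. indicator (annulus r) (flat 0 + r *\<^sub>R flat z + (z \<bullet> e) *\<^sub>R e) \<partial>lborel)"
    by (rule nn_integral_flat_scale) (use r in auto)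
  also have "(\<lambda>z. indicator (annulus r) (flat 0 + r *\<^sub>R flat z + (z \<bullet> e) *\<^sub>R e) :: ennreal) = indicator (annulus 1)"
    using r by (auto simp: fun_eq_iff annulus_def slab_def inner_add_left field_simps split: split_indicator)
  finally show ?thesis by (simp add: nn_integral_indicator)
qed

lemma annulus_1: "0 < emeasure lborel (annulus 1)" "emeasure lborel (annulus 1) < \<infinity>"
proof -
  have "annulus 1 \<subseteq> cball 0 2"
  proof
    fix z assume z: "z \<in> annulus 1"
    have "norm z \<le> norm (flat z) + norm ((z \<bullet> e) *\<^sub>R e)"
      using norm_triangle_ineq[of "flat z" "(z \<bullet> e) *\<^sub>R e"] by (simp add: flat_def)
    then show "z \<in> cball 0 2" using z by (auto simp: annulus_def slab_def)
  qed
  then have "bounded (annulus 1)" using bounded_cball bounded_subset by blast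
  then show "emeasure lborel (annulus 1) < \<infinity>" using emeasure_bounded_finite by blast
  \<comment> \<open>Dimension at least two provides a second coordinate direction; on the line
    \<open>flat\<close> vanishes and the annulus would be empty.\<close>
  have "card (Basis - {e}) \<noteq> 0" using dim e by (simp add: card_Diff_singleton)
  then have "Basis - {e} \<noteq> {}" by (metis card.empty)
  then obtain b :: 'a where b: "b \<in> Basis" "b \<noteq> e" by blast
  let ?U = "{z. 0 < z \<bullet> e \<and> z \<bullet> e < 1 \<and> 1 / 2 < norm (flat z) \<and> norm (flat z) < 1}"
  have "open ?U"
    by (intro open_Collect_conj open_Collect_less continuous_intros)
  moreover have "b \<bullet> e = 0" using b e by (simp add: inner_Basis)
  then have "(1 / 2) *\<^sub>R e + (3 / 4) *\<^sub>R b \<in> ?U"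
    using b by (simp add: inner_add_left) (simp add: flat_def)
  then have "?U \<noteq> {}" by blast
  ultimately have "\<not> negligible ?U" by (rule open_not_negligible)
  then have "emeasure lborel ?U \<noteq> 0"
    using \<open>open ?U\<close> by (auto simp: negligible_iff_null_sets null_sets_def)
  moreover have "emeasure lborel ?U \<le> emeasure lborel (annulus 1)"
    by (intro emeasure_mono) (auto simp: annulus_def slab_def)
  ultimately show "0 < emeasure lborel (annulus 1)" by (auto simp: zero_less_iff_neq_zero)
qed

lemma annulus_finite: "0 < r \<Longrightarrow> emeasure lborel (annulus r) < \<infinity>"
  using annulus_1 by (subst emeasure_annulus) (auto simp: ennreal_mult_less_top)

text \<open>Splitting \<open>\<rho>\<close> at the level \<open>K\<close> replaces the use of Hoelder's inequality.\<close>

lemma le_level_plus_power: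
  fixes x :: ennreal
  assumes "0 < K" "1 \<le> n"
  shows "x \<le> ennreal K + ennreal (inverse K ^ (n - 1)) * x ^ n"
proof (cases "x \<le> ennreal K")
  case False
  have "x = ennreal (inverse K ^ (n - 1)) * ennreal K ^ (n - 1) * x"
    using assms by (simp add: ennreal_power flip: ennreal_mult power_mult_distrib)
  also have "\<dots> \<le> ennreal (inverse K ^ (n - 1)) * x ^ (n - 1) * x"
    using False by (intro mult_right_mono mult_left_mono power_mono) auto
  also have "\<dots> = ennreal (inverse K ^ (n - 1)) * x ^ n"
    using assms by (cases n) (simp_all add: mult_ac)
  finally show ?thesis by (simp add: add_increasing)
qed (simp add: add_increasing2)

text \<open>In the applications \<open>u + t *\<^sub>R z\<close> runs through a segment leading to
  \<open>z\<close>, or beyond it. The level \<open>K\<close> contributes \<open>K\<close> times the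
  measure of the annulus; in the power term, passing from \<open>z\<close> to
  \<open>u + t *\<^sub>R z\<close> is a dilation within the hyperplane and costs
  \<open>inverse t ^ (DIM('a) - 1)\<close>. The indicator discards those \<open>z\<close> whose
  image leaves the disc.\<close>

lemma annulus_average_le:
  assumes [measurable]: "\<rho> \<in> borel_measurable borel" and t: "0 < t" and K: "0 < K"
  shows "(\<integral>\<^sup>+ z \<in> annulus r. \<rho> (sheet r s (u + t *\<^sub>R z)) * indicator {z. norm (flat (u + t *\<^sub>R z)) \<le> r} z \<partial>lborel)
    \<le> ennreal K * emeasure lborel (annulus r) +
      ennreal (inverse K ^ (DIM('a) - 1)) * ennreal (inverse t ^ (DIM('a) - 1)) *
        sheet_integral (\<lambda>x. \<rho> x ^ DIM('a)) r s"
proof -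
  let ?n = "DIM('a)"
  let ?D = "{w \<in> slab. norm (flat w) \<le> r}"
  let ?T = "\<lambda>z. flat u + t *\<^sub>R flat z + (z \<bullet> e) *\<^sub>R e"
  let ?H = "\<lambda>w. \<rho> (sheet r s w) ^ ?n * indicator ?D w"
  have pt: "\<rho> (sheet r s (u + t *\<^sub>R z)) * indicator {z. norm (flat (u + t *\<^sub>R z)) \<le> r} z * indicator (annulus r) z
      \<le> ennreal K * indicator (annulus r) z + ennreal (inverse K ^ (?n - 1)) * ?H (?T z)" for z
  proof (cases "z \<in> annulus r \<and> norm (flat (u + t *\<^sub>R z)) \<le> r")
    case True
    have "sheet r s (u + t *\<^sub>R z) = sheet r s (?T z)"
      by (simp add: sheet_def)
    moreover have "?T z \<in> ?D"
      using True by (simp add: annulus_def slab_def inner_add_left)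
    ultimately show ?thesis
      using True le_level_plus_power[OF K, of ?n "\<rho> (sheet r s (?T z))"] dim by simp
  qed (auto split: split_indicator)
  have "(\<integral>\<^sup>+ z \<in> annulus r. \<rho> (sheet r s (u + t *\<^sub>R z)) * indicator {z. norm (flat (u + t *\<^sub>R z)) \<le> r} z \<partial>lborel)
      \<le> (\<integral>\<^sup>+ z. ennreal K * indicator (annulus r) z + ennreal (inverse K ^ (?n - 1)) * ?H (?T z) \<partial>lborel)"
    by (intro nn_integral_mono pt)
  also have "\<dots> = ennreal K * emeasure lborel (annulus r) +
      ennreal (inverse K ^ (?n - 1)) * (\<integral>\<^sup>+ z. ?H (?T z) \<partial>lborel)"
    by (subst nn_integral_add) (auto simp: nn_integral_cmult nn_integral_cmult_indicator)
  also have "(\<integral>\<^sup>+ z. ?H (?T z) \<partial>lborel) =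
      ennreal (inverse t ^ (?n - 1)) * (ennreal (t ^ (?n - 1)) * (\<integral>\<^sup>+ z. ?H (?T z) \<partial>lborel))"
    using t by (simp add: mult.assoc[symmetric] flip: ennreal_mult power_mult_distrib)
  also have "ennreal (t ^ (?n - 1)) * (\<integral>\<^sup>+ z. ?H (?T z) \<partial>lborel) = sheet_integral (\<lambda>x. \<rho> x ^ ?n) r s"
    unfolding sheet_integral_def by (rule nn_integral_flat_scale[symmetric]) (use t in auto)
  finally show ?thesis by (simp add: mult.assoc)
qed

end

section \<open>Concatenation of rectifiable curves\<close>

lemma rectifiable_curve_path: "rectifiable_curve d 0 1 \<Longrightarrow> path d"
  by (simp add: path_def rectifiable_curve_def)

lemma rect_line_integral_sub_le:
  assumes "rectifiable_curve d a b" "a \<le> u" "u \<le> v" "v \<le> b" "\<rho> \<in> borel_measurable borel"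
  shows "rect_line_integral \<rho> d u v \<le> rect_line_integral \<rho> d a b"
proof -
  interpret rectifiable_curve d a b by fact
  interpret av: rectifiable_curve d a v using assms by (intro sub) auto
  show ?thesis
    using av.rect_line_integral_split(3)[of u \<rho>] rect_line_integral_split(2)[of v \<rho>] assms by force
qed

lemma line_integral_Fin:
  fixes d :: "real \<Rightarrow> 'a::real_inner"
  assumes "rectifiable_curve d 0 1"
  shows "locally_rectifiable ({0..1}, Fin \<circ> d)"
    and "\<rho> \<in> borel_measurable borel \<Longrightarrow> line_integral \<rho> ({0..1}, Fin \<circ> d) \<le> rect_line_integral \<rho> d 0 1"
proof -
  interpret rectifiable_curve d 0 1 by fact
  have eq: "the_fin \<circ> (Fin \<circ> d) = d" by auto
  show "locally_rectifiable ({0..1}, Fin \<circ> d)"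
    unfolding locally_rectifiable_def
    using le_less_trans[OF curve_length_mono fin] by (auto simp: eq)
  show "line_integral \<rho> ({0..1}, Fin \<circ> d) \<le> rect_line_integral \<rho> d 0 1"
    if "\<rho> \<in> borel_measurable borel"
    unfolding line_integral_def prod.case eq
    using that by (intro SUP_least) (auto intro: rect_line_integral_sub_le[OF assms])
qed

lemma rectifiable_curve_join:
  assumes g: "rectifiable_curve g 0 1" and h: "rectifiable_curve h 0 1" and gh: "g 1 = h 0"
    and \<rho>: "\<rho> \<in> borel_measurable borel"
  shows "rectifiable_curve (g +++ h) 0 1"
    and "rect_line_integral \<rho> (g +++ h) 0 1 \<le> rect_line_integral \<rho> g 0 1 + rect_line_integral \<rho> h 0 1"
proof -
  have 1: "rectifiable_curve (g +++ h) 0 (1/2)"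
    "rect_line_integral \<rho> (g +++ h) 0 (1/2) = rect_line_integral \<rho> g 0 1"
    using rect_line_integral_affine(1)[where c = g and k = 2 and a = 0 and m = 0 and b = "1/2" and d = "g +++ h"]
      rect_line_integral_affine(2)[where c = g and k = 2 and a = 0 and m = 0 and b = "1/2" and d = "g +++ h" and \<rho> = \<rho>] g by (auto simp: joinpaths_def)
  have "(g +++ h) t = h (2 * t + - 1)" if "t \<in> {1/2..1}" for t
  proof (cases "t = 1/2")
    case True
    show ?thesis using gh unfolding True by (simp add: joinpaths_def)
  qed (use that in \<open>auto simp: joinpaths_def\<close>)
  then have 2: "rectifiable_curve (g +++ h) (1/2) 1"
    "rect_line_integral \<rho> (g +++ h) (1/2) 1 = rect_line_integral \<rho> h 0 1"
    using rect_line_integral_affine(1)[where c = h and k = 2 and a = "1/2" and m = "-1" and b = 1 and d = "g +++ h"]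
      rect_line_integral_affine(2)[where c = h and k = 2 and a = "1/2" and m = "-1" and b = 1 and d = "g +++ h" and \<rho> = \<rho>] h
    by simp_all
  show r: "rectifiable_curve (g +++ h) 0 1"
  proof
    show "continuous_on {0..1} (g +++ h)"
      using rectifiable_curve_path[OF g] rectifiable_curve_path[OF h] gh
      by (simp add: pathstart_def pathfinish_def flip: path_def)
    show "curve_length (g +++ h) 0 1 < \<infinity>"
      using 1(1) 2(1) curve_length_add[of 0 "1/2" 1 "g +++ h"] by (simp add: rectifiable_curve_def)
  qed simp
  show "rect_line_integral \<rho> (g +++ h) 0 1 \<le> rect_line_integral \<rho> g 0 1 + rect_line_integral \<rho> h 0 1"
    using rectifiable_curve.rect_line_integral_split(1)[OF r _ _ \<rho>, of "1/2"] 1(2) 2(2) by simp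
qed

section \<open>Paths on a double cone through a point of the annulus\<close>

context slicing
begin

definition sheet_segment :: "real \<Rightarrow> real \<Rightarrow> 'a \<Rightarrow> 'a \<Rightarrow> real \<Rightarrow> 'a" where
  "sheet_segment r s u v t = sheet r s ((1 - t) *\<^sub>R u + t *\<^sub>R v)"

lemma cone_norm_sheet:
  assumes "\<bar>s\<bar> = 1" "norm (flat w) \<le> r"
  shows "cone_norm (sheet r s w - q) = r"
  using assms by (simp add: cone_norm_def sheet_def inner_add_left inner_diff_left abs_mult)

text \<open>The height over the disc is a 1-Lipschitz function of \<open>flat w\<close>; horizontal
  and vertical displacement together give the factor 2.\<close>

lemma norm_sheet_diff:
  assumes "\<bar>s\<bar> = 1"
  shows "norm (sheet r s u - sheet r s v) \<le> 2 * norm (flat u - flat v)"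
proof -
  have "sheet r s u - sheet r s v = (flat u - flat v) + (s * (norm (flat v) - norm (flat u))) *\<^sub>R e"
    by (simp add: sheet_def algebra_simps)
  also have "norm \<dots> \<le> norm (flat u - flat v) + norm ((s * (norm (flat v) - norm (flat u))) *\<^sub>R e)"
    by (rule norm_triangle_ineq)
  also have "norm ((s * (norm (flat v) - norm (flat u))) *\<^sub>R e) \<le> norm (flat u - flat v)"
    using assms norm_triangle_ineq3[of "flat u" "flat v"] by (simp add: abs_mult abs_minus_commute)
  finally show ?thesis by simp
qed

lemma sheet_segment_integral:
  assumes s: "\<bar>s\<bar> = 1" and "\<rho> \<in> borel_measurable borel"
  shows "rectifiable_curve (sheet_segment r s u v) 0 1"
    and "rect_line_integral \<rho> (sheet_segment r s u v) 0 1 \<le>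
      ennreal (2 * norm (flat v - flat u)) * (\<integral>\<^sup>+ t \<in> {0..1}. \<rho> (sheet_segment r s u v t) \<partial>lborel)"
proof -
  have lip: "dist (sheet_segment r s u v t) (sheet_segment r s u v t')
      \<le> 2 * norm (flat v - flat u) * (t' - t)" if "t \<le> t'" for t t'
  proof -
    have "dist (sheet_segment r s u v t) (sheet_segment r s u v t') \<le>
        2 * norm (flat ((1 - t) *\<^sub>R u + t *\<^sub>R v) - flat ((1 - t') *\<^sub>R u + t' *\<^sub>R v))"
      unfolding dist_norm sheet_segment_def by (rule norm_sheet_diff[OF s])
    also have "flat ((1 - t) *\<^sub>R u + t *\<^sub>R v) - flat ((1 - t') *\<^sub>R u + t' *\<^sub>R v) = (t - t') *\<^sub>R (flat v - flat u)"
      by (simp add: algebra_simps)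
    finally show ?thesis using that by (simp add: mult_ac)
  qed
  show "rectifiable_curve (sheet_segment r s u v) 0 1"
    "rect_line_integral \<rho> (sheet_segment r s u v) 0 1 \<le>
      ennreal (2 * norm (flat v - flat u)) * (\<integral>\<^sup>+ t \<in> {0..1}. \<rho> (sheet_segment r s u v t) \<partial>lborel)"
    by (rule rect_line_integral_lipschitz[OF zero_le_one _ lip assms(2)]; simp)+
qed

lemma sheet_segment_reverse:
  assumes [measurable]: "\<rho> \<in> borel_measurable borel"
  shows "(\<integral>\<^sup>+ t \<in> {0..1}. \<rho> (sheet_segment r s u v t) \<partial>lborel) =
    (\<integral>\<^sup>+ t \<in> {0..1}. \<rho> (sheet_segment r s v u t) \<partial>lborel)"
proof -
  have "(\<integral>\<^sup>+ t \<in> {0..1}. \<rho> (sheet_segment r s u v t) \<partial>lborel) =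
      ennreal \<bar>- 1\<bar> * (\<integral>\<^sup>+ t. \<rho> (sheet_segment r s u v (1 + (- 1) * t)) * indicator {0..1} (1 + (- 1) * t) \<partial>lborel)"
    unfolding sheet_segment_def by (rule nn_integral_real_affine) auto
  also have "\<dots> = (\<integral>\<^sup>+ t \<in> {0..1}. \<rho> (sheet_segment r s v u t) \<partial>lborel)"
    by (simp add: sheet_segment_def) (auto intro!: nn_integral_cong simp: add.commute split: split_indicator)
  finally show ?thesis .
qed

text \<open>Bounds the line integral over the lift of the segment from \<open>u\<close> to
  \<open>z\<close>: both lie in the disc of radius \<open>r\<close>, so the segment has length at
  most \<open>2 * r\<close>, and lifting at most doubles it.\<close>

definition inner_part :: "('a \<Rightarrow> ennreal) \<Rightarrow> real \<Rightarrow> real \<Rightarrow> 'a \<Rightarrow> 'a \<Rightarrow> ennreal" where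
  "inner_part \<rho> r s u z =
    ennreal (4 * r) * (\<integral>\<^sup>+ t \<in> {0..1}. \<rho> (sheet r s ((1 - t) *\<^sub>R u + t *\<^sub>R z)) \<partial>lborel)"

text \<open>Bounds the line integral over the lift of the radial segment from \<open>z\<close> to
  the rim. Since \<open>r / 2 \<le> norm (flat z)\<close>, a stretching factor in
  \<open>{1..2}\<close> reaches the rim, where the indicator stops. The radial speed is at most
  \<open>r\<close>, and lifting at most doubles it.\<close>

definition rim_part :: "('a \<Rightarrow> ennreal) \<Rightarrow> real \<Rightarrow> real \<Rightarrow> 'a \<Rightarrow> ennreal" where
  "rim_part \<rho> r s z = ennreal (2 * r) *
    (\<integral>\<^sup>+ t \<in> {1..2}. \<rho> (sheet r s (t *\<^sub>R z)) * indicator {t. norm (flat (t *\<^sub>R z)) \<le> r} t \<partial>lborel)"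

text \<open>The number \<open>k\<close> stretches \<open>z\<close> to the rim. Substituting
  \<open>1 + (k - 1) * t\<close> turns the parameter of the segment into the stretching factor,
  which runs through \<open>{1..k}\<close>, a part of \<open>{1..2}\<close>.\<close>

lemma rim_part_ge:
  assumes [measurable]: "\<rho> \<in> borel_measurable borel" and r: "0 < r" and z: "z \<in> annulus r"
    and k: "k = r / norm (flat z)"
  shows "ennreal (2 * norm (flat (k *\<^sub>R z) - flat z)) *
      (\<integral>\<^sup>+ t \<in> {0..1}. \<rho> (sheet_segment r s z (k *\<^sub>R z) t) \<partial>lborel) \<le> rim_part \<rho> r s z"
proof -
  have nz: "0 < norm (flat z)" using z r by (auto simp: annulus_def)
  then have k12: "1 \<le> k" "k \<le> 2" "k * norm (flat z) = r"
    using z by (simp_all add: annulus_def k le_divide_eq divide_le_eq)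
  show ?thesis
  proof (cases "k = 1")
    case False
    let ?f = "\<lambda>t. \<rho> (sheet r s (t *\<^sub>R z)) * indicator {1..k} t"
    have "flat (k *\<^sub>R z) - flat z = (k - 1) *\<^sub>R flat z" by (simp add: algebra_simps)
    then have "2 * norm (flat (k *\<^sub>R z) - flat z) = 2 * norm (flat z) * (k - 1)"
      using k12 by simp
    also have "\<dots> \<le> 2 * r * (k - 1)"
      using z k12 by (intro mult_right_mono) (auto simp: annulus_def)
    finally have "ennreal (2 * norm (flat (k *\<^sub>R z) - flat z)) \<le> ennreal (2 * r) * ennreal \<bar>k - 1\<bar>"
      using r k12 by (simp add: ennreal_leI flip: ennreal_mult)
    note norm_le = this
    let ?I = "\<integral>\<^sup>+ t \<in> {0..1}. \<rho> (sheet_segment r s z (k *\<^sub>R z) t) \<partial>lborel"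
    have I:  "(\<integral>\<^sup>+ t \<in> {0..1}. \<rho> (sheet_segment r s z (k *\<^sub>R z) t) \<partial>lborel) =
        (\<integral>\<^sup>+ t. ?f (1 + (k - 1) * t) \<partial>lborel)"
    proof (rule nn_integral_cong)
      fix t
      have "(1 - t) *\<^sub>R z + t *\<^sub>R k *\<^sub>R z = (1 + (k - 1) * t) *\<^sub>R z" by (simp add: algebra_simps)
      moreover have "1 + (k - 1) * t \<in> {1..k} \<longleftrightarrow> t \<in> {0..1}"
      proof -
        have "0 < k - 1" using k12 False by simp
        from mult_le_cancel_left_pos[OF this, of t 1] mult_le_cancel_left_pos[OF this, of 0 t]
        show ?thesis by (simp add: le_diff_eq add.commute)
      qed
      ultimately show "\<rho> (sheet_segment r s z (k *\<^sub>R z) t) * indicator {0..1} t = ?f (1 + (k - 1) * t)"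
        by (simp add: sheet_segment_def indicator_def)
    qed
    have "ennreal \<bar>k - 1\<bar> * ?I = (\<integral>\<^sup>+ t. ?f t \<partial>lborel)"
      unfolding I using False by (intro nn_integral_real_affine[symmetric]) auto
    also have "\<dots> \<le> (\<integral>\<^sup>+ t \<in> {1..2}. \<rho> (sheet r s (t *\<^sub>R z)) * indicator {t. norm (flat (t *\<^sub>R z)) \<le> r} t \<partial>lborel)"
    proof (intro nn_integral_mono)
      fix t
      have "norm (flat (t *\<^sub>R z)) \<le> r" if "1 \<le> t" "t \<le> k"
        using mult_right_mono[OF that(2), of "norm (flat z)"] that k12 by simp
      then show "?f t \<le> \<rho> (sheet r s (t *\<^sub>R z)) * indicator {t. norm (flat (t *\<^sub>R z)) \<le> r} t * indicator {1..2} t"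
        using k12 by (auto split: split_indicator)
    qed
    finally have "ennreal (2 * r) * (ennreal \<bar>k - 1\<bar> * ?I) \<le> rim_part \<rho> r s z"
      unfolding rim_part_def by (rule mult_left_mono) simp
    moreover have "ennreal (2 * norm (flat (k *\<^sub>R z) - flat z)) * ?I \<le> ennreal (2 * r) * (ennreal \<bar>k - 1\<bar> * ?I)"
      unfolding mult.assoc[symmetric] by (rule mult_right_mono[OF norm_le]) simp
    ultimately show ?thesis by (rule order_trans[rotated])
  qed simp
qed

lemma norm_flat_cone_norm: "norm (flat x) \<le> cone_norm x"
  by (simp add: cone_norm_def)

lemma sheet_of_cone_norm:
  assumes "cone_norm (x - q) = r"
  obtains s where "\<bar>s\<bar> = 1" "x = sheet r s (x - q)"
proof (rule that)
  let ?s = "if 0 \<le> (x - q) \<bullet> e then 1 else - 1 :: real"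
  show "\<bar>?s\<bar> = 1" by simp
  have "?s * (r - norm (flat (x - q))) = (x - q) \<bullet> e"
    using assms by (simp add: cone_norm_def abs_if split: if_splits)
  then show "x = sheet r ?s (x - q)" unfolding sheet_def by (simp add: flat_def)
qed

text \<open>The path runs over \<open>z\<close> to the rim on one sheet and back over
  \<open>z\<close> to the other end point on the second sheet. The detour to the rim is needed when
  the end points lie on different halves of the cone; it is made in every case, which saves a
  distinction.\<close>

lemma path_through_annulus:
  assumes \<rho>: "\<rho> \<in> borel_measurable borel" and r: "0 < r" and z: "z \<in> annulus r"
    and s: "\<bar>s\<bar> = 1" "\<bar>s'\<bar> = 1" and u: "norm (flat u) \<le> r" "norm (flat u') \<le> r"
  obtains d where "rectifiable_curve d 0 1" "d 0 = sheet r s u" "d 1 = sheet r s' u'"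
    "\<And>t. t \<in> {0..1} \<Longrightarrow> cone_norm (d t - q) = r"
    "rect_line_integral \<rho> d 0 1 \<le>
      inner_part \<rho> r s u z + rim_part \<rho> r s z + (rim_part \<rho> r s' z + inner_part \<rho> r s' u' z)"
proof -
  define k where "k = r / norm (flat z)"
  have nz: "0 < norm (flat z)" "norm (flat z) \<le> r" using z r by (auto simp: annulus_def)
  have kz: "norm (flat (k *\<^sub>R z)) = r" using nz r by (simp add: k_def)
  have seg: "norm (flat ((1 - t) *\<^sub>R a + t *\<^sub>R b)) \<le> r"
    if "norm (flat a) \<le> r" "norm (flat b) \<le> r" "t \<in> {0..1}" for a b t
  proof -
    have "norm (flat ((1 - t) *\<^sub>R a + t *\<^sub>R b)) \<le> (1 - t) * norm (flat a) + t * norm (flat b)"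
      using that norm_triangle_ineq[of "(1 - t) *\<^sub>R flat a" "t *\<^sub>R flat b"] by simp
    also have "\<dots> \<le> (1 - t) * r + t * r"
      using that by (intro add_mono mult_left_mono) auto
    finally show ?thesis by (simp add: algebra_simps)
  qed
  have sg: "cone_norm (sheet_segment r \<sigma> a b t - q) = r"
    if "\<bar>\<sigma>\<bar> = 1" "norm (flat a) \<le> r" "norm (flat b) \<le> r" "t \<in> {0..1}" for \<sigma> a b t
    unfolding sheet_segment_def by (rule cone_norm_sheet[OF that(1) seg[OF that(2-4)]])
  have inner: "ennreal (2 * norm (flat z - flat w)) *
      (\<integral>\<^sup>+ t \<in> {0..1}. \<rho> (sheet_segment r \<sigma> w z t) \<partial>lborel) \<le> inner_part \<rho> r \<sigma> w z"
    if "norm (flat w) \<le> r" for \<sigma> w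
  proof -
    have "norm (flat z - flat w) \<le> 2 * r"
      using norm_triangle_ineq4[of "flat z" "flat w"] nz that by simp
    then show ?thesis
      unfolding inner_part_def sheet_segment_def by (intro mult_right_mono ennreal_leI) auto
  qed
  note R = sheet_segment_integral(1)[OF _ \<rho>] and L = sheet_segment_integral(2)[OF _ \<rho>]
  let ?g1 = "sheet_segment r s u z" and ?g2 = "sheet_segment r s z (k *\<^sub>R z)"
  let ?h1 = "sheet_segment r s' z u'" and ?h2 = "sheet_segment r s' (k *\<^sub>R z) z"
  let ?g = "?g1 +++ ?g2" and ?h = "?h2 +++ ?h1"
  have ends: "sheet_segment r \<sigma> a b 0 = sheet r \<sigma> a" "sheet_segment r \<sigma> a b 1 = sheet r \<sigma> b" for \<sigma> a b
    by (simp_all add: sheet_segment_def)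
  \<comment> \<open>Over the rim the height is zero, whatever the sign.\<close>
  have rim: "sheet r s (k *\<^sub>R z) = sheet r s' (k *\<^sub>R z)"
    using kz by (simp add: sheet_def)
  have g: "rectifiable_curve ?g 0 1"
    "rect_line_integral \<rho> ?g 0 1 \<le> rect_line_integral \<rho> ?g1 0 1 + rect_line_integral \<rho> ?g2 0 1"
    using rectifiable_curve_join[OF R R _ \<rho>, OF s(1) s(1)] by (simp_all add: ends)
  have h: "rectifiable_curve ?h 0 1"
    "rect_line_integral \<rho> ?h 0 1 \<le> rect_line_integral \<rho> ?h2 0 1 + rect_line_integral \<rho> ?h1 0 1"
    using rectifiable_curve_join[OF R R _ \<rho>, OF s(2) s(2)] by (simp_all add: ends)
  have gh: "?g 1 = ?h 0" by (simp add: joinpaths_def ends rim)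
  show thesis
  proof (rule that)
    show "rectifiable_curve (?g +++ ?h) 0 1"
      by (rule rectifiable_curve_join[OF g(1) h(1) gh \<rho>])
    show "(?g +++ ?h) 0 = sheet r s u" "(?g +++ ?h) 1 = sheet r s' u'"
      by (simp_all add: joinpaths_def ends)
    show "cone_norm ((?g +++ ?h) t - q) = r" if "t \<in> {0..1}" for t
    proof -
      have "(?g +++ ?h) ` {0..1} \<subseteq> ?g1 ` {0..1} \<union> ?g2 ` {0..1} \<union> ?h1 ` {0..1} \<union> ?h2 ` {0..1}"
        using path_image_join_subset[of ?g ?h] path_image_join_subset[of ?g1 ?g2] path_image_join_subset[of ?h2 ?h1]
        unfolding path_image_def by blast
      then have "(?g +++ ?h) t \<in> ?g1 ` {0..1} \<union> ?g2 ` {0..1} \<union> ?h1 ` {0..1} \<union> ?h2 ` {0..1}"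
        using that by blast
      then show ?thesis
        using sg[OF s(1) u(1) nz(2)] sg[OF s(1) nz(2) kz[THEN eq_refl]]
          sg[OF s(2) nz(2) u(2)] sg[OF s(2) kz[THEN eq_refl] nz(2)]
        by (elim UnE imageE) simp_all
    qed
    have "rect_line_integral \<rho> (?g +++ ?h) 0 1 \<le> rect_line_integral \<rho> ?g 0 1 + rect_line_integral \<rho> ?h 0 1"
      by (rule rectifiable_curve_join[OF g(1) h(1) gh \<rho>])
    also have "\<dots> \<le> (rect_line_integral \<rho> ?g1 0 1 + rect_line_integral \<rho> ?g2 0 1) +
        (rect_line_integral \<rho> ?h2 0 1 + rect_line_integral \<rho> ?h1 0 1)"
      by (intro add_mono g h)
    also have "\<dots> \<le> (inner_part \<rho> r s u z + rim_part \<rho> r s z) + (rim_part \<rho> r s' z + inner_part \<rho> r s' u' z)"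
    proof (intro add_mono)
      show "rect_line_integral \<rho> ?g1 0 1 \<le> inner_part \<rho> r s u z"
        by (rule order_trans[OF L[OF s(1)] inner[OF u(1)]])
      show "rect_line_integral \<rho> ?g2 0 1 \<le> rim_part \<rho> r s z"
        by (rule order_trans[OF L[OF s(1)] rim_part_ge[OF \<rho> r z k_def]])
      have "rect_line_integral \<rho> ?h2 0 1 \<le> ennreal (2 * norm (flat (k *\<^sub>R z) - flat z)) *
          (\<integral>\<^sup>+ t \<in> {0..1}. \<rho> (sheet_segment r s' z (k *\<^sub>R z) t) \<partial>lborel)"
        using L[OF s(2), of r "k *\<^sub>R z" z]
        by (simp only: norm_minus_commute[of "flat z"] sheet_segment_reverse[OF \<rho>, of r s' "k *\<^sub>R z" z])
      then show "rect_line_integral \<rho> ?h2 0 1 \<le> rim_part \<rho> r s' z"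
        by (rule order_trans[OF _ rim_part_ge[OF \<rho> r z k_def]])
      have "rect_line_integral \<rho> ?h1 0 1 \<le> ennreal (2 * norm (flat z - flat u')) *
          (\<integral>\<^sup>+ t \<in> {0..1}. \<rho> (sheet_segment r s' u' z t) \<partial>lborel)"
        using L[OF s(2), of r z u']
        by (simp only: norm_minus_commute[of "flat u'"] sheet_segment_reverse[OF \<rho>, of r s' z u'])
      then show "rect_line_integral \<rho> ?h1 0 1 \<le> inner_part \<rho> r s' u' z"
        by (rule order_trans[OF _ inner[OF u(2)]])
    qed
    finally show "rect_line_integral \<rho> (?g +++ ?h) 0 1 \<le>
      inner_part \<rho> r s u z + rim_part \<rho> r s z + (rim_part \<rho> r s' z + inner_part \<rho> r s' u' z)" .
  qed
qed

end

lemma nn_integral_cmult_section: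
  fixes g :: "'a::euclidean_space \<Rightarrow> 'b::euclidean_space \<Rightarrow> ennreal"
  assumes [measurable]: "case_prod g \<in> borel_measurable (lborel \<Otimes>\<^sub>M lborel)" "A \<in> sets borel"
  shows "(\<integral>\<^sup>+ z \<in> A. (c * (\<integral>\<^sup>+ t. g z t \<partial>lborel)) \<partial>lborel) =
    c * (\<integral>\<^sup>+ z. \<integral>\<^sup>+ t. g z t * indicator A z \<partial>lborel \<partial>lborel)"
proof -
  have "(\<integral>\<^sup>+ z \<in> A. (c * (\<integral>\<^sup>+ t. g z t \<partial>lborel)) \<partial>lborel) =
      (\<integral>\<^sup>+ z. c * ((\<integral>\<^sup>+ t. g z t \<partial>lborel) * indicator A z) \<partial>lborel)"
    by (simp add: mult.assoc)
  also have "\<dots> = c * (\<integral>\<^sup>+ z. (\<integral>\<^sup>+ t. g z t \<partial>lborel) * indicator A z \<partial>lborel)"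
    by (rule nn_integral_cmult) measurable
  also have "(\<integral>\<^sup>+ z. (\<integral>\<^sup>+ t. g z t \<partial>lborel) * indicator A z \<partial>lborel) =
      (\<integral>\<^sup>+ z. \<integral>\<^sup>+ t. g z t * indicator A z \<partial>lborel \<partial>lborel)"
    by (intro nn_integral_cong nn_integral_multc[symmetric]) measurable
  finally show ?thesis .
qed

section \<open>Averaging over the annulus and integrating over the cones\<close>

context slicing
begin

text \<open>The stretching factor \<open>t\<close> is at least one, so the Jacobian factor
  \<open>inverse t ^ (DIM('a) - 1)\<close> is at most one and a single level \<open>K\<close> serves
  for all \<open>t\<close>.\<close>

lemma rim_part_average:
  assumes [measurable]: "\<rho> \<in> borel_measurable borel" and r: "0 < r" and K: "0 < K"
  shows "(\<integral>\<^sup>+ z \<in> annulus r. rim_part \<rho> r s z \<partial>lborel) \<le>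
    ennreal (2 * r) * (ennreal K * emeasure lborel (annulus r) +
      ennreal (inverse K ^ (DIM('a) - 1)) * sheet_integral (\<lambda>x. \<rho> x ^ DIM('a)) r s)"
    (is "_ \<le> ennreal (2 * r) * ?B")
proof -
  let ?f = "\<lambda>z t. \<rho> (sheet r s (t *\<^sub>R z)) * indicator {t. norm (flat (t *\<^sub>R z)) \<le> r} t"
  have [measurable]: "case_prod ?f \<in> borel_measurable (lborel \<Otimes>\<^sub>M lborel)"
    unfolding indicator_def by (simp add: case_prod_unfold) measurable
  have eq: "(\<integral>\<^sup>+ z \<in> annulus r. rim_part \<rho> r s z \<partial>lborel) =
      ennreal (2 * r) * (\<integral>\<^sup>+ z. \<integral>\<^sup>+ t. ?f z t * indicator {1..2} t * indicator (annulus r) z \<partial>lborel \<partial>lborel)"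
    unfolding rim_part_def by (rule nn_integral_cmult_section) measurable
  have "(\<integral>\<^sup>+ z. \<integral>\<^sup>+ t. ?f z t * indicator {1..2} t * indicator (annulus r) z \<partial>lborel \<partial>lborel) =
      (\<integral>\<^sup>+ t. \<integral>\<^sup>+ z. ?f z t * indicator {1..2} t * indicator (annulus r) z \<partial>lborel \<partial>lborel)"
    by (rule lborel_pair.Fubini'[symmetric]) measurable
  also have "\<dots> \<le> (\<integral>\<^sup>+ t \<in> {1..2::real}. ?B \<partial>lborel)"
  proof (rule nn_integral_mono)
    fix t :: real
    show "(\<integral>\<^sup>+ z. ?f z t * indicator {1..2} t * indicator (annulus r) z \<partial>lborel) \<le> ?B * indicator {1..2} t"
    proof (cases "t \<in> {1..2}")
      case True
      then have t: "0 < t" by simp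
      have "(\<integral>\<^sup>+ z. ?f z t * indicator {1..2} t * indicator (annulus r) z \<partial>lborel) =
          (\<integral>\<^sup>+ z \<in> annulus r. \<rho> (sheet r s (0 + t *\<^sub>R z)) * indicator {z. norm (flat (0 + t *\<^sub>R z)) \<le> r} z \<partial>lborel)"
        using True by (auto intro!: nn_integral_cong simp: indicator_def)
      also have "\<dots> \<le> ennreal K * emeasure lborel (annulus r) +
          ennreal (inverse K ^ (DIM('a) - 1)) * ennreal (inverse t ^ (DIM('a) - 1)) *
            sheet_integral (\<lambda>x. \<rho> x ^ DIM('a)) r s"
        by (rule annulus_average_le) (use t K in auto)
      also have "\<dots> \<le> ennreal K * emeasure lborel (annulus r) +
          ennreal (inverse K ^ (DIM('a) - 1)) * 1 * sheet_integral (\<lambda>x. \<rho> x ^ DIM('a)) r s"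
        using True K by (intro add_left_mono mult_right_mono mult_left_mono)
          (auto simp: inverse_le_1_iff intro!: power_le_one)
      finally show ?thesis using True by simp
    qed simp
  qed
  also have "\<dots> = ?B" by (simp add: nn_integral_cmult_indicator)
  finally show ?thesis unfolding eq by (rule mult_left_mono) simp
qed

text \<open>All segments issue from \<open>u\<close>, and the Jacobian factor
  \<open>inverse t ^ (n - 1)\<close> is not integrable at 0; hence the level varies with
  \<open>t\<close>. The exponent \<beta> satisfies
  \<open>(\<beta> - 1) * (n - 1) = - \<beta>\<close>, which makes the two terms of the average blow
  up at the same rate. The factor \<open>DIM('a)\<close> is the integral of
  \<open>t powr - \<beta>\<close> over \<open>{0..1}\<close>.\<close>

lemma inner_part_average:
  assumes [measurable]: "\<rho> \<in> borel_measurable borel" and r: "0 < r" and K: "0 < K"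
    and u: "norm (flat u) \<le> r"
  shows "(\<integral>\<^sup>+ z \<in> annulus r. inner_part \<rho> r s u z \<partial>lborel) \<le>
    ennreal (4 * r * DIM('a)) * (ennreal K * emeasure lborel (annulus r) +
      ennreal (inverse K ^ (DIM('a) - 1)) * sheet_integral (\<lambda>x. \<rho> x ^ DIM('a)) r s)"
    (is "_ \<le> ennreal (4 * r * DIM('a)) * ?B")
proof -
  let ?f = "\<lambda>z t. \<rho> (sheet r s ((1 - t) *\<^sub>R u + t *\<^sub>R z))"
  define n where "n = DIM('a)"
  have n: "2 \<le> n" using dim by (simp add: n_def)
  define \<beta> where "\<beta> = (real n - 1) / real n"
  have [measurable]: "case_prod ?f \<in> borel_measurable (lborel \<Otimes>\<^sub>M lborel)"
    by (simp add: case_prod_unfold) measurable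
  have eq: "(\<integral>\<^sup>+ z \<in> annulus r. inner_part \<rho> r s u z \<partial>lborel) =
      ennreal (4 * r) * (\<integral>\<^sup>+ z. \<integral>\<^sup>+ t. ?f z t * indicator {0..1} t * indicator (annulus r) z \<partial>lborel \<partial>lborel)"
    unfolding inner_part_def by (rule nn_integral_cmult_section) measurable
  have "(\<integral>\<^sup>+ z. \<integral>\<^sup>+ t. ?f z t * indicator {0..1} t * indicator (annulus r) z \<partial>lborel \<partial>lborel) =
      (\<integral>\<^sup>+ t. \<integral>\<^sup>+ z. ?f z t * indicator {0..1} t * indicator (annulus r) z \<partial>lborel \<partial>lborel)"
    by (rule lborel_pair.Fubini'[symmetric]) measurable
  also have "\<dots> \<le> (\<integral>\<^sup>+ t \<in> {0..1}. ?B * ennreal (t powr (- \<beta>)) \<partial>lborel)"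
  \<comment> \<open>The dilation degenerates at \<open>t = 0\<close>, a null set.\<close>
  proof (rule nn_integral_mono_AE, rule eventually_mono[OF AE_lborel_singleton[of 0]])
    fix t :: real assume t0: "t \<noteq> 0"
    show "(\<integral>\<^sup>+ z. ?f z t * indicator {0..1} t * indicator (annulus r) z \<partial>lborel) \<le>
        ?B * ennreal (t powr (- \<beta>)) * indicator {0..1} t"
    proof (cases "t \<in> {0..1}")
      case True
      then have t: "0 < t" "t \<le> 1" using t0 by auto
      define L where "L = K * t powr (- \<beta>)"
        \<comment> \<open>With this level both terms of the average are multiples of \<open>t powr - \<beta>\<close>, integrable at 0.\<close>
      have L: "0 < L" using K t by (simp add: L_def)
      have "norm (flat ((1 - t) *\<^sub>R u + t *\<^sub>R z)) \<le> r" if "z \<in> annulus r" for z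
      proof -
        have "norm (flat ((1 - t) *\<^sub>R u + t *\<^sub>R z)) \<le> (1 - t) * norm (flat u) + t * norm (flat z)"
          using t norm_triangle_ineq[of "(1 - t) *\<^sub>R flat u" "t *\<^sub>R flat z"] by simp
        also have "\<dots> \<le> (1 - t) * r + t * r"
          using t u that by (intro add_mono mult_left_mono) (auto simp: annulus_def)
        finally show ?thesis by (simp add: algebra_simps)
      qed
      then have "(\<integral>\<^sup>+ z. ?f z t * indicator {0..1} t * indicator (annulus r) z \<partial>lborel) =
          (\<integral>\<^sup>+ z \<in> annulus r. \<rho> (sheet r s ((1 - t) *\<^sub>R u + t *\<^sub>R z)) *
            indicator {z. norm (flat ((1 - t) *\<^sub>R u + t *\<^sub>R z)) \<le> r} z \<partial>lborel)"
        using True by (auto intro!: nn_integral_cong simp: indicator_def)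
      also have "\<dots> \<le> ennreal L * emeasure lborel (annulus r) +
          ennreal (inverse L ^ (n - 1)) * ennreal (inverse t ^ (n - 1)) *
            sheet_integral (\<lambda>x. \<rho> x ^ n) r s"
        unfolding n_def by (rule annulus_average_le) (use t L in auto)
      also have "ennreal (inverse L ^ (n - 1)) * ennreal (inverse t ^ (n - 1)) =
          ennreal (inverse K ^ (n - 1)) * ennreal (t powr (- \<beta>))"
      proof -
        have "inverse L * inverse t = inverse K * t powr (\<beta> - 1)"
          using t K by (simp add: L_def powr_minus powr_diff field_simps)
        then have "inverse L ^ (n - 1) * inverse t ^ (n - 1) = inverse K ^ (n - 1) * (t powr (\<beta> - 1)) ^ (n - 1)"
          by (metis power_mult_distrib)
        also have "(t powr (\<beta> - 1)) ^ (n - 1) = t powr ((\<beta> - 1) * (real n - 1))"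
          using t n by (simp add: powr_powr flip: powr_realpow)
        also have "(\<beta> - 1) * (real n - 1) = - \<beta>"
          using n by (simp add: \<beta>_def field_simps)
        finally show ?thesis
          using K t L by (simp flip: ennreal_mult)
      qed
      also have "ennreal L * emeasure lborel (annulus r) +
          ennreal (inverse K ^ (n - 1)) * ennreal (t powr (- \<beta>)) * sheet_integral (\<lambda>x. \<rho> x ^ n) r s =
          ?B * ennreal (t powr (- \<beta>))"
        using K by (simp add: L_def ennreal_mult distrib_left distrib_right mult_ac n_def)
      finally show ?thesis using True by simp
    qed simp
  qed
  also have "\<dots> = ?B * (\<integral>\<^sup>+ t \<in> {0..1}. ennreal (t powr (- \<beta>)) \<partial>lborel)"
    by (subst nn_integral_cmult[symmetric]) (auto simp: mult.assoc)
  also have "(\<integral>\<^sup>+ t \<in> {0..1}. ennreal (t powr (- \<beta>)) \<partial>lborel) = ennreal (real n)"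
  proof -
    have "- 1 < - \<beta>" using n by (simp add: \<beta>_def field_simps)
    from has_integral_powr_from_0[OF this, of 1]
    have "((\<lambda>t. t powr (- \<beta>)) has_integral (1 / (1 - \<beta>))) {0..1}" by simp
    moreover have "1 / (1 - \<beta>) = real n" using n by (simp add: \<beta>_def field_simps)
    ultimately show ?thesis
      by (intro nn_integral_has_integral_lebesgue') auto
  qed
  finally have "(\<integral>\<^sup>+ z \<in> annulus r. inner_part \<rho> r s u z \<partial>lborel) \<le> ennreal (4 * r) * (?B * ennreal (real n))"
    unfolding eq by (rule mult_left_mono) simp
  also have "\<dots> = ennreal (4 * r * DIM('a)) * ?B"
    using r by (simp add: ennreal_mult n_def mult_ac)
  finally show ?thesis .
qed

text \<open>The sum \<open>4 * real DIM('a) + 2\<close> collects the coefficients in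
  \<open>inner_part_average\<close> and \<open>rim_part_average\<close>; the further factor 4 and
  the power stem from the choice of the level in \<open>sheet_integrals_ge\<close>.\<close>

definition loewner_constant :: real where
  "loewner_constant =
    enn2real (emeasure lborel (annulus 1)) / (4 * (4 * real DIM('a) + 2)) ^ DIM('a)"

lemma loewner_constant_pos: "0 < loewner_constant"
  using annulus_1 by (simp add: loewner_constant_def enn2real_positive_iff)

text \<open>Averaging the admissibility of the paths over \<open>z\<close> bounds the measure
  \<zeta> of the annulus by \<open>2 * C * r\<close> times
  \<open>K * \<zeta> + inverse K ^ (n - 1) * j\<close>. For the chosen \<open>K\<close> the first
  term is half of \<zeta> and is absorbed. As \<zeta> scales like the power \<open>n - 1\<close> of
  \<open>r\<close>, and \<open>K ^ n\<close> like the power \<open>- n\<close>, a multiple of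
  \<open>1 / r\<close> remains.\<close>

lemma sheet_integrals_ge:
  assumes \<rho> [measurable]: "\<rho> \<in> borel_measurable borel" and r: "0 < r"
    and x: "cone_norm (x - q) = r" and y: "cone_norm (y - q) = r"
    and adm: "\<And>d. rectifiable_curve d 0 1 \<Longrightarrow> d 0 = x \<Longrightarrow> d 1 = y \<Longrightarrow>
      (\<And>t. t \<in> {0..1} \<Longrightarrow> cone_norm (d t - q) = r) \<Longrightarrow> 1 \<le> rect_line_integral \<rho> d 0 1"
  shows "ennreal (loewner_constant / r) \<le>
    sheet_integral (\<lambda>x. \<rho> x ^ DIM('a)) r 1 + sheet_integral (\<lambda>x. \<rho> x ^ DIM('a)) r (- 1)"
proof -
  define n where "n = DIM('a)"
  have n: "1 \<le> n" using dim by (simp add: n_def)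
  define J where "J = sheet_integral (\<lambda>x. \<rho> x ^ n) r 1 + sheet_integral (\<lambda>x. \<rho> x ^ n) r (- 1)"
  have J: "sheet_integral (\<lambda>x. \<rho> x ^ n) r s \<le> J" if "\<bar>s\<bar> = 1" for s
    using that by (auto simp: J_def abs_if split: if_splits)
  obtain s where s: "\<bar>s\<bar> = 1" "x = sheet r s (x - q)" using sheet_of_cone_norm[OF x] .
  obtain s' where s': "\<bar>s'\<bar> = 1" "y = sheet r s' (y - q)" using sheet_of_cone_norm[OF y] .
  have u: "norm (flat (x - q)) \<le> r" "norm (flat (y - q)) \<le> r"
    using norm_flat_cone_norm[of "x - q"] norm_flat_cone_norm[of "y - q"] x y by auto
  let ?S = "\<lambda>z. inner_part \<rho> r s (x - q) z + rim_part \<rho> r s z + (rim_part \<rho> r s' z + inner_part \<rho> r s' (y - q) z)"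
  have "1 \<le> ?S z" if z: "z \<in> annulus r" for z
  proof -
    obtain d where d: "rectifiable_curve d 0 1" "d 0 = sheet r s (x - q)" "d 1 = sheet r s' (y - q)"
      "\<And>t. t \<in> {0..1} \<Longrightarrow> cone_norm (d t - q) = r" "rect_line_integral \<rho> d 0 1 \<le> ?S z"
      using path_through_annulus[OF \<rho> r z s(1) s'(1) u] by metis
    then show ?thesis using adm[of d] s(2) s'(2) by (metis order_trans)
  qed
  then have "(\<integral>\<^sup>+ z. indicator (annulus r) z \<partial>lborel) \<le> (\<integral>\<^sup>+ z \<in> annulus r. ?S z \<partial>lborel)"
    by (intro nn_integral_mono) (simp split: split_indicator)
  then have "emeasure lborel (annulus r) \<le> (\<integral>\<^sup>+ z \<in> annulus r. ?S z \<partial>lborel)"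
    by (simp add: nn_integral_indicator)
  also have "\<dots> = (\<integral>\<^sup>+ z \<in> annulus r. inner_part \<rho> r s (x - q) z \<partial>lborel) +
      (\<integral>\<^sup>+ z \<in> annulus r. rim_part \<rho> r s z \<partial>lborel) +
      ((\<integral>\<^sup>+ z \<in> annulus r. rim_part \<rho> r s' z \<partial>lborel) +
      (\<integral>\<^sup>+ z \<in> annulus r. inner_part \<rho> r s' (y - q) z \<partial>lborel))"
  proof -
    have [measurable]: "(\<lambda>z. inner_part \<rho> r \<sigma> w z) \<in> borel_measurable borel" for \<sigma> w
      unfolding inner_part_def by measurable
    have [measurable]: "(\<lambda>z. rim_part \<rho> r \<sigma> z) \<in> borel_measurable borel" for \<sigma>
      unfolding rim_part_def indicator_def by measurable
    show ?thesis by (simp add: distrib_right nn_integral_add)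
  qed
  finally have le: "emeasure lborel (annulus r) \<le> \<dots>" .
  define \<zeta> where "\<zeta> = enn2real (emeasure lborel (annulus r))"
  have \<zeta>: "emeasure lborel (annulus r) = ennreal \<zeta>" "0 \<le> \<zeta>"
    using annulus_finite[OF r] by (simp_all add: \<zeta>_def)
  have \<zeta>1: "\<zeta> = r ^ (n - 1) * enn2real (emeasure lborel (annulus 1))"
    using r by (simp add: \<zeta>_def emeasure_annulus[OF r] enn2real_mult n_def)
  define C where "C = 4 * real n + 2"
  \<comment> \<open>Chosen so that \<open>2 * C * r * K = 1 / 2\<close>.\<close>
  define K where "K = inverse (4 * C * r)"
  have C: "0 < C" by (simp add: C_def)
  have K: "0 < K" using r C by (simp add: K_def)
  have "ennreal (loewner_constant / r) \<le> J"
  proof (cases "J = top")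
    case False
    define j where "j = enn2real J"
    have j: "J = ennreal j" "0 \<le> j" using False by (simp_all add: j_def less_top)
    let ?b = "K * \<zeta> + inverse K ^ (n - 1) * j"
    have B: "ennreal K * emeasure lborel (annulus r) +
      ennreal (inverse K ^ (n - 1)) * sheet_integral (\<lambda>x. \<rho> x ^ n) r \<sigma> \<le> ennreal ?b" if "\<bar>\<sigma>\<bar> = 1" for \<sigma>
    proof -
      have "ennreal K * emeasure lborel (annulus r) +
        ennreal (inverse K ^ (n - 1)) * sheet_integral (\<lambda>x. \<rho> x ^ n) r \<sigma> \<le>
        ennreal K * ennreal \<zeta> + ennreal (inverse K ^ (n - 1)) * ennreal j"
        using J[OF that] unfolding \<zeta>(1) j(1) by (intro add_left_mono mult_left_mono) auto
      also have "\<dots> = ennreal ?b"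
        using K \<zeta> j by (simp flip: ennreal_mult ennreal_plus)
      finally show ?thesis .
    qed
    have b0: "0 \<le> ?b" using K \<zeta> j by simp
    have I: "(\<integral>\<^sup>+ z \<in> annulus r. inner_part \<rho> r \<sigma> w z \<partial>lborel) \<le> ennreal (4 * r * n * ?b)"
      if "\<bar>\<sigma>\<bar> = 1" "norm (flat w) \<le> r" for \<sigma> w
    proof -
      have "(\<integral>\<^sup>+ z \<in> annulus r. inner_part \<rho> r \<sigma> w z \<partial>lborel) \<le> ennreal (4 * r * n) * ennreal ?b"
        using order_trans[OF inner_part_average[OF \<rho> r K that(2)] mult_left_mono[OF B[OF that(1), unfolded n_def]]]
        by (simp add: n_def)
      then show ?thesis using r b0 by (simp flip: ennreal_mult)
    qed
    have R: "(\<integral>\<^sup>+ z \<in> annulus r. rim_part \<rho> r \<sigma> z \<partial>lborel) \<le> ennreal (2 * r * ?b)"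
      if "\<bar>\<sigma>\<bar> = 1" for \<sigma>
    proof -
      have "(\<integral>\<^sup>+ z \<in> annulus r. rim_part \<rho> r \<sigma> z \<partial>lborel) \<le> ennreal (2 * r) * ennreal ?b"
        using order_trans[OF rim_part_average[OF \<rho> r K] mult_left_mono[OF B[OF that(1), unfolded n_def]]]
        by (simp add: n_def)
      then show ?thesis using r b0 by (simp flip: ennreal_mult)
    qed
    have "ennreal \<zeta> \<le> ennreal (4 * r * n * ?b) + ennreal (2 * r * ?b) + (ennreal (2 * r * ?b) + ennreal (4 * r * n * ?b))"
      using le unfolding \<zeta>(1) by (rule order_trans) (intro add_mono I R s s' u)
    also have "\<dots> = ennreal (2 * (4 * r * n * ?b) + 2 * (2 * r * ?b))"
    proof -
      have "ennreal X + ennreal Y + (ennreal Y + ennreal X) = ennreal (2 * X + 2 * Y)"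
        if "0 \<le> X" "0 \<le> Y" for X Y
        using that by (simp flip: ennreal_plus)
      then show ?thesis using r b0 by (auto intro: mult_nonneg_nonneg)
    qed
    also have "2 * (4 * r * n * ?b) + 2 * (2 * r * ?b) = 2 * C * r * ?b"
      by (simp add: C_def algebra_simps)
    finally have "\<zeta> \<le> 2 * C * r * ?b"
      using r b0 C by (simp add: ennreal_le_iff)
    also have "\<dots> = \<zeta> / 2 + 2 * C * r * inverse K ^ (n - 1) * j"
      using r C by (simp add: K_def field_simps)
    finally have "\<zeta> \<le> 4 * C * r * inverse K ^ (n - 1) * j" by simp
    also have "\<dots> = inverse K ^ n * j"
    proof -
      have "inverse K = 4 * C * r" by (simp only: K_def inverse_inverse_eq)
      then show ?thesis using n by (cases n) simp_all
    qed
    finally have "\<zeta> * K ^ n \<le> j"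
      using K by (simp add: field_simps power_inverse)
    also have "\<zeta> * K ^ n = loewner_constant / r"
    proof -
      have "K = inverse (4 * C) * inverse r" by (simp add: K_def)
      then have "K ^ n = inverse ((4 * C) ^ n) * inverse r ^ n"
        by (simp only: power_mult_distrib power_inverse)
      moreover have "inverse r ^ n = inverse r ^ (n - 1) * inverse r"
        using n by (cases n) simp_all
      ultimately have Kn: "K ^ n = inverse ((4 * C) ^ n) * (inverse r ^ (n - 1) * inverse r)"
        by (simp only:)
      have "r ^ (n - 1) * inverse r ^ (n - 1) = 1"
        using r by (simp flip: power_mult_distrib)
      moreover have "\<zeta> * K ^ n = enn2real (emeasure lborel (annulus 1)) * inverse ((4 * C) ^ n) * inverse r *
          (r ^ (n - 1) * inverse r ^ (n - 1))"
        unfolding \<zeta>1 Kn by (simp only: mult_ac)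
      ultimately have "\<zeta> * K ^ n = enn2real (emeasure lborel (annulus 1)) * inverse ((4 * C) ^ n) * inverse r"
        by (simp only: mult_1_right)
      then show ?thesis
        by (simp add: loewner_constant_def C_def n_def divide_inverse)
    qed
    finally show ?thesis unfolding j(1) by (rule ennreal_leI)
  qed simp
  then show ?thesis by (simp add: J_def n_def)
qed


text \<open>Each double cone of radius between \<open>a\<close> and \<open>b\<close> lies in
  \<open>G\<close> and carries points of \<open>E\<close> and \<open>F\<close>, so the bound
  \<open>loewner_constant / r\<close> can be integrated over \<open>r\<close>. The factor 1/2 is
  lost because the upper and the lower sheets are both estimated by the integral over the whole
  space.\<close>

lemma ring_modulus_ge:
  assumes a: "0 < a" "a < b"
    and G: "\<And>x. a < cone_norm (x - q) \<Longrightarrow> cone_norm (x - q) < b \<Longrightarrow> Fin x \<in> G"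
    and E: "\<And>r. a < r \<Longrightarrow> r < b \<Longrightarrow> \<exists>x. Fin x \<in> E \<and> cone_norm (x - q) = r"
    and F: "\<And>r. a < r \<Longrightarrow> r < b \<Longrightarrow> \<exists>x. Fin x \<in> F \<and> cone_norm (x - q) = r"
  shows "ennreal (loewner_constant * ln (b / a) / 2) \<le> modulus (joining E F G)"
  unfolding modulus_def
proof (rule INF_greatest)
  fix \<rho> assume "\<rho> \<in> admissible (joining E F G)"
  then have \<rho> [measurable]: "\<rho> \<in> borel_measurable borel"
    and adm: "\<And>\<gamma>. \<gamma> \<in> joining E F G \<Longrightarrow> locally_rectifiable \<gamma> \<Longrightarrow> 1 \<le> line_integral \<rho> \<gamma>"
    by (auto simp: admissible_def)
  let ?R = "\<lambda>x. \<rho> x ^ DIM('a)"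
  let ?J = "\<lambda>r. sheet_integral ?R r 1 + sheet_integral ?R r (- 1)"
  have J: "ennreal (loewner_constant / r) \<le> ?J r" if r: "a < r" "r < b" for r
  proof -
    obtain x y where x: "Fin x \<in> E" "cone_norm (x - q) = r" and y: "Fin y \<in> F" "cone_norm (y - q) = r"
      using E[OF r] F[OF r] by blast
    show ?thesis
    proof (rule sheet_integrals_ge[OF \<rho> _ x(2) y(2)])
      fix d assume d: "rectifiable_curve d 0 1" "d 0 = x" "d 1 = y"
        "\<And>t. t \<in> {0..1} \<Longrightarrow> cone_norm (d t - q) = r"
      have "path (Fin \<circ> d)"
        using rectifiable_curve_path[OF d(1)] unfolding path_def
        by (intro continuous_on_compose continuous_on_Fin)
      moreover have "(Fin \<circ> d) t \<in> G" if "t \<in> {0<..<1}" for t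
        using that d(4)[of t] G[of "d t"] r by simp
      ultimately have "({0..1}, Fin \<circ> d) \<in> joining E F G"
        unfolding joining_def using d x y by (auto simp: pathstart_def pathfinish_def)
      from adm[OF this line_integral_Fin(1)[OF d(1)]] line_integral_Fin(2)[OF d(1) \<rho>]
      show "1 \<le> rect_line_integral \<rho> d 0 1" by (rule order_trans)
    qed (use a r in auto)
  qed
  have "ennreal (loewner_constant * ln (b / a)) = (\<integral>\<^sup>+ r \<in> {a..b}. ennreal (loewner_constant / r) \<partial>lborel)"
  proof -
    have "((\<lambda>r. loewner_constant / r) has_integral (loewner_constant * ln b - loewner_constant * ln a)) {a..b}"
      using a by (intro fundamental_theorem_of_calculus)
        (auto intro!: derivative_eq_intros simp flip: has_real_derivative_iff_has_vector_derivative)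
    moreover have "loewner_constant * ln b - loewner_constant * ln a = loewner_constant * ln (b / a)"
      using a by (simp add: ln_div algebra_simps)
    ultimately show ?thesis
      using a loewner_constant_pos by (intro nn_integral_has_integral_lebesgue'[symmetric]) auto
  qed
  also have "\<dots> \<le> (\<integral>\<^sup>+ r. ?J r \<partial>lborel)"
  proof (rule nn_integral_mono_AE)
    show "AE r in lborel. ennreal (loewner_constant / r) * indicator {a..b} r \<le> ?J r"
      using AE_lborel_singleton[of a] AE_lborel_singleton[of b]
      by eventually_elim (use J in \<open>auto split: split_indicator\<close>)
  qed
  also have "\<dots> = (\<integral>\<^sup>+ r. sheet_integral ?R r 1 \<partial>lborel) + (\<integral>\<^sup>+ r. sheet_integral ?R r (- 1) \<partial>lborel)"
    using sheet_integral_measurable[of ?R] by (intro nn_integral_add) auto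
  also have "\<dots> \<le> (\<integral>\<^sup>+ x. ?R x \<partial>lborel) + (\<integral>\<^sup>+ x. ?R x \<partial>lborel)"
    by (intro add_mono nn_integral_sheet_integral_le) auto
  finally have le: "ennreal (loewner_constant * ln (b / a)) \<le> 2 * (\<integral>\<^sup>+ x. ?R x \<partial>lborel)"
    by (simp add: mult_2)
  have "ennreal (loewner_constant * ln (b / a) / 2) = ennreal (1 / 2) * ennreal (loewner_constant * ln (b / a))"
    by (subst ennreal_mult'[symmetric]) auto
  also have "\<dots> \<le> ennreal (1 / 2) * (2 * (\<integral>\<^sup>+ x. ?R x \<partial>lborel))"
    by (intro mult_left_mono le) simp
  also have "\<dots> = (\<integral>\<^sup>+ x. ?R x \<partial>lborel)"
  proof -
    have "ennreal (1 / 2) * 2 = 1"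
      by (metis ennreal_1 ennreal_mult ennreal_numeral nonzero_divide_eq_eq zero_le_divide_1_iff zero_le_numeral zero_neq_numeral)
    then show ?thesis by (simp flip: mult.assoc)
  qed
  finally show "ennreal (loewner_constant * ln (b / a) / 2) \<le> (\<integral>\<^sup>+ x. ?R x \<partial>lborel)" .
qed

section \<open>The property of weak flatness at interior points\<close>

lemma continuous_on_cone_norm: "continuous_on S cone_norm"
  unfolding cone_norm_def by (intro continuous_intros)

lemma cone_norm_0 [simp]: "cone_norm 0 = 0"
  by (simp add: cone_norm_def)

lemma norm_le_cone_norm: "norm x \<le> cone_norm x"
  using norm_triangle_ineq[of "(x \<bullet> e) *\<^sub>R e" "flat x"] by (simp add: cone_norm_def flat_def)

lemma cone_norm_le: "cone_norm x \<le> 3 * norm x"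
proof -
  have "\<bar>x \<bullet> e\<bar> \<le> norm x" using e by (rule Basis_le_norm)
  moreover have "norm (flat x) \<le> norm x + norm ((x \<bullet> e) *\<^sub>R e)"
    unfolding flat_def by (rule norm_triangle_ineq4)
  ultimately show ?thesis by (simp add: cone_norm_def)
qed

lemma open_cone_norm_less: "open (Fin ` {x. cone_norm (x - q) < r})"
proof -
  have "open {x. cone_norm (x - q) < r}"
    by (intro open_Collect_less continuous_intros continuous_on_compose2[OF continuous_on_cone_norm[of UNIV]]) auto
  then show ?thesis by (rule open_Fin_image)
qed

lemma closed_cone_norm_le: "closed (Fin ` {x. cone_norm (x - q) \<le> r})"
proof (rule closed_Fin_image)
  have "closed {x. cone_norm (x - q) \<le> r}"
    by (intro closed_Collect_le continuous_intros continuous_on_compose2[OF continuous_on_cone_norm[of UNIV]]) auto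
  moreover have "{x. cone_norm (x - q) \<le> r} \<subseteq> cball q r"
    using norm_le_cone_norm order_trans by (fastforce simp: dist_norm norm_minus_commute)
  ultimately show "compact {x. cone_norm (x - q) \<le> r}"
    by (metis bounded_cball bounded_subset compact_eq_bounded_closed)
qed

text \<open>The point \<open>y\<close> may be \<open>Infty\<close>, so \<open>E\<close> is separated
  by open sets of the extended space instead of applying an intermediate value theorem to
  \<open>cone_norm\<close>.\<close>

lemma connected_meets_cone_norm_sphere:
  assumes "connected E" and i: "Fin x \<in> E" "cone_norm (x - q) < r"
    and o: "y \<in> E" "y \<notin> Fin ` {x. cone_norm (x - q) \<le> r}"
  shows "\<exists>x. Fin x \<in> E \<and> cone_norm (x - q) = r"
proof (rule ccontr)
  assume no: "\<not> ?thesis"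
  let ?I = "Fin ` {x. cone_norm (x - q) < r}" and ?O = "- Fin ` {x. cone_norm (x - q) \<le> r}"
  have "E \<subseteq> ?I \<union> ?O" using no by fastforce
  moreover have "?I \<inter> ?O \<inter> E = {}" by auto
  moreover have "open ?I" "open ?O" using open_cone_norm_less closed_cone_norm_le by auto
  ultimately have "?I \<inter> E = {} \<or> ?O \<inter> E = {}" using \<open>connected E\<close> connectedD by blast
  then show False using i o by blast
qed

text \<open>The defining property of weak flatness holds at interior points by the ring estimate, so
  that boundary and interior points can later be treated alike. The inner radius \<open>a\<close> is
  chosen such that \<open>ln (s / a) = M\<close>, which turns the estimate into
  \<open>P + 1\<close>.\<close>

lemma interior_weakly_flat_Fin:
  assumes "open G" "Fin q \<in> G"
  shows "weakly_flat_at G (Fin q)"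
  unfolding weakly_flat_at_def
proof (intro allI impI, elim conjE)
  fix P :: real and U assume P: "0 < P" and U: "open U" "Fin q \<in> U"
  obtain s where s: "0 < s" "Fin ` cball q s \<subseteq> U \<inter> G"
    using open_Fin_obtain[of "U \<inter> G" q] assms U by blast
  define M where "M = 2 * (P + 1) / loewner_constant"
  have M: "0 < M" using P loewner_constant_pos by (simp add: M_def)
  define a where "a = s * exp (- M)"
  have a: "0 < a" "a < s" using s M by (simp_all add: a_def)
  have in_s: "Fin x \<in> U \<inter> G" if "cone_norm (x - q) \<le> s" for x
    using that norm_le_cone_norm[of "x - q"] s(2) by (auto simp: dist_norm norm_minus_commute image_subset_iff)
  let ?V = "Fin ` {x. cone_norm (x - q) < a}"
  show "\<exists>V. open V \<and> Fin q \<in> V \<and> V \<subseteq> U \<and>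
      (\<forall>E F. continuum E \<and> continuum F \<and> E \<subseteq> G \<and> F \<subseteq> G \<and>
         E \<inter> frontier U \<noteq> {} \<and> E \<inter> frontier V \<noteq> {} \<and> F \<inter> frontier U \<noteq> {} \<and> F \<inter> frontier V \<noteq> {} \<longrightarrow>
         ennreal P < modulus (joining E F G))"
  proof (intro exI[of _ ?V] conjI allI impI)
    show "open ?V" by (rule open_cone_norm_less)
    show "Fin q \<in> ?V" using a by simp
    show "?V \<subseteq> U" using in_s a by auto
    have cross: "\<exists>x. Fin x \<in> E \<and> cone_norm (x - q) = r"
      if E: "continuum E" "E \<inter> frontier U \<noteq> {}" "E \<inter> frontier ?V \<noteq> {}" and r: "a < r" "r < s" for E r
    proof -
      have "?V \<subseteq> Fin ` {x. cone_norm (x - q) \<le> a}" by auto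
      then have "closure ?V \<subseteq> Fin ` {x. cone_norm (x - q) \<le> a}"
        using closed_cone_norm_le by (rule closure_minimal)
      then obtain x where x: "Fin x \<in> E" "cone_norm (x - q) \<le> a"
        using E(3) by (auto simp: frontier_def)
      obtain y where y: "y \<in> E" "y \<in> frontier U" using E(2) by blast
      have "y \<notin> U" using y(2) U(1) by (simp add: frontier_def interior_open)
      then have "y \<notin> Fin ` {x. cone_norm (x - q) \<le> r}" using in_s r by fastforce
      then show ?thesis
        using connected_meets_cone_norm_sphere[of E x r y] E(1) x y r by (auto simp: continuum_def)
    qed
    fix E F
    assume EF: "continuum E \<and> continuum F \<and> E \<subseteq> G \<and> F \<subseteq> G \<and>
         E \<inter> frontier U \<noteq> {} \<and> E \<inter> frontier ?V \<noteq> {} \<and> F \<inter> frontier U \<noteq> {} \<and> F \<inter> frontier ?V \<noteq> {}"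
    have "ennreal (loewner_constant * ln (s / a) / 2) \<le> modulus (joining E F G)"
      using EF by (intro ring_modulus_ge a cross) (use in_s in auto)
    moreover have "s / a = exp M" using s by (simp add: a_def exp_minus inverse_eq_divide)
    then have "loewner_constant * ln (s / a) / 2 = P + 1"
      using loewner_constant_pos by (simp add: M_def)
    ultimately show "ennreal P < modulus (joining E F G)"
      using P by (metis ennreal_lessI less_add_one less_le_trans add_pos_pos zero_less_one)
  qed
qed

text \<open>The same ring estimate with the roles of the radii exchanged: \<open>V\<close> is the
  complement of a large closed ball for \<open>cone_norm\<close>, around an arbitrary finite center
  \<open>q\<close>.\<close>

lemma interior_weakly_flat_Infty:
  fixes G :: "'a onept set"
  assumes "open G" "Infty \<in> G"
  shows "weakly_flat_at G Infty"
  unfolding weakly_flat_at_def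
proof (intro allI impI, elim conjE)
  fix P :: real and U :: "'a onept set" assume P: "0 < P" and U: "open U" "Infty \<in> U"
  obtain R where R: "0 < R" "\<And>x. R \<le> norm x \<Longrightarrow> Fin x \<in> U \<inter> G"
    using open_Infty_obtain[of "U \<inter> G"] assms U by blast
  define M where "M = 2 * (P + 1) / loewner_constant"
  have M: "0 < M" using P loewner_constant_pos by (simp add: M_def)
  \<comment> \<open>By \<open>cone_norm_le\<close>, points with
    \<open>s \<le> cone_norm (x - q)\<close> have norm at least \<open>R\<close>.\<close>
  define s where "s = 3 * (R + norm q)"
  have s: "0 < s" using R by (simp add: s_def add_pos_nonneg)
  define b where "b = s * exp M"
  have b: "s < b" using s M by (simp add: b_def)
  have in_s: "Fin x \<in> U \<inter> G" if "s \<le> cone_norm (x - q)" for x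
  proof -
    have "R + norm q \<le> norm (x - q)" using that cone_norm_le[of "x - q"] by (simp add: s_def)
    also have "\<dots> \<le> norm x + norm q" by (rule norm_triangle_ineq4)
    finally show ?thesis by (intro R) simp
  qed
  let ?V = "- Fin ` {x. cone_norm (x - q) \<le> b}"
  show "\<exists>V. open V \<and> Infty \<in> V \<and> V \<subseteq> U \<and>
      (\<forall>E F. continuum E \<and> continuum F \<and> E \<subseteq> G \<and> F \<subseteq> G \<and>
         E \<inter> frontier U \<noteq> {} \<and> E \<inter> frontier V \<noteq> {} \<and> F \<inter> frontier U \<noteq> {} \<and> F \<inter> frontier V \<noteq> {} \<longrightarrow>
         ennreal P < modulus (joining E F G))"
  proof (intro exI[of _ ?V] conjI allI impI)
    show "open ?V" using closed_cone_norm_le by blast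
    show "Infty \<in> ?V" by auto
    show "?V \<subseteq> U"
    proof
      fix y assume "y \<in> ?V"
      then show "y \<in> U" using in_s b U(2) by (cases y) force+
    qed
    have cross: "\<exists>x. Fin x \<in> E \<and> cone_norm (x - q) = r"
      if E: "continuum E" "E \<inter> frontier U \<noteq> {}" "E \<inter> frontier ?V \<noteq> {}" and r: "s < r" "r < b" for E r
    proof -
      have "?V \<subseteq> - Fin ` {x. cone_norm (x - q) < b}" by auto
      then have "closure ?V \<subseteq> - Fin ` {x. cone_norm (x - q) < b}"
        using open_cone_norm_less by (intro closure_minimal) auto
      then obtain y where y: "y \<in> E" "y \<notin> Fin ` {x. cone_norm (x - q) < b}"
        using E(3) by (auto simp: frontier_def)
      then have y': "y \<notin> Fin ` {x. cone_norm (x - q) \<le> r}" using r by auto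
      obtain x where x: "x \<in> E" "x \<in> frontier U" using E(2) by blast
      have "x \<notin> U" using x(2) U(1) by (simp add: frontier_def interior_open)
      then obtain x' where "x = Fin x'" "cone_norm (x' - q) < s"
        using in_s U(2) by (cases x) force+
      then show ?thesis
        using connected_meets_cone_norm_sphere[of E x' r y] E(1) x y y' r by (auto simp: continuum_def)
    qed
    fix E F
    assume EF: "continuum E \<and> continuum F \<and> E \<subseteq> G \<and> F \<subseteq> G \<and>
         E \<inter> frontier U \<noteq> {} \<and> E \<inter> frontier ?V \<noteq> {} \<and> F \<inter> frontier U \<noteq> {} \<and> F \<inter> frontier ?V \<noteq> {}"
    have "ennreal (loewner_constant * ln (b / s) / 2) \<le> modulus (joining E F G)"
      using EF by (intro ring_modulus_ge s b cross) (use in_s in auto)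
    moreover have "b / s = exp M" using s by (simp add: b_def)
    then have "loewner_constant * ln (b / s) / 2 = P + 1"
      using loewner_constant_pos by (simp add: M_def)
    ultimately show "ennreal P < modulus (joining E F G)"
      using P by (metis ennreal_lessI less_add_one less_le_trans add_pos_pos zero_less_one)
  qed
qed

end

lemma interior_weakly_flat:
  fixes G :: "'a::euclidean_space onept set"
  assumes "2 \<le> DIM('a)" "open G" "y \<in> G"
  shows "weakly_flat_at G y"
proof -
  obtain e :: 'a where "e \<in> Basis" using nonempty_Basis by blast
  then have "slicing e" using assms(1) by (simp add: slicing_def)
  then show ?thesis
    using slicing.interior_weakly_flat_Fin slicing.interior_weakly_flat_Infty assms(2,3)
    by (cases y) blast+
qed

section \<open>Upper bounds for the modulus\<close>

text \<open>Each curve that matters has a curve of some \<open>\<Delta> i\<close> below it, so the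
  pointwise supremum of densities for the \<open>\<Delta> i\<close> is admissible, and its power is
  at most the sum of theirs. The summand 1 makes room for infima that are not attained.\<close>

lemma modulus_le_minorized:
  fixes \<Gamma> :: "'a::euclidean_space onept curve set" and B :: real
  assumes I: "finite I" and B: "\<And>i. i \<in> I \<Longrightarrow> modulus (\<Delta> i) \<le> ennreal B" "0 \<le> B"
    and sub: "\<And>\<gamma>. \<gamma> \<in> \<Gamma> \<Longrightarrow> locally_rectifiable \<gamma> \<Longrightarrow> \<exists>i\<in>I. \<exists>\<gamma>'\<in>\<Delta> i. locally_rectifiable \<gamma>' \<and>
      (\<forall>\<rho>\<in>borel_measurable borel. line_integral \<rho> \<gamma>' \<le> line_integral \<rho> \<gamma>)"
  shows "modulus \<Gamma> \<le> ennreal (card I * (B + 1))"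
proof -
  let ?n = "DIM('a)"
  have "\<exists>\<rho>\<in>admissible (\<Delta> i). (\<integral>\<^sup>+ x. \<rho> x ^ ?n \<partial>lborel) < ennreal (B + 1)" if "i \<in> I" for i
    using le_less_trans[OF B(1)[OF that], of "ennreal (B + 1)"] B(2)
    unfolding modulus_def INF_less_iff by (simp add: ennreal_less_iff)
  then obtain r where r: "\<And>i. i \<in> I \<Longrightarrow> r i \<in> admissible (\<Delta> i)"
    "\<And>i. i \<in> I \<Longrightarrow> (\<integral>\<^sup>+ x. r i x ^ ?n \<partial>lborel) < ennreal (B + 1)"
    by metis
  have rm: "r i \<in> borel_measurable borel" if "i \<in> I" for i
    using r(1)[OF that] by (simp add: admissible_def)
  define \<rho> where "\<rho> x = (SUP i\<in>I. r i x)" for x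
  have \<rho>m: "\<rho> \<in> borel_measurable borel"
    unfolding \<rho>_def by (rule borel_measurable_SUP) (use I rm in \<open>auto intro: countable_finite\<close>)
  have "\<rho> \<in> admissible \<Gamma>"
    unfolding admissible_def
  proof (intro CollectI conjI ballI impI \<rho>m)
    fix \<gamma> assume "\<gamma> \<in> \<Gamma>" "locally_rectifiable \<gamma>"
    then obtain i \<gamma>' where i: "i \<in> I" "\<gamma>' \<in> \<Delta> i" "locally_rectifiable \<gamma>'"
      "line_integral \<rho> \<gamma>' \<le> line_integral \<rho> \<gamma>"
      using sub \<rho>m by blast
    have "1 \<le> line_integral (r i) \<gamma>'"
      using r(1)[OF i(1)] i by (auto simp: admissible_def)
    also have "\<dots> \<le> line_integral \<rho> \<gamma>'"
      unfolding line_integral_def rect_line_integral_def \<rho>_def using i(1)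
      by (cases \<gamma>') (auto intro!: SUP_mono' nn_integral_mono mult_right_mono SUP_upper)
    finally show "1 \<le> line_integral \<rho> \<gamma>" using i(4) by (rule order_trans)
  qed
  then have "modulus \<Gamma> \<le> (\<integral>\<^sup>+ x. \<rho> x ^ ?n \<partial>lborel)"
    unfolding modulus_def by (rule INF_lower)
  also have "\<dots> \<le> (\<integral>\<^sup>+ x. (\<Sum>i\<in>I. r i x ^ ?n) \<partial>lborel)"
  proof (rule nn_integral_mono)
    fix x
    show "\<rho> x ^ ?n \<le> (\<Sum>i\<in>I. r i x ^ ?n)"
    proof (cases "I = {}")
      case False
      have "\<rho> x = Max ((\<lambda>i. r i x) ` I)"
        unfolding \<rho>_def using I False by (intro cSup_eq_Max) auto
      then have "\<rho> x \<in> (\<lambda>i. r i x) ` I" using I False by (metis Max_in finite_imageI image_is_empty)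
      then obtain i where "i \<in> I" "\<rho> x = r i x" by blast
      then show ?thesis using I member_le_sum[of i I "\<lambda>i. r i x ^ ?n"] by simp
    qed (simp add: \<rho>_def bot_ennreal)
  qed
  also have "\<dots> = (\<Sum>i\<in>I. \<integral>\<^sup>+ x. r i x ^ ?n \<partial>lborel)"
    by (rule nn_integral_sum) (use rm in measurable)
  also have "\<dots> \<le> (\<Sum>i\<in>I. ennreal (B + 1))"
    using r(2) by (intro sum_mono less_imp_le)
  also have "\<dots> = ennreal (card I * (B + 1))"
    using B(2) by (simp add: ennreal_mult ennreal_of_nat_eq_real_of_nat)
  finally show ?thesis .
qed

section \<open>Modulus bounds from the ring condition\<close>

lemma locally_rectifiable_interval:
  fixes c :: "real \<Rightarrow> 'a::real_inner onept"
  assumes c: "path c" and l: "locally_rectifiable ({0..1}, c)"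
  shows "rectifiable_curve (the_fin \<circ> c) 0 1" and "\<And>t. t \<in> {0..1} \<Longrightarrow> c t = Fin (the_fin (c t))"
proof -
  have r: "c ` {0..1} \<subseteq> range Fin" and len: "curve_length (the_fin \<circ> c) 0 1 < \<infinity>"
    using l by (auto simp: locally_rectifiable_def)
  have "continuous_on {0..1} (the_fin \<circ> c)"
    using c unfolding path_def
    by (intro continuous_on_compose continuous_on_subset[OF continuous_on_the_fin r])
  then show "rectifiable_curve (the_fin \<circ> c) 0 1"
    using len by unfold_locales auto
  show "c t = Fin (the_fin (c t))" if "t \<in> {0..1}" for t
    using r that by force
qed

text \<open>Members of \<open>joining\<close> are parametrised by \<open>{0..1}\<close>, so a
  subcurve has to be stretched to this interval; its compact subcurves correspond to some of those
  of \<open>c\<close>.\<close>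

lemma subcurve_line_integral:
  fixes c :: "real \<Rightarrow> 'a::real_inner onept"
  assumes c: "path c" and l: "locally_rectifiable ({0..1}, c)"
    and uv: "0 \<le> u" "u < v" "v \<le> 1" and d: "\<And>t. t \<in> {0..1} \<Longrightarrow> d t = c ((v - u) * t + u)"
  shows "locally_rectifiable ({0..1}, d)"
    and "line_integral \<rho> ({0..1}, d) \<le> line_integral \<rho> ({0..1}, c)"
proof -
  interpret rectifiable_curve "the_fin \<circ> c" 0 1 by (rule locally_rectifiable_interval(1)[OF c l])
  let ?\<phi> = "\<lambda>t. (v - u) * t + u"
  have \<phi>: "?\<phi> a \<le> ?\<phi> b" if "a \<le> b" for a b
    using that uv by (simp add: mult_left_mono)
  have \<phi>01: "0 \<le> ?\<phi> a" "?\<phi> a \<le> 1" if "0 \<le> a" "a \<le> 1" for a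
    using \<phi>[of 0 a] \<phi>[of a 1] that uv by auto
  have R: "rectifiable_curve (the_fin \<circ> d) a b"
    "rect_line_integral \<rho> (the_fin \<circ> d) a b = rect_line_integral \<rho> (the_fin \<circ> c) (?\<phi> a) (?\<phi> b)"
    if "0 \<le> a" "a \<le> b" "b \<le> 1" for a b
  proof -
    have S: "rectifiable_curve (the_fin \<circ> c) (?\<phi> a) (?\<phi> b)"
      using that \<phi>01[of a] \<phi>01[of b] \<phi>[of a b] by (intro sub) auto
    have "0 < v - u" using uv by simp
    moreover have "(the_fin \<circ> d) t = (the_fin \<circ> c) (?\<phi> t)" if "t \<in> {a..b}" for t
      using that \<open>0 \<le> a\<close> \<open>b \<le> 1\<close> d[of t] by simp
    ultimately show "rectifiable_curve (the_fin \<circ> d) a b"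
      "rect_line_integral \<rho> (the_fin \<circ> d) a b = rect_line_integral \<rho> (the_fin \<circ> c) (?\<phi> a) (?\<phi> b)"
      using rect_line_integral_affine[OF S _ \<open>a \<le> b\<close>] by blast+
  qed
  show "locally_rectifiable ({0..1}, d)"
    unfolding locally_rectifiable_def prod.case
  proof (intro conjI ballI impI subsetI)
    fix w assume "w \<in> d ` {0..1}"
    then obtain t where t: "t \<in> {0..1}" "w = d t" by blast
    then have "w = Fin (the_fin (c (?\<phi> t)))"
      using d[OF t(1)] locally_rectifiable_interval(2)[OF c l, of "?\<phi> t"] \<phi>01[of t] by simp
    then show "w \<in> range Fin" by blast
  next
    fix a b :: real assume "a \<in> {0..1}" "b \<in> {0..1}" "a \<le> b"
    then show "curve_length (the_fin \<circ> d) a b < \<infinity>"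
      using R(1)[of a b] by (simp add: rectifiable_curve_def)
  qed
  show "line_integral \<rho> ({0..1}, d) \<le> line_integral \<rho> ({0..1}, c)"
    unfolding line_integral_def prod.case
  proof (rule SUP_least, clarify)
    fix a b :: real assume ab: "a \<in> {0..1}" "b \<in> {0..1}" "a \<le> b"
    have "(?\<phi> a, ?\<phi> b) \<in> {(a, b). a \<in> {0..1} \<and> b \<in> {0..1} \<and> a \<le> b}"
      using ab \<phi>01[of a] \<phi>01[of b] \<phi>[of a b] by auto
    from SUP_upper[OF this, of "\<lambda>(a, b). rect_line_integral \<rho> (the_fin \<circ> c) a b"]
    show "rect_line_integral \<rho> (the_fin \<circ> d) a b \<le>
        (SUP (a, b)\<in>{(a, b). a \<in> {0..1} \<and> b \<in> {0..1} \<and> a \<le> b}. rect_line_integral \<rho> (the_fin \<circ> c) a b)"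
      using R(2)[of a b] ab by simp
  qed
qed

text \<open>The constant weight \<open>inverse (r2 - r1)\<close> has integral one; enlarging the
  ring to all of \<open>D\<close> leaves a bound that does not depend on the center.\<close>

lemma ring_Q_mapping_constant:
  fixes Q :: "'a::euclidean_space \<Rightarrow> ennreal"
  assumes ring: "ring_Q_mapping_at Q D f x0" and r: "0 < r1" "r1 < r2"
    and d0: "ereal r2 < (SUP x\<in>D. ereal (norm (x - x0)))"
    and Q: "Q \<in> borel_measurable lebesgue" and D: "D \<in> sets lebesgue"
  shows "modulus (image_curves f D (joining (sphere x0 r1) (sphere x0 r2) D)) \<le>
    ennreal (inverse (r2 - r1) ^ DIM('a)) * (\<integral>\<^sup>+ x \<in> D. Q x \<partial>lebesgue)"
proof -
  let ?k = "inverse (r2 - r1)"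
  have "(\<integral>\<^sup>+ r. ennreal ?k \<partial>lebesgue_on {r1<..<r2}) = ennreal ?k * ennreal (r2 - r1)"
    using r by (simp add: emeasure_restrict_space)
  also have "\<dots> = 1" using r by (simp flip: ennreal_mult)
  finally have "1 \<le> (\<integral>\<^sup>+ r. ennreal ?k \<partial>lebesgue_on {r1<..<r2})" by simp
  then have "modulus (image_curves f D (joining (sphere x0 r1) (sphere x0 r2) D)) \<le>
      (\<integral>\<^sup>+ x \<in> {x. r1 < norm (x - x0) \<and> norm (x - x0) < r2} \<inter> D. Q x * ennreal ?k ^ DIM('a) \<partial>lebesgue)"
    using ring r d0 unfolding ring_Q_mapping_at_def
    by (elim allE[of _ r1] allE[of _ r2] allE[of _ "\<lambda>_. ennreal ?k"]) simp
  also have "\<dots> \<le> (\<integral>\<^sup>+ x. ennreal (?k ^ DIM('a)) * (Q x * indicator D x) \<partial>lebesgue)"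
    using r by (intro nn_integral_mono) (auto simp: ennreal_power mult_ac split: split_indicator)
  also have "\<dots> = ennreal (?k ^ DIM('a)) * (\<integral>\<^sup>+ x \<in> D. Q x \<partial>lebesgue)"
    using Q D by (intro nn_integral_cmult borel_measurable_times_ennreal borel_measurable_indicator)
  finally show ?thesis .
qed

text \<open>The preimage of a joining curve starts within \<open>\<eta> / 4\<close> of one of
  finitely many centers and ends farther than \<open>\<eta> / 2\<close> from it. It thus contains a
  subcurve joining the two spheres, to which the ring condition at this center applies. The order of
  quantifiers is essential: \<open>C\<close> is fixed before \<open>D'\<close>, \<open>f\<close>,
  \<open>E\<close> and \<open>F\<close>.\<close>

lemma image_joining_modulus_bounded:
  fixes D :: "'a::euclidean_space set"
  assumes D: "bounded D" "open D" and Q: "Q \<in> borel_measurable lebesgue"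
    and fin: "(\<integral>\<^sup>+ x \<in> D. Q x \<partial>lebesgue) < \<infinity>" and \<eta>: "0 < \<eta>"
  obtains C :: real where "0 < C"
    "\<forall>D' f g E F. homeomorphism D' D g f \<longrightarrow> ring_Q_mapping_in Q D f (closure D) \<longrightarrow> E \<subseteq> D \<longrightarrow> F \<subseteq> D \<longrightarrow>
      (\<forall>x\<in>E. \<forall>y\<in>F. \<eta> \<le> dist x y) \<longrightarrow> modulus (joining (f ` E) (f ` F) D') \<le> ennreal C"
proof -
  have "compact (closure D)" using D by simp
  then obtain X where X: "finite X" "X \<subseteq> closure D" "closure D \<subseteq> (\<Union>x\<in>X. ball x (\<eta> / 4))"
    by (rule compactE_image[of "closure D" "closure D" "\<lambda>x. ball x (\<eta> / 4)"]) (use \<eta> in auto)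
  define L where "L = enn2real (\<integral>\<^sup>+ x \<in> D. Q x \<partial>lebesgue)"
  have L: "(\<integral>\<^sup>+ x \<in> D. Q x \<partial>lebesgue) = ennreal L" "0 \<le> L" using fin by (simp_all add: L_def)
  define B where "B = inverse (\<eta> / 4) ^ DIM('a) * L"
  have B: "0 \<le> B" using \<eta> L by (simp add: B_def)
  show thesis
  proof (rule that)
    \<comment> \<open>The last summand keeps the bound positive even if the cover is empty; weak
      flatness is applied with this bound.\<close>
    show "0 < card X * (B + 1) + 1" using B by (simp add: add_nonneg_pos)
  next
    show "\<forall>D' f g E F. homeomorphism D' D g f \<longrightarrow> ring_Q_mapping_in Q D f (closure D) \<longrightarrow> E \<subseteq> D \<longrightarrow> F \<subseteq> D \<longrightarrow>
      (\<forall>x\<in>E. \<forall>y\<in>F. \<eta> \<le> dist x y) \<longrightarrow> modulus (joining (f ` E) (f ` F) D') \<le> ennreal (card X * (B + 1) + 1)"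
    proof (intro allI impI)
      fix D' f g E F
      assume h: "homeomorphism D' D g f" and ring: "ring_Q_mapping_in Q D f (closure D)"
        and EF: "E \<subseteq> D" "F \<subseteq> D" and dist: "\<forall>x\<in>E. \<forall>y\<in>F. \<eta> \<le> dist x y"
      \<comment> \<open>The ring condition speaks only of radii below the supremal distance of
        points of \<open>D\<close> from the center. Other centers are never selected, since the end
        point of the preimage curve lies beyond \<open>\<eta> / 2\<close>.\<close>
      define I where "I = {x \<in> X. ereal (\<eta> / 2) < (SUP y\<in>D. ereal (norm (y - x)))}"
      let ?\<Delta> = "\<lambda>x. image_curves f D (joining (sphere x (\<eta> / 4)) (sphere x (\<eta> / 2)) D)"
      have "modulus (joining (f ` E) (f ` F) D') \<le> ennreal (card I * (B + 1))"
      proof (rule modulus_le_minorized[where I = I and \<Delta> = ?\<Delta> and B = B])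
        show "finite I" using X by (simp add: I_def)
        show "modulus (?\<Delta> x) \<le> ennreal B" if "x \<in> I" for x
        proof -
          have x: "x \<in> closure D" "ereal (\<eta> / 2) < (SUP y\<in>D. ereal (norm (y - x)))"
            using that X by (auto simp: I_def)
          have "ring_Q_mapping_at Q D f x" using ring x(1) by (simp add: ring_Q_mapping_in_def)
          from ring_Q_mapping_constant[OF this _ _ x(2) Q, of "\<eta> / 4"] \<eta> D(2) L(2)
          show ?thesis by (simp add: L(1) B_def flip: ennreal_mult)
        qed
        fix \<gamma> assume "\<gamma> \<in> joining (f ` E) (f ` F) D'" and lr: "locally_rectifiable \<gamma>"
        then obtain c where \<gamma>: "\<gamma> = ({0..1}, c)" and c: "path c" "c 0 \<in> f ` E" "c 1 \<in> f ` F"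
          "\<And>t. t \<in> {0<..<1} \<Longrightarrow> c t \<in> D'"
          by (auto simp: joining_def pathstart_def pathfinish_def)
        have fD: "f ` D = D'" and gf: "\<And>x. x \<in> D \<Longrightarrow> g (f x) = x" and fg: "\<And>y. y \<in> D' \<Longrightarrow> f (g y) = y"
          and gD: "g ` D' = D" and gc: "continuous_on D' g"
          using h by (auto simp: homeomorphism_def)
        have cD: "c t \<in> D'" if "t \<in> {0..1}" for t
          using that c EF fD by (cases "t = 0 \<or> t = 1") auto
        define p where "p = g \<circ> c"
        have pD: "p t \<in> D" if "t \<in> {0..1}" for t using cD[OF that] gD by (auto simp: p_def)
        have p: "continuous_on {0..1} p"
          unfolding p_def using c(1) cD
          by (intro continuous_on_compose) (auto simp: path_def intro: continuous_on_subset[OF gc])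
        have p01: "p 0 \<in> E" "p 1 \<in> F" using c gf EF by (auto simp: p_def)
        then have "p 0 \<in> closure D" using EF closure_subset by blast
        then obtain x where x: "x \<in> X" "dist x (p 0) < \<eta> / 4" using X by auto
        have "\<eta> \<le> dist (p 0) (p 1)" using dist p01 by blast
        then have far: "\<eta> / 2 < dist x (p 1)"
          using x(2) dist_triangle[of "p 0" "p 1" x] \<eta> by (simp add: dist_commute)
        then have "ereal (\<eta> / 2) < ereal (norm (p 1 - x))" by (simp add: dist_norm norm_minus_commute)
        also have "\<dots> \<le> (SUP y\<in>D. ereal (norm (y - x)))" by (rule SUP_upper) (simp add: pD)
        finally have xI: "x \<in> I" using x by (simp add: I_def)
        have cd: "continuous_on {0..1} (\<lambda>t. dist x (p t))"
          using p by (intro continuous_intros)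
        obtain u where u: "0 \<le> u" "u \<le> 1" "dist x (p u) = \<eta> / 4"
          using IVT'[of "\<lambda>t. dist x (p t)" 0 "\<eta> / 4" 1] x(2) far cd \<eta> by auto
        obtain v where v: "u \<le> v" "v \<le> 1" "dist x (p v) = \<eta> / 2"
          using IVT'[of "\<lambda>t. dist x (p t)" u "\<eta> / 2" 1] u far continuous_on_subset[OF cd] \<eta> by force
        have uv: "u < v" using u v \<eta> by (cases "u = v") auto
        let ?\<phi> = "\<lambda>t. (v - u) * t + u"
        have \<phi>: "?\<phi> t \<in> {0..1}" if "t \<in> {0..1}" for t
        proof -
          have "0 \<le> (v - u) * t" "(v - u) * t \<le> v - u"
            using that uv by (auto simp: mult_left_le)
          then show ?thesis using u v by auto
        qed
        define q where "q = p \<circ> ?\<phi>"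
        have qD: "q t \<in> D" if "t \<in> {0..1}" for t
          unfolding q_def comp_def by (rule pD[OF \<phi>[OF that]])
        have "continuous_on {0..1} q"
          unfolding q_def
        proof (rule continuous_on_compose)
          show "continuous_on {0..1} ?\<phi>" by (intro continuous_intros)
          show "continuous_on (?\<phi> ` {0..1}) p"
            by (rule continuous_on_subset[OF p]) (rule image_subsetI, rule \<phi>)
        qed
        then have qj: "({0..1}, q) \<in> joining (sphere x (\<eta> / 4)) (sphere x (\<eta> / 2)) D"
        proof -
          have "q 0 = p u" "q 1 = p v" by (simp_all add: q_def)
          then have "pathstart q \<in> sphere x (\<eta> / 4)" "pathfinish q \<in> sphere x (\<eta> / 2)"
            using u v by (simp_all add: pathstart_def pathfinish_def)
          moreover have "\<forall>t\<in>{0<..<1}. q t \<in> D" using qD by simp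
          ultimately show ?thesis
            using \<open>continuous_on {0..1} q\<close> unfolding joining_def path_def by blast
        qed
        have "{t \<in> {0..1}. q t \<in> D} = {0..1}" using qD by blast
        then have in\<Delta>: "({0..1}, f \<circ> q) \<in> ?\<Delta> x"
          unfolding image_curves_def by (intro image_eqI[OF _ qj]) simp
        have "(f \<circ> q) t = c (?\<phi> t)" if "t \<in> {0..1}" for t
          using fg cD \<phi>[OF that] by (simp add: q_def p_def)
        note sc = subcurve_line_integral[OF c(1) lr[unfolded \<gamma>] u(1) uv v(2) this]
        show "\<exists>x\<in>I. \<exists>\<gamma>'\<in>?\<Delta> x. locally_rectifiable \<gamma>' \<and>
            (\<forall>\<rho>\<in>borel_measurable borel. line_integral \<rho> \<gamma>' \<le> line_integral \<rho> \<gamma>)"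
          unfolding \<gamma> by (intro bexI[OF _ xI] bexI[OF _ in\<Delta>] conjI ballI sc)
      qed (rule B)
      also have "\<dots> \<le> ennreal (card X * (B + 1) + 1)"
        using X B card_mono[of X I] by (intro ennreal_leI add_increasing2 mult_right_mono) (auto simp: I_def)
      finally show "modulus (joining (f ` E) (f ` F) D') \<le> ennreal (card X * (B + 1) + 1)" .
    qed
  qed
qed

text \<open>The density \<open>inverse \<delta>\<close> on the ball assigns at least one to every
  curve that moves by \<delta> inside it. Only curves with a finite lift \<open>d\<close> have to be
  considered, as no other curve is locally rectifiable.\<close>

lemma modulus_le_crossing:
  fixes \<Gamma> :: "'a::euclidean_space onept curve set" and B :: real
  assumes \<delta>: "0 < \<delta>"
    and \<Gamma>: "\<And>\<gamma>. \<gamma> \<in> \<Gamma> \<Longrightarrow> \<exists>c. \<gamma> = ({0..1}, c) \<and> path c"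
    and cross: "\<And>c d. ({0..1}, c) \<in> \<Gamma> \<Longrightarrow> continuous_on {0..1} d \<Longrightarrow> (\<And>t. t \<in> {0..1} \<Longrightarrow> c t = Fin (d t)) \<Longrightarrow>
      \<exists>u v. 0 \<le> u \<and> u \<le> v \<and> v \<le> 1 \<and> d ` {u..v} \<subseteq> cball q B \<and> \<delta> \<le> dist (d u) (d v)"
  shows "modulus \<Gamma> \<le> ennreal (inverse \<delta> ^ DIM('a)) * emeasure lborel (cball q B)"
proof -
  define \<rho> where "\<rho> x = ennreal (inverse \<delta>) * indicator (cball q B) x" for x
  have "\<rho> \<in> admissible \<Gamma>"
    unfolding admissible_def
  proof (intro CollectI conjI ballI impI)
    show "\<rho> \<in> borel_measurable borel" unfolding \<rho>_def
      by (intro borel_measurable_times_ennreal borel_measurable_const borel_measurable_indicator) auto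
    then have \<rho>m: "\<rho> \<in> borel_measurable borel" .
    fix \<gamma> assume \<gamma>: "\<gamma> \<in> \<Gamma>" "locally_rectifiable \<gamma>"
    then obtain c where c: "\<gamma> = ({0..1}, c)" "path c" using \<Gamma> by blast
    note lr = locally_rectifiable_interval[OF c(2) \<gamma>(2)[unfolded c(1)]]
    let ?d = "the_fin \<circ> c"
    interpret rectifiable_curve ?d 0 1 by (rule lr)
    obtain u v where uv: "0 \<le> u" "u \<le> v" "v \<le> 1" "?d ` {u..v} \<subseteq> cball q B" "\<delta> \<le> dist (?d u) (?d v)"
      using cross[of c ?d] \<gamma>(1) c(1) cont lr(2) by auto
    interpret uv: rectifiable_curve ?d u v by (rule sub[OF uv(1-3)])
    have "1 = ennreal (inverse \<delta>) * ennreal \<delta>" using \<delta> by (simp flip: ennreal_mult)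
    also have "\<dots> \<le> ennreal (inverse \<delta>) * ennreal (dist (?d u) (?d v))"
      using uv(5) by (intro mult_left_mono ennreal_leI) auto
    also have "\<dots> \<le> rect_line_integral \<rho> ?d u v"
      by (rule uv.rect_line_integral_ge) (use uv(4) in \<open>auto simp: \<rho>_def image_subset_iff\<close>)
    also have "\<dots> \<le> line_integral \<rho> \<gamma>"
      unfolding line_integral_def c(1) prod.case
      by (rule SUP_upper2[of "(u, v)"]) (use uv in auto)
    finally show "1 \<le> line_integral \<rho> \<gamma>" .
  qed
  then have "modulus \<Gamma> \<le> (\<integral>\<^sup>+ x. \<rho> x ^ DIM('a) \<partial>lborel)"
    unfolding modulus_def by (rule INF_lower)
  also have "\<dots> = (\<integral>\<^sup>+ x. ennreal (inverse \<delta> ^ DIM('a)) * indicator (cball q B) x \<partial>lborel)"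
    using \<delta> by (intro nn_integral_cong) (auto simp: \<rho>_def ennreal_power split: split_indicator)
  also have "\<dots> = ennreal (inverse \<delta> ^ DIM('a)) * emeasure lborel (cball q B)"
    by (simp add: nn_integral_cmult_indicator)
  finally show ?thesis .
qed


section \<open>Curves that escape from a neighborhood\<close>

lemma first_hit:
  fixes c :: "real \<Rightarrow> 'b::topological_space"
  assumes c: "continuous_on {a..b} c" and "closed S" "t \<in> {a..b}" "c t \<in> S"
  obtains u where "u \<in> {a..b}" "c u \<in> S" "\<And>v. a \<le> v \<Longrightarrow> v < u \<Longrightarrow> c v \<notin> S"
proof -
  have "closed ({a..b} \<inter> c -` S)"
    using c \<open>closed S\<close> by (intro continuous_closed_preimage) auto
  then have "compact ({a..b} \<inter> c -` S)"
    using compact_Int_closed[of "{a..b}" "{a..b} \<inter> c -` S"] by simp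
  from compact_attains_inf[OF this]
  have "\<exists>u\<in>{a..b} \<inter> c -` S. \<forall>v\<in>{a..b} \<inter> c -` S. u \<le> v" using assms(3,4) by blast
  then obtain u where u: "u \<in> {a..b}" "c u \<in> S" "\<And>v. v \<in> {a..b} \<Longrightarrow> c v \<in> S \<Longrightarrow> u \<le> v"
    by blast
  show thesis
  proof (rule that[OF u(1,2)])
    fix v assume "a \<le> v" "v < u"
    then show "c v \<notin> S" using u(1) u(3)[of v] by auto
  qed
qed

text \<open>An escaping curve crosses a fixed spherical ring. Line integrals are Euclidean, so at
  \<open>Infty\<close> the ring between the radii \<open>R\<close> and \<open>2 * R\<close> is used:
  a bounded region in which the curve still moves by \<open>R\<close>. The bound \<open>C\<close>
  depends on \<open>k\<close> and \<open>N\<close>, not on the family.\<close>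

lemma escape_modulus_bounded:
  fixes k :: "'a::euclidean_space onept"
  assumes "open N" "k \<in> N"
  obtains N' C where "open N'" "k \<in> N'" "closure N' \<subseteq> N"
    "\<And>\<Gamma>. (\<And>\<gamma>. \<gamma> \<in> \<Gamma> \<Longrightarrow> \<exists>c t. \<gamma> = ({0..1}, c) \<and> path c \<and> c 0 \<in> closure N' \<and> t \<in> {0..1} \<and> c t \<notin> N) \<Longrightarrow>
      modulus \<Gamma> \<le> ennreal C"
proof (cases k)
  case (Fin q)
  then obtain s0 where s0: "0 < s0" "Fin ` cball q s0 \<subseteq> N" using open_Fin_obtain assms by blast
  define s where "s = s0 / 2"
  have s: "0 < s" "Fin ` cball q (2 * s) \<subseteq> N" using s0 by (simp_all add: s_def)
  let ?N' = "Fin ` ball q s"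
  have cl: "closure ?N' \<subseteq> Fin ` cball q s"
    by (intro closure_minimal closed_Fin_image) auto
  define C where "C = enn2real (ennreal (inverse s ^ DIM('a)) * emeasure lborel (cball q (2 * s)))"
  have C: "ennreal (inverse s ^ DIM('a)) * emeasure lborel (cball q (2 * s)) = ennreal C"
    using emeasure_lborel_cball_finite[of q "2 * s"] by (simp add: C_def ennreal_mult_less_top)
  show thesis
  proof (rule that[of ?N' C])
    show "open ?N'" by (intro open_Fin_image) simp
    show "k \<in> ?N'" using s Fin by simp
    show "closure ?N' \<subseteq> N" using cl s by force
    fix \<Gamma> :: "'a onept curve set"
    assume \<Gamma>: "\<And>\<gamma>. \<gamma> \<in> \<Gamma> \<Longrightarrow> \<exists>c t. \<gamma> = ({0..1}, c) \<and> path c \<and> c 0 \<in> closure ?N' \<and> t \<in> {0..1} \<and> c t \<notin> N"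
    show "modulus \<Gamma> \<le> ennreal C"
      unfolding C[symmetric]
    proof (rule modulus_le_crossing[OF s(1)])
      show "\<exists>c. \<gamma> = ({0..1}, c) \<and> path c" if "\<gamma> \<in> \<Gamma>" for \<gamma> using \<Gamma>[OF that] by blast
      fix c d assume c: "({0..1}, c) \<in> \<Gamma>" and d: "continuous_on {0..1} d" "\<And>t. t \<in> {0..1} \<Longrightarrow> c t = Fin (d t)"
      obtain t where t: "c 0 \<in> closure ?N'" "t \<in> {0..1}" "c t \<notin> N" using \<Gamma>[OF c] by auto
      have d0: "dist q (d 0) \<le> s" using t(1) cl d(2)[of 0] by auto
      have dt: "2 * s < dist q (d t)" using t(3) s(2) d(2)[OF t(2)] by (force simp: not_less[symmetric])
      obtain v where v: "v \<in> {0..1}" "d v \<in> - ball q (2 * s)" "\<And>w. 0 \<le> w \<Longrightarrow> w < v \<Longrightarrow> d w \<notin> - ball q (2 * s)"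
        by (rule first_hit[OF d(1), of "- ball q (2 * s)" t]) (use t(2) dt in auto)
      have "0 < v" using v(2) d0 s v(1) by (cases "v = 0") auto
      have "d ` {0..v} \<subseteq> cball q (2 * s)"
      proof -
        have "d ` {0..<v} \<subseteq> cball q (2 * s)" using v(3) by force
        moreover have "continuous_on {0..v} d" using d(1) v(1) by (auto intro: continuous_on_subset)
        ultimately have "d ` closure {0..<v} \<subseteq> cball q (2 * s)"
          using \<open>0 < v\<close> by (intro image_closure_subset) auto
        then show ?thesis using \<open>0 < v\<close> by simp
      qed
      moreover have "s \<le> dist (d 0) (d v)"
        using v(2) d0 dist_triangle[of q "d v" "d 0"] by auto
      ultimately show "\<exists>u v. 0 \<le> u \<and> u \<le> v \<and> v \<le> 1 \<and> d ` {u..v} \<subseteq> cball q (2 * s) \<and> s \<le> dist (d u) (d v)"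
        using v(1) by (intro exI[of _ 0] exI[of _ v]) auto
    qed
  qed
next
  case Infty
  then obtain R where R: "0 < R" "\<And>x. R \<le> norm x \<Longrightarrow> Fin x \<in> N"
    using open_Infty_obtain assms by blast
  \<comment> \<open>The starting points have norm at least \<open>3 * R\<close>, so the whole ring
    between \<open>R\<close> and \<open>2 * R\<close> is still ahead of them.\<close>
  let ?N' = "- Fin ` cball (0::'a) (3 * R)"
  have cl: "closure ?N' \<subseteq> - Fin ` ball 0 (3 * R)"
    by (intro closure_minimal closed_Compl open_Fin_image) auto
  define C where "C = enn2real (ennreal (inverse R ^ DIM('a)) * emeasure lborel (cball (0::'a) (2 * R)))"
  have C: "ennreal (inverse R ^ DIM('a)) * emeasure lborel (cball (0::'a) (2 * R)) = ennreal C"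
    using emeasure_lborel_cball_finite[of "0::'a" "2 * R"] by (simp add: C_def ennreal_mult_less_top)
  show thesis
  proof (rule that[of ?N' C])
    show "open ?N'" by (intro open_Compl closed_Fin_image) simp
    show "k \<in> ?N'" using Infty by auto
    show "closure ?N' \<subseteq> N"
    proof
      fix y assume "y \<in> closure ?N'"
      then have "y \<notin> Fin ` ball 0 (3 * R)" using cl by blast
      then show "y \<in> N" using R assms(2) Infty by (cases y) (force simp: not_less)+
    qed
    fix \<Gamma> :: "'a onept curve set"
    assume \<Gamma>: "\<And>\<gamma>. \<gamma> \<in> \<Gamma> \<Longrightarrow> \<exists>c t. \<gamma> = ({0..1}, c) \<and> path c \<and> c 0 \<in> closure ?N' \<and> t \<in> {0..1} \<and> c t \<notin> N"
    show "modulus \<Gamma> \<le> ennreal C"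
      unfolding C[symmetric]
    proof (rule modulus_le_crossing[OF R(1)])
      show "\<exists>c. \<gamma> = ({0..1}, c) \<and> path c" if "\<gamma> \<in> \<Gamma>" for \<gamma> using \<Gamma>[OF that] by blast
      fix c d assume c: "({0..1}, c) \<in> \<Gamma>" and d: "continuous_on {0..1} d" "\<And>t. t \<in> {0..1} \<Longrightarrow> c t = Fin (d t)"
      obtain t where t: "c 0 \<in> closure ?N'" "t \<in> {0..1}" "c t \<notin> N" using \<Gamma>[OF c] by auto
      have d0: "3 * R \<le> norm (d 0)" using t(1) cl d(2)[of 0] by force
      have dt: "norm (d t) < R" using t(3) R(2)[of "d t"] d(2)[OF t(2)] by (metis not_le)
      obtain v where v: "v \<in> {0..1}" "d v \<in> cball 0 R" "\<And>w. 0 \<le> w \<Longrightarrow> w < v \<Longrightarrow> d w \<notin> cball 0 R"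
        by (rule first_hit[OF d(1), of "cball 0 R" t]) (use t(2) dt in auto)
      \<comment> \<open>With time reversed, a first hit becomes the last moment before
        \<open>v\<close> at which the curve is not inside the ball of radius
        \<open>2 * R\<close>.\<close>
      have cont: "continuous_on {-v..0} (\<lambda>w. d (- w))"
        using v(1) by (intro continuous_on_compose2[OF d(1)] continuous_intros) auto
      obtain w where w: "w \<in> {-v..0}" "d (- w) \<in> - ball 0 (2 * R)"
          "\<And>w'. - v \<le> w' \<Longrightarrow> w' < w \<Longrightarrow> d (- w') \<notin> - ball 0 (2 * R)"
        by (rule first_hit[OF cont, of "- ball 0 (2 * R)" 0]) (use v(1) d0 R in auto)
      have vw: "- v < w" using w v(2) R by (cases "w = - v") auto
      have "d ` {- w..v} \<subseteq> cball 0 (2 * R)"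
      proof -
        have "d ` {- w<..v} \<subseteq> cball 0 (2 * R)"
        proof clarify
          fix x assume "x \<in> {- w<..v}"
          then show "d x \<in> cball 0 (2 * R)" using w(3)[of "- x"] by auto
        qed
        moreover have "continuous_on {- w..v} d" using d(1) v(1) w(1) by (auto intro: continuous_on_subset)
        ultimately have "d ` closure {- w<..v} \<subseteq> cball 0 (2 * R)"
          using vw by (intro image_closure_subset) auto
        then show ?thesis using vw by simp
      qed
      moreover have "R \<le> dist (d (- w)) (d v)"
        using v(2) w(2) norm_triangle_ineq2[of "d (- w)" "d v"] by (auto simp: dist_norm)
      ultimately show "\<exists>u v. 0 \<le> u \<and> u \<le> v \<and> v \<le> 1 \<and> d ` {u..v} \<subseteq> cball 0 (2 * R) \<and> R \<le> dist (d u) (d v)"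
        using v(1) w(1) vw by (intro exI[of _ "- w"] exI[of _ v]) auto
    qed
  qed
qed

section \<open>Separated connections in a domain\<close>

lemma locally_connected_at_closure:
  fixes D :: "'a::euclidean_space set"
  assumes "open D" "locally_connected_on_boundary D" "x \<in> closure D" "0 < r"
  obtains V where "open V" "x \<in> V" "V \<subseteq> ball x r" "connected (V \<inter> D)"
proof (cases "x \<in> D")
  case True
  then obtain s where s: "0 < s" "ball x s \<subseteq> D" using \<open>open D\<close> openE by blast
  then have "ball x (min r s) \<inter> D = ball x (min r s)" by auto
  then have "connected (ball x (min r s) \<inter> D)" by (simp add: convex_connected)
  then show thesis
    by (rule that[rotated 3]) (use s \<open>0 < r\<close> in auto)
next
  case False
  then have "x \<in> frontier D" using assms by (simp add: frontier_def interior_open)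
  then show thesis
    using assms(2) that \<open>0 < r\<close> unfolding locally_connected_on_boundary_def locally_connected_at_def
    by (metis centre_in_ball open_ball)
qed

text \<open>A homeomorphism fixing the complement of \<open>D\<close> and two given points drags connected
  pieces of \<open>D\<close> near these points to \<open>A\<close>; this keeps the pieces disjoint.\<close>

lemma separated_connection_at:
  fixes D :: "'a::euclidean_space set"
  assumes dim: "2 \<le> DIM('a)" and D: "open D" "connected D" "locally_connected_on_boundary D"
    and A: "infinite A" "A \<subseteq> D" and x: "x \<in> closure D" "x' \<in> closure D" "x \<noteq> x'"
  obtains W W' \<eta> where "open W" "x \<in> W" "open W'" "x' \<in> W'" "0 < \<eta>"
    "\<And>y y'. y \<in> W \<inter> D \<Longrightarrow> y' \<in> W' \<inter> D \<Longrightarrow> \<exists>E F. continuum E \<and> continuum F \<and> E \<subseteq> D \<and> F \<subseteq> D \<and>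
      y \<in> E \<and> y' \<in> F \<and> E \<inter> A \<noteq> {} \<and> F \<inter> A \<noteq> {} \<and> (\<forall>u\<in>E. \<forall>v\<in>F. \<eta> \<le> dist u v)"
proof -
  \<comment> \<open>A third of the distance makes the closed balls of radius \<open>r\<close> around
    \<open>x\<close> and \<open>x'\<close> disjoint.\<close>
  define r where "r = dist x x' / 3"
  have r: "0 < r" using x by (simp add: r_def)
  obtain V where V: "open V" "x \<in> V" "V \<subseteq> ball x r" "connected (V \<inter> D)"
    using locally_connected_at_closure[OF D(1,3) x(1) r] .
  obtain V' where V': "open V'" "x' \<in> V'" "V' \<subseteq> ball x' r" "connected (V' \<inter> D)"
    using locally_connected_at_closure[OF D(1,3) x(2) r] .
  have disj: "cball x r \<inter> cball x' r = {}"
  proof (rule ccontr)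
    assume "cball x r \<inter> cball x' r \<noteq> {}"
    then obtain y where "dist x y \<le> r" "dist x' y \<le> r" by auto
    moreover have "dist x x' = 3 * r" by (simp add: r_def)
    ultimately show False using r dist_triangle2[of x x' y] by linarith
  qed
  \<comment> \<open>The points to be moved must differ from \<open>x\<close> and \<open>x'\<close>,
    which the homeomorphism has to fix.\<close>
  have pick: "\<exists>p. p \<in> U \<inter> D \<and> p \<notin> {x, x'}" if "open U" "z \<in> U" "z \<in> closure D" for U z
  proof -
    have "U \<inter> D \<noteq> {}" using that open_Int_closure_eq_empty[of U D] by blast
    moreover have "open (U \<inter> D)" using that D by blast
    ultimately have "infinite (U \<inter> D)" using finite_imp_not_open by blast
    then have "infinite (U \<inter> D - {x, x'})" by simp
    then show ?thesis by (metis Diff_iff finite.emptyI ex_in_conv)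
  qed
  obtain p where p: "p \<in> V \<inter> D" "p \<notin> {x, x'}" using pick[OF V(1,2) x(1)] by blast
  obtain p' where p': "p' \<in> V' \<inter> D" "p' \<notin> {x, x'}" using pick[OF V'(1,2) x(2)] by blast
  have "infinite (A - {x, x'})" using A by simp
  then obtain a where a: "a \<in> A - {x, x'}" by (metis finite.emptyI ex_in_conv)
  have "infinite (A - {x, x'} - {a})" using A by simp
  then obtain a' where a': "a' \<in> A - {x, x'} - {a}" by (metis finite.emptyI ex_in_conv)
  \<comment> \<open>Since the homeomorphism is the identity off \<open>S\<close>, it fixes
    \<open>x\<close> and \<open>x'\<close>, and the images of their neighborhoods are again
    neighborhoods. Deleting two points keeps \<open>D\<close> connected as the dimension is at least
    two.\<close>
  define S where "S = D - {x, x'}"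
  have S: "open S" "connected S"
    unfolding S_def using D dim connected_open_delete_finite[of D "{x, x'}"] by (auto intro: open_delete)
  have "p \<noteq> p'" using p p' V V' disj by (auto simp: disjoint_iff) (metis less_imp_le mem_ball subsetD)
  have pS: "p \<in> S" "p' \<in> S" "a \<in> S" "a' \<in> S" using p p' a a' A by (auto simp: S_def)
  have "affine hull S = UNIV" using S(1) pS(1) affine_hull_open by blast
  then have aff: "UNIV \<subseteq> affine hull S" by simp
  have mem: "(if i then p else p') \<in> S \<and> (if i then a else a') \<in> S" if "i \<in> (UNIV :: bool set)" for i
    using pS by simp
  have pw: "pairwise (\<lambda>i j. (if i then p else p') \<noteq> (if j then p else p') \<and>
      (if i then a else a') \<noteq> (if j then a else a')) (UNIV :: bool set)"
    using a' \<open>p \<noteq> p'\<close> by (auto simp: pairwise_def)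
  obtain h k where hk: "homeomorphism UNIV UNIV h k"
    "\<And>b. b \<in> (UNIV :: bool set) \<Longrightarrow> h (if b then p else p') = (if b then a else a')"
    "{z. \<not> (h z = z \<and> k z = z)} \<subseteq> S"
    by (rule homeomorphism_moving_points_exists[OF dim S subset_UNIV finite mem pw subset_UNIV aff S(2)])
      (assumption, (rule that; assumption))
  have ha: "h p = a" "h p' = a'" using hk(2)[of True] hk(2)[of False] by auto
  have kh: "k (h z) = z" and hk': "h (k z) = z" for z using hk(1) by (auto simp: homeomorphism_def)
  have hc: "continuous_on X h" "continuous_on X k" for X
    using hk(1) by (auto simp: homeomorphism_def intro: continuous_on_subset)
  have hfix: "h z = z" "k z = z" if "z \<notin> S" for z using hk(3) that by auto
  have hS: "h z \<in> S \<longleftrightarrow> z \<in> S" for z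
    using hfix kh hk' by metis
  have hD: "h z \<in> D \<longleftrightarrow> z \<in> D" for z
    using hS[of z] hfix(1)[of z] kh by (auto simp: S_def)
  have hx: "h x = x" "h x' = x'" by (simp_all add: hfix S_def)
  have inj: "inj h" using kh by (metis injI)
  have oh: "open (h ` U)" if "open U" for U
  proof -
    have "h ` U = k -` U"
    proof (intro set_eqI iffI)
      fix z assume "z \<in> k -` U"
      then show "z \<in> h ` U" by (intro image_eqI[of _ _ "k z"]) (simp_all add: hk')
    qed (auto simp: kh)
    then show ?thesis using open_vimage[OF that hc(2)[of UNIV]] by simp
  qed
  have img: "h ` V \<inter> D = h ` (V \<inter> D)" "h ` V' \<inter> D = h ` (V' \<inter> D)" using hD by auto
  have "compact (h ` cball x r)" "compact (h ` cball x' r)"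
    by (intro compact_continuous_image hc compact_cball)+
  moreover have "h ` cball x r \<inter> h ` cball x' r = {}"
    using disj inj by (metis image_Int image_is_empty)
  \<comment> \<open>One distance for all \<open>y\<close> and \<open>y'\<close> near
    \<open>x\<close> and \<open>x'\<close>: the images of the disjoint closed balls are compact and
    disjoint.\<close>
  ultimately obtain \<eta> where \<eta>: "0 < \<eta>" "\<And>u v. u \<in> h ` cball x r \<Longrightarrow> v \<in> h ` cball x' r \<Longrightarrow> \<eta> \<le> dist u v"
    using separate_compact_closed[of "h ` cball x r" "h ` cball x' r"] compact_imp_closed by metis
  have conn: "\<exists>E. continuum E \<and> E \<subseteq> h ` (U \<inter> D) \<and> y \<in> E \<and> b \<in> E"
    if "open U" "connected (U \<inter> D)" "y \<in> h ` (U \<inter> D)" "b \<in> h ` (U \<inter> D)" for U y b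
  proof -
    have "open (h ` (U \<inter> D))" using that D by (intro oh) auto
    moreover have "connected (h ` (U \<inter> D))" using that hc by (intro connected_continuous_image)
    ultimately have "path_connected (h ` (U \<inter> D))" by (rule connected_open_path_connected)
    then have "\<exists>g. path g \<and> path_image g \<subseteq> h ` (U \<inter> D) \<and> pathstart g = y \<and> pathfinish g = b"
      using that(3,4) unfolding path_connected_def by (elim ballE[of _ _ y] ballE[of _ _ b]) simp_all
    then obtain g where g: "path g" "path_image g \<subseteq> h ` (U \<inter> D)" "pathstart g = y" "pathfinish g = b"
      by blast
    have "continuum (path_image g)"
      using g(1) by (simp add: continuum_def compact_path_image connected_path_image)
    then show ?thesis using g pathstart_in_path_image[of g] pathfinish_in_path_image[of g] by metis
  qed
  show thesis
  proof (rule that[of "h ` V" "h ` V'" \<eta>])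
    show "open (h ` V)" "open (h ` V')" using oh V V' by auto
    show "x \<in> h ` V" "x' \<in> h ` V'" using hx V(2) V'(2) by (metis imageI)+
    show "0 < \<eta>" by (rule \<eta>)
    fix y y' assume y: "y \<in> h ` V \<inter> D" "y' \<in> h ` V' \<inter> D"
    have "a \<in> h ` (V \<inter> D)" "a' \<in> h ` (V' \<inter> D)" using ha p p' by (metis imageI)+
    then obtain E F where E: "continuum E" "E \<subseteq> h ` (V \<inter> D)" "y \<in> E" "a \<in> E"
      and F: "continuum F" "F \<subseteq> h ` (V' \<inter> D)" "y' \<in> F" "a' \<in> F"
      using conn[OF V(1,4)] conn[OF V'(1,4)] y unfolding img by metis
    have "E \<subseteq> D" "F \<subseteq> D" using E(2) F(2) img by blast+
    moreover have "E \<subseteq> h ` cball x r" "F \<subseteq> h ` cball x' r"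
      using E(2) F(2) V(3) V'(3) ball_subset_cball by blast+
    then have "\<forall>u\<in>E. \<forall>v\<in>F. \<eta> \<le> dist u v" using \<eta>(2) by blast
    ultimately show "\<exists>E F. continuum E \<and> continuum F \<and> E \<subseteq> D \<and> F \<subseteq> D \<and>
      y \<in> E \<and> y' \<in> F \<and> E \<inter> A \<noteq> {} \<and> F \<inter> A \<noteq> {} \<and> (\<forall>u\<in>E. \<forall>v\<in>F. \<eta> \<le> dist u v)"
      using E F a a' by (intro exI[of _ E] exI[of _ F]) auto
  qed
qed

text \<open>The local statement holds near every pair of different points of the closure, boundary
  points included, and finitely many such neighborhoods cover the compact set of pairs at distance
  at least \<epsilon>.\<close>

lemma separated_connection:
  fixes D :: "'a::euclidean_space set"
  assumes dim: "2 \<le> DIM('a)" and D: "open D" "connected D" "bounded D" "locally_connected_on_boundary D"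
    and A: "infinite A" "A \<subseteq> D" and "0 < \<epsilon>"
  obtains \<eta> where "0 < \<eta>"
    "\<And>y y'. y \<in> D \<Longrightarrow> y' \<in> D \<Longrightarrow> \<epsilon> \<le> dist y y' \<Longrightarrow> \<exists>E F. continuum E \<and> continuum F \<and> E \<subseteq> D \<and> F \<subseteq> D \<and>
      y \<in> E \<and> y' \<in> F \<and> E \<inter> A \<noteq> {} \<and> F \<inter> A \<noteq> {} \<and> (\<forall>u\<in>E. \<forall>v\<in>F. \<eta> \<le> dist u v)"
proof -
  define P where "P \<eta> y y' \<longleftrightarrow> (\<exists>E F. continuum E \<and> continuum F \<and> E \<subseteq> D \<and> F \<subseteq> D \<and>
      y \<in> E \<and> y' \<in> F \<and> E \<inter> A \<noteq> {} \<and> F \<inter> A \<noteq> {} \<and> (\<forall>u\<in>E. \<forall>v\<in>F. \<eta> \<le> dist u v))" for \<eta> y y'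
  define K where "K = (closure D \<times> closure D) \<inter> {z. \<epsilon> \<le> dist (fst z) (snd z)}"
  have "closed {z :: 'a \<times> 'a. \<epsilon> \<le> dist (fst z) (snd z)}"
    by (intro closed_Collect_le continuous_intros)
  then have K: "compact K" unfolding K_def using D(3) by (intro compact_Int_closed compact_Times) simp_all
  have "\<exists>T \<eta>. open T \<and> z \<in> T \<and> 0 < \<eta> \<and> (\<forall>w\<in>T. fst w \<in> D \<longrightarrow> snd w \<in> D \<longrightarrow> P \<eta> (fst w) (snd w))"
    if "z \<in> K" for z
  proof -
    have z: "fst z \<in> closure D" "snd z \<in> closure D" "fst z \<noteq> snd z" using that \<open>0 < \<epsilon>\<close> by (auto simp: K_def)
    obtain W W' \<eta> where W: "open W" "fst z \<in> W" "open W'" "snd z \<in> W'" "0 < \<eta>"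
      "\<And>y y'. y \<in> W \<inter> D \<Longrightarrow> y' \<in> W' \<inter> D \<Longrightarrow> P \<eta> y y'"
      using separated_connection_at[OF dim D(1,2,4) A z] unfolding P_def by metis
    show ?thesis
    proof (intro exI[of _ "W \<times> W'"] exI[of _ \<eta>] conjI ballI impI)
      show "z \<in> W \<times> W'" using W by (simp add: mem_Times_iff)
      show "open (W \<times> W')" using W by (intro open_Times)
    qed (use W in auto)
  qed
  then obtain T \<eta> where T: "\<And>z. z \<in> K \<Longrightarrow> open (T z)" "\<And>z. z \<in> K \<Longrightarrow> z \<in> T z" "\<And>z. z \<in> K \<Longrightarrow> 0 < \<eta> z"
    "\<And>z w. z \<in> K \<Longrightarrow> w \<in> T z \<Longrightarrow> fst w \<in> D \<Longrightarrow> snd w \<in> D \<Longrightarrow> P (\<eta> z) (fst w) (snd w)"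
    by metis
  obtain Z where Z: "Z \<subseteq> K" "finite Z" "K \<subseteq> (\<Union>z\<in>Z. T z)"
    by (rule compactE_image[OF K, of K T]) (use T in auto)
  \<comment> \<open>The element 1 provides a minimum when there is no pair to be covered.\<close>
  define \<eta>0 where "\<eta>0 = Min (insert 1 (\<eta> ` Z))"
  show thesis
  proof (rule that)
    show "0 < \<eta>0" using Z T(3) by (auto simp: \<eta>0_def)
    fix y y' assume y: "y \<in> D" "y' \<in> D" "\<epsilon> \<le> dist y y'"
    then have "(y, y') \<in> K" unfolding K_def using closure_subset by auto
    then obtain z where z: "z \<in> Z" "(y, y') \<in> T z" using Z by blast
    have "\<eta>0 \<le> \<eta> z" using Z z by (simp add: \<eta>0_def)
    moreover have "P (\<eta> z) y y'" using T(4)[of z "(y, y')"] z Z(1) y by (metis fst_conv snd_conv subsetD)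
    ultimately show "\<exists>E F. continuum E \<and> continuum F \<and> E \<subseteq> D \<and> F \<subseteq> D \<and>
      y \<in> E \<and> y' \<in> F \<and> E \<inter> A \<noteq> {} \<and> F \<inter> A \<noteq> {} \<and> (\<forall>u\<in>E. \<forall>v\<in>F. \<eta>0 \<le> dist u v)"
      unfolding P_def by (meson order_trans)
  qed
qed

section \<open>Equicontinuity of the inverse mappings\<close>

text \<open>A convenient substitute for meeting both frontiers: if \<open>V \<subseteq> U\<close>, a
  connected set that meets \<open>V\<close> and leaves \<open>U\<close> meets the frontier of
  each.\<close>

definition crosses :: "'b::topological_space set \<Rightarrow> 'b set \<Rightarrow> 'b set \<Rightarrow> 'b set \<Rightarrow> bool" where
  "crosses G U V E \<longleftrightarrow> continuum E \<and> E \<subseteq> G \<and> E \<inter> V \<noteq> {} \<and> \<not> E \<subseteq> U"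

lemma weakly_flat_crossing:
  assumes flat: "weakly_flat_at G y" and U: "open U" "y \<in> U" and P: "0 < P"
  obtains V where "open V" "y \<in> V" "V \<subseteq> U"
    "\<forall>E F. crosses G U V E \<longrightarrow> crosses G U V F \<longrightarrow> ennreal P < modulus (joining E F G)"
proof -
  have "\<exists>V. open V \<and> y \<in> V \<and> V \<subseteq> U \<and> (\<forall>E F. continuum E \<and> continuum F \<and> E \<subseteq> G \<and> F \<subseteq> G \<and>
      E \<inter> frontier U \<noteq> {} \<and> E \<inter> frontier V \<noteq> {} \<and> F \<inter> frontier U \<noteq> {} \<and> F \<inter> frontier V \<noteq> {} \<longrightarrow>
      ennreal P < modulus (joining E F G))" (is "\<exists>V. ?A V")
    using flat U P unfolding weakly_flat_at_def by (elim allE[of _ P] allE[of _ U]) simp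
  then obtain V where A: "?A V" by (rule exE)
  then have V: "open V" "y \<in> V" "V \<subseteq> U" by simp_all
  have fr: "E \<inter> frontier U \<noteq> {}" "E \<inter> frontier V \<noteq> {}" if "crosses G U V E" for E
    by (rule connected_Int_frontier; use that V(3) in \<open>auto simp: crosses_def continuum_def\<close>)+
  have "ennreal P < modulus (joining E F G)" if "crosses G U V E" "crosses G U V F" for E F
    using A fr[OF that(1)] fr[OF that(2)] that by (simp add: crosses_def)
  then show thesis using that V by simp
qed

section \<open>The family of mappings and the position of \<open>f(A)\<close>\<close>

locale inverse_setting =
  fixes D A :: "'a::euclidean_space set" and D' :: "'a onept set" and \<delta> :: real and Q :: "'a \<Rightarrow> ennreal"
  assumes dim: "2 \<le> DIM('a)"
    and domain: "is_domain D" and bounded: "bounded D" and domain': "is_domain D'"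
    and \<delta>: "0 < \<delta>" and A: "continuum A" "A \<subseteq> D"
    and Q: "Q \<in> borel_measurable lebesgue" "(\<integral>\<^sup>+ x \<in> D. Q x \<partial>lebesgue) < \<infinity>"
    and lc: "locally_connected_on_boundary D" and wf: "weakly_flat_boundary D'"
    and nondegenerate: "\<And>C p. C \<in> components (frontier D') \<Longrightarrow> C \<noteq> {p}"
begin

lemma D: "open D" "connected D" "path_connected D" and D': "open D'"
  using domain domain' connected_open_path_connected by (auto simp: is_domain_def)

definition admitted :: "('a onept \<Rightarrow> 'a) \<Rightarrow> ('a \<Rightarrow> 'a onept) \<Rightarrow> bool" where
  "admitted g f \<longleftrightarrow> homeomorphism D' D g f \<and> ring_Q_mapping_in Q D f (closure D) \<and> \<delta> \<le> diameter (f ` A)"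

lemma inverse_family_admitted: "g \<in> inverse_family \<delta> A Q D D' \<Longrightarrow> \<exists>f. admitted g f"
  by (auto simp: inverse_family_def ring_Q_homeomorphism_in_def admitted_def)

lemma admittedD:
  assumes "admitted g f"
  shows "\<And>x. x \<in> D \<Longrightarrow> g (f x) = x" "\<And>y. y \<in> D' \<Longrightarrow> f (g y) = y" "f ` D = D'" "g ` D' = D"
    "continuous_on D f" "continuous_on D' g"
  using assms by (auto simp: admitted_def homeomorphism_def)

lemma continuum_image:
  assumes "admitted g f" "continuum E" "E \<subseteq> D"
  shows "continuum (f ` E)" "f ` E \<subseteq> D'"
  using assms admittedD(3,5)[OF assms(1)] unfolding continuum_def
  by (auto intro!: compact_continuous_image connected_continuous_image intro: continuous_on_subset)

text \<open>A ball of radius \<open>r\<close> has diameter at most \<open>2 * r\<close>. Hence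
  \<open>f(A)\<close> itself can serve as one of the continua that leave a small ball.\<close>

lemma not_subset_small:
  assumes "admitted g f" "2 * r < \<delta>"
  shows "\<not> f ` A \<subseteq> ball y r"
proof
  assume *: "f ` A \<subseteq> ball y r"
  have ne: "f ` A \<noteq> {}" using assms(1) \<delta> by (auto simp: admitted_def)
  have "dist u v \<le> 2 * r" if "u \<in> f ` A" "v \<in> f ` A" for u v
  proof -
    have "dist y u < r" "dist y v < r" using * that by auto
    then show ?thesis using dist_triangle3[of u v y] by simp
  qed
  then have "diameter (f ` A) \<le> 2 * r"
    using ne unfolding diameter_def by (auto intro!: cSUP_least)
  then show False using assms by (simp add: admitted_def)
qed


text \<open>A finite connected set has at most one point, so its image has diameter zero. Leading
  two points to \<open>A\<close> along disjoint continua takes two different points of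
  \<open>A\<close>.\<close>

lemma infinite_A:
  assumes "admitted g f"
  shows "infinite A"
proof
  assume "finite A"
  then have "A = {} \<or> (\<exists>a. A = {a})"
    using A(1) connected_finite_iff_sing[of A] by (simp add: continuum_def)
  then have "diameter (f ` A) = 0" by auto
  then show False using assms \<delta> by (simp add: admitted_def)
qed

text \<open>Suppose that \<open>f(A)\<close> comes close to \<open>y0\<close>, in the boundary component \<open>K\<close>. By the modulus bound, no
  continuum of \<open>D'\<close> whose preimage is far from \<open>A\<close> crosses the ring \<open>U - V\<close>. Hence the part of \<open>D'\<close> away
  from \<open>f(A)\<close> falls into pieces near and far from \<open>y0\<close>, which accumulate at a common point \<open>k\<close> of the
  connected set \<open>K\<close>. But curves joining different pieces leave a neighborhood of \<open>k\<close>, so their modulus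
  is bounded, contradicting weak flatness at \<open>k\<close>.\<close>

lemma image_avoids_boundary_point:
  assumes y0: "y0 \<in> frontier D'"
  obtains V where "open V" "y0 \<in> V" "\<And>g f. admitted g f \<Longrightarrow> f ` A \<inter> V = {}"
proof (cases "A = {}")
  case True
  then show thesis by (intro that[of UNIV]) auto
next
  case False
  have "compact A" using A by (simp add: continuum_def)
  moreover have "closed (- D)" "A \<inter> - D = {}" using D A by auto
  ultimately obtain \<eta>0 where \<eta>0: "0 < \<eta>0" "\<And>a y. a \<in> A \<Longrightarrow> y \<in> - D \<Longrightarrow> \<eta>0 \<le> dist a y"
    using separate_compact_closed[of A "- D"] by blast
  \<comment> \<open>Half of the distance between \<open>A\<close> and the complement of
    \<open>D\<close>, so that the closed \<eta>-neighborhood \<open>L\<close> of \<open>A\<close>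
    still lies in \<open>D\<close>.\<close>
  define \<eta> where "\<eta> = \<eta>0 / 2"
  have \<eta>: "0 < \<eta>" using \<eta>0 by (simp add: \<eta>_def)
  define L where "L = {x. infdist x A \<le> \<eta>}"
  define O' where "O' = D - L"
  have LD: "L \<subseteq> D"
  proof
    fix x assume "x \<in> L"
    moreover obtain a where a: "a \<in> A" "infdist x A = dist x a"
      using infdist_attains_inf[of A x] \<open>compact A\<close> False compact_imp_closed by blast
    ultimately have "dist a x < \<eta>0" using \<eta>0(1) by (simp add: L_def \<eta>_def dist_commute)
    then show "x \<in> D" using \<eta>0(2)[OF a(1), of x] by force
  qed
  have "closed L" unfolding L_def by (intro closed_Collect_le continuous_intros)
  then have L: "compact L" using LD bounded by (meson bounded_subset compact_eq_bounded_closed)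
  have AL: "A \<subseteq> L" using \<eta> by (auto simp: L_def)
  have far: "\<eta> \<le> dist a x" if "a \<in> A" "x \<in> O'" for a x
    using that infdist_le[of a A x] by (simp add: O'_def L_def dist_commute)
  have O': "open O'" "O' \<subseteq> D" using D \<open>closed L\<close> by (auto simp: O'_def)
  obtain C where C: "0 < C" "\<forall>D' f g E F. homeomorphism D' D g f \<longrightarrow> ring_Q_mapping_in Q D f (closure D) \<longrightarrow> E \<subseteq> D \<longrightarrow> F \<subseteq> D \<longrightarrow>
      (\<forall>x\<in>E. \<forall>y\<in>F. \<eta> \<le> dist x y) \<longrightarrow> modulus (joining (f ` E) (f ` F) D') \<le> ennreal C"
    by (rule image_joining_modulus_bounded[OF bounded D(1) Q \<eta>])
  define K where "K = connected_component_set (frontier D') y0"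
  have K: "connected K" "K \<subseteq> frontier D'" "y0 \<in> K"
    using y0 by (simp_all add: K_def connected_component_subset)
  have "K \<in> components (frontier D')" using y0 by (auto simp: K_def components_def)
  then obtain y1 where y1: "y1 \<in> K" "y1 \<noteq> y0" using nondegenerate[of K y0] K(3) by blast
  \<comment> \<open>The bound \<open>\<delta> / 3\<close> makes \<open>f(A)\<close> too large for
    \<open>?U\<close>; the other one keeps \<open>y1\<close> out of the closure of
    \<open>?U\<close>.\<close>
  define r where "r = min (\<delta> / 3) (dist y0 y1 / 2)"
  have r: "0 < r" "2 * r < \<delta>" "r < dist y0 y1" using \<delta> y1(2) by (auto simp: r_def min_def)
  let ?U = "ball y0 r"
  have "weakly_flat_at D' y0" using wf y0 by (simp add: weakly_flat_boundary_def)
  then obtain V where V: "open V" "y0 \<in> V" "V \<subseteq> ?U"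
    and flat: "\<forall>E F. crosses D' ?U V E \<longrightarrow> crosses D' ?U V F \<longrightarrow> ennreal C < modulus (joining E F D')"
    by (rule weakly_flat_crossing[OF _ open_ball centre_in_ball[THEN iffD2, OF r(1)] C(1)])
  show thesis
  proof (rule that[OF V(1,2)])
    fix g f assume adm: "admitted g f"
    note f = admittedD[OF adm]
    have hr: "homeomorphism D' D g f" "ring_Q_mapping_in Q D f (closure D)"
      using adm by (auto simp: admitted_def)
    show "f ` A \<inter> V = {}"
    proof (rule ccontr)
      assume AV: "f ` A \<inter> V \<noteq> {}"
      have small: "f ` F \<subseteq> ?U" if F: "continuum F" "F \<subseteq> O'" "f ` F \<inter> V \<noteq> {}" for F
      proof (rule ccontr)
        assume notU: "\<not> f ` F \<subseteq> ?U"
        have FD: "F \<subseteq> D" using F O' by blast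
        have "crosses D' ?U V (f ` A)" "crosses D' ?U V (f ` F)"
          unfolding crosses_def using continuum_image[OF adm A] continuum_image[OF adm F(1) FD] AV F(3) notU
            not_subset_small[OF adm r(2)] by auto
        then have "ennreal C < modulus (joining (f ` A) (f ` F) D')" using flat by blast
        moreover have "modulus (joining (f ` A) (f ` F) D') \<le> ennreal C"
          using far F(2) by (intro C(2)[rule_format, OF hr A(2) FD]) auto
        ultimately show False by simp
      qed
      \<comment> \<open>The path components of \<open>O'\<close> with a point mapped into
        \<open>V\<close>; any two points of such a component are joined by a path, so its whole
        image stays in \<open>?U\<close>.\<close>
      define O1 where "O1 = {x \<in> O'. \<exists>z. f z \<in> V \<and> path_component O' x z}"
      define O2 where "O2 = O' - O1"
      have comp1: "z \<in> O1" if "x \<in> O1" "path_component O' x z" for x z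
        using that path_component_mem(2) path_component_sym path_component_trans unfolding O1_def by blast
      have O1V: "O' \<inter> f -` V \<subseteq> O1" unfolding O1_def using path_component_refl by blast
      have O1U: "f ` O1 \<subseteq> ?U"
      proof (rule image_subsetI)
        fix x assume "x \<in> O1"
        then obtain z p where z: "f z \<in> V" and p: "path p" "path_image p \<subseteq> O'" "pathstart p = x" "pathfinish p = z"
          unfolding O1_def path_component_def by blast
        have "f ` path_image p \<subseteq> ?U"
          using z p pathfinish_in_path_image[of p]
          by (intro small) (auto simp: continuum_def compact_path_image connected_path_image)
        then show "f x \<in> ?U" using p pathstart_in_path_image[of p] by blast
      qed
      have fL: "compact (f ` L)" using L LD f(5) by (meson compact_continuous_image continuous_on_subset)
      have fO: "f ` O' = D' - f ` L"
        using f(1,3) LD unfolding O'_def by (metis Diff_subset inj_on_def inj_on_image_set_diff order_refl)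
      have "f ` O' = f ` O1 \<union> f ` O2" by (auto simp: O1_def O2_def)
      moreover have "D' = f ` O' \<union> f ` L" using fO f(3) LD by blast
      \<comment> \<open>The compact set \<open>f(L)\<close> lies in the open set \<open>D'\<close>
        and therefore adds no boundary points.\<close>
      ultimately have "closure D' = closure (f ` O1) \<union> closure (f ` O2) \<union> f ` L"
        using fL by (metis closure_Un closure_closed compact_imp_closed)
      moreover have frD: "frontier D' \<inter> D' = {}" using D' by (auto simp: frontier_def interior_open)
      moreover have fLD: "f ` L \<subseteq> D'" using f(3) LD by blast
      moreover have "K \<subseteq> closure D'" using K(2) by (auto simp: frontier_def)
      ultimately have Kcl: "K \<subseteq> closure (f ` O1) \<union> closure (f ` O2)"
        using K(2) by blast
      have "y0 \<notin> closure (f ` O2)"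
      proof -
        have "V \<inter> f ` O2 = {}" using O1V by (auto simp: O2_def)
        then show ?thesis using V by (metis disjoint_iff open_Int_closure_eq_empty)
      qed
      moreover have "y1 \<notin> closure (f ` O1)"
      proof -
        have "closure (f ` O1) \<subseteq> cball y0 r"
          using O1U ball_subset_cball by (intro closure_minimal) (auto simp: subset_iff)
        then show ?thesis using r(3) by auto
      qed
      ultimately have "K \<inter> closure (f ` O1) \<noteq> {}" "K \<inter> closure (f ` O2) \<noteq> {}" using Kcl K(3) y1(1) by blast+
      then obtain k where k: "k \<in> K" "k \<in> closure (f ` O1)" "k \<in> closure (f ` O2)"
        using connected_closedD[OF K(1) _ Kcl closed_closure closed_closure] by blast
      let ?N = "- f ` L"
      have "open ?N" "k \<in> ?N"
        using fL compact_imp_closed k(1) K(2) frD fLD by blast+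
      then obtain N' C' where N': "open N'" "k \<in> N'" "closure N' \<subseteq> ?N"
        and esc: "\<And>\<Gamma>. (\<And>\<gamma>. \<gamma> \<in> \<Gamma> \<Longrightarrow> \<exists>c t. \<gamma> = ({0..1}, c) \<and> path c \<and> c 0 \<in> closure N' \<and> t \<in> {0..1} \<and> c t \<notin> ?N) \<Longrightarrow>
          modulus \<Gamma> \<le> ennreal C'"
        using escape_modulus_bounded[of ?N k] by metis
      have "weakly_flat_at D' k" using wf k(1) K(2) by (auto simp: weakly_flat_boundary_def)
      \<comment> \<open>Weak flatness is stated for positive bounds, hence \<open>max C' 1\<close>.
        Only the present \<open>f\<close> is concerned, so \<open>C'\<close> and \<open>V'\<close>
        may depend on it.\<close>
      then obtain V' where V': "open V'" "k \<in> V'" "V' \<subseteq> N'"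
        and flat': "\<forall>E F. crosses D' N' V' E \<longrightarrow> crosses D' N' V' F \<longrightarrow>
          ennreal (max C' 1) < modulus (joining E F D')"
        by (rule weakly_flat_crossing[OF _ N'(1,2), of D' "max C' 1"]) simp
      \<comment> \<open>Follow a path from \<open>x\<close> to \<open>A\<close>, whose image has to
        leave \<open>N'\<close>. Up to the first exit the image stays in the closure of
        \<open>N'\<close>, hence off \<open>f(L)\<close>, so this piece of the path remains in one
        component of \<open>O'\<close>.\<close>
      have reach: "\<exists>E. continuum E \<and> E \<subseteq> path_component_set O' x \<and> f ` E \<subseteq> closure N' \<and>
          crosses D' N' V' (f ` E)"
        if x: "x \<in> O'" "f x \<in> V'" for x
      proof -
        obtain a where a: "a \<in> A" using False by blast
        obtain p where p: "path p" "path_image p \<subseteq> D" "pathstart p = x" "pathfinish p = a"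
          using D(3) x(1) O' a A(2) unfolding path_connected_def by (metis subsetD)
        have p01: "p ` {0..1} \<subseteq> D" "p 0 = x" "p 1 = a"
          using p by (simp_all add: path_image_def pathstart_def pathfinish_def)
        have pc: "continuous_on {0..1} p" using p(1) by (simp add: path_def)
        have qc: "continuous_on {0..1} (f \<circ> p)"
          using pc p01(1) by (intro continuous_on_compose continuous_on_subset[OF f(5)]) auto
        have "(f \<circ> p) 1 \<in> - N'"
          using a AL p01(3) N'(3) closure_subset[of N'] by auto
        then obtain u where u: "u \<in> {0..1}" "(f \<circ> p) u \<in> - N'" "\<And>v. 0 \<le> v \<Longrightarrow> v < u \<Longrightarrow> (f \<circ> p) v \<notin> - N'"
          using first_hit[OF qc, of "- N'" 1] N'(1) by (metis atLeastAtMost_iff closed_Compl order_refl zero_le_one)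
        have "u \<noteq> 0" using u(2) p01(2) x(2) V'(3) by auto
        then have u0: "0 < u" using u(1) by simp
        have cl: "(f \<circ> p) ` {0..u} \<subseteq> closure N'"
        proof -
          have "(f \<circ> p) ` {0..<u} \<subseteq> closure N'" using u(3) closure_subset[of N'] by auto
          moreover have "continuous_on {0..u} (f \<circ> p)" using qc u(1) by (auto intro: continuous_on_subset)
          ultimately have "(f \<circ> p) ` closure {0..<u} \<subseteq> closure N'"
            using u0 by (intro image_closure_subset) auto
          then show ?thesis using u0 by simp
        qed
        let ?E = "p ` {0..u}"
        have ED: "?E \<subseteq> D" using p01(1) u(1) by auto
        have pcu: "continuous_on {0..u} p" using pc u(1) by (auto intro: continuous_on_subset)
        have E: "continuum ?E"
          unfolding continuum_def using pcu by (simp add: compact_continuous_image connected_continuous_image)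
        have "?E \<subseteq> O'"
        proof
          fix z assume z: "z \<in> ?E"
          then have "f z \<in> ?N" using cl N'(3) by (auto simp: image_comp)
          then show "z \<in> O'" using z ED by (auto simp: O'_def)
        qed
        moreover have "path_connected ?E"
          using pcu by (intro path_connected_continuous_image) (auto simp: convex_imp_path_connected)
        moreover have xE: "x \<in> ?E" using p01(2) u0 by force
        ultimately have "?E \<subseteq> path_component_set O' x" by (intro path_component_maximal)
        moreover have "f (p u) \<in> f ` ?E" "f (p u) \<notin> N'" using u0 u(2) by auto
        then have "crosses D' N' V' (f ` ?E)"
          unfolding crosses_def using continuum_image[OF adm E ED] xE x(2) by blast
        ultimately show ?thesis using E cl by (intro exI[of _ ?E]) (auto simp: image_comp)
      qed
      have hit: "\<exists>x\<in>X. f x \<in> V'" if "k \<in> closure (f ` X)" for X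
        using that V'(1,2) open_Int_closure_eq_empty[of V' "f ` X"] by blast
      obtain x1 x2 where x1: "x1 \<in> O1" "f x1 \<in> V'" and x2: "x2 \<in> O2" "f x2 \<in> V'"
        using hit[OF k(2)] hit[OF k(3)] by blast
      have x12: "x1 \<in> O'" "x2 \<in> O'" using x1 x2 by (auto simp: O1_def O2_def)
      obtain E where E: "continuum E" "E \<subseteq> path_component_set O' x1" "f ` E \<subseteq> closure N'"
          "crosses D' N' V' (f ` E)"
        using reach[OF x12(1) x1(2)] by blast
      obtain F where F: "continuum F" "F \<subseteq> path_component_set O' x2" "f ` F \<subseteq> closure N'"
          "crosses D' N' V' (f ` F)"
        using reach[OF x12(2) x2(2)] by blast
      have E1: "E \<subseteq> O1" using E(2) comp1[OF x1(1)] by blast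
      have F2: "F \<subseteq> O2"
      proof
        fix z assume "z \<in> F"
        then have z: "path_component O' x2 z" using F(2) by blast
        then have "z \<notin> O1" using comp1[of z x2] path_component_sym x2(1) by (auto simp: O2_def)
        then show "z \<in> O2" using path_component_mem(2)[OF z] by (simp add: O2_def)
      qed
      have EFD: "E \<subseteq> D" "F \<subseteq> D" using E1 F2 O'(2) by (auto simp: O1_def O2_def)
      have "ennreal (max C' 1) < modulus (joining (f ` E) (f ` F) D')"
        using flat' E(4) F(4) by blast
      moreover have "modulus (joining (f ` E) (f ` F) D') \<le> ennreal C'"
      proof (rule esc)
        fix \<gamma> assume "\<gamma> \<in> joining (f ` E) (f ` F) D'"
        then obtain c where c: "\<gamma> = ({0..1}, c)" "path c" "c 0 \<in> f ` E" "c 1 \<in> f ` F"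
          "\<And>t. t \<in> {0<..<1} \<Longrightarrow> c t \<in> D'"
          by (auto simp: joining_def pathstart_def pathfinish_def)
        have cD: "c t \<in> D'" if "t \<in> {0..1}" for t
          using that c EFD f(3) by (cases "t = 0 \<or> t = 1") auto
        \<comment> \<open>A curve avoiding \<open>f(L)\<close> would pull back to a path in
          \<open>O'\<close> that leads from \<open>O1\<close> to \<open>O2\<close>.\<close>
        have "\<exists>t\<in>{0..1}. c t \<notin> ?N"
        proof (rule ccontr)
          assume "\<not> ?thesis"
          then have cO: "c t \<in> f ` O'" if "t \<in> {0..1}" for t using cD[OF that] fO that by blast
          have gO: "g w \<in> O'" if "w \<in> f ` O'" for w using that f(1) O'(2) by auto
          have "path_component O' (g (c 0)) (g (c 1))"
            unfolding path_component_def
          proof (intro exI conjI)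
            show "path (g \<circ> c)"
              using c(2) cD unfolding path_def
              by (intro continuous_on_compose continuous_on_subset[OF f(6)]) auto
            show "path_image (g \<circ> c) \<subseteq> O'" using cO gO by (auto simp: path_image_def)
          qed (simp_all add: pathstart_def pathfinish_def)
          moreover have "g (c 0) \<in> O1" "g (c 1) \<in> O2"
            using c(3,4) E1 F2 f(1) EFD by (auto dest!: subsetD)
          ultimately show False using comp1 by (auto simp: O2_def)
        qed
        then show "\<exists>c t. \<gamma> = ({0..1}, c) \<and> path c \<and> c 0 \<in> closure N' \<and> t \<in> {0..1} \<and> c t \<notin> ?N"
          using c E(3) by blast
      qed
      ultimately have "ennreal (max C' 1) < ennreal C'" by (rule less_le_trans)
      then show False by (simp add: ennreal_less_iff)
    qed
  qed
qed

text \<open>Every ray leaves the bounded set \<open>D\<close>. If all its points before the first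
  exit belonged to \<open>K\<close>, so would the exit point, as \<open>K\<close> is closed; but
  that point is not in \<open>D\<close>.\<close>

lemma ray_leaves_compact:
  assumes x: "x \<in> D" and v: "v \<noteq> 0" and K: "compact K" "K \<subseteq> D"
  obtains t where "0 \<le> t" "(\<lambda>s. x + s *\<^sub>R v) ` {0..t} \<subseteq> D" "x + t *\<^sub>R v \<notin> K"
proof -
  let ?l = "\<lambda>s. x + s *\<^sub>R v"
  obtain R where R: "\<And>y. y \<in> D \<Longrightarrow> norm y \<le> R" using bounded unfolding bounded_iff by blast
  \<comment> \<open>Makes the norm of \<open>b *\<^sub>R v\<close> equal to
    \<open>\<bar>R\<bar> + norm x + 1\<close>, which takes the ray beyond the bound
    \<open>R\<close>.\<close>
  define b where "b = (\<bar>R\<bar> + norm x + 1) / norm v"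
  have b: "0 \<le> b" using v by (simp add: b_def)
  have "norm (b *\<^sub>R v) = \<bar>R\<bar> + norm x + 1" using v b by (simp add: b_def)
  then have "R < norm (?l b)" using norm_diff_ineq[of "b *\<^sub>R v" x] by (simp add: add.commute)
  then have out: "?l b \<in> - D" using R[of "?l b"] by auto
  have "continuous_on {0..b} ?l" by (intro continuous_intros)
  then obtain u where u: "u \<in> {0..b}" "?l u \<in> - D" "\<And>s. 0 \<le> s \<Longrightarrow> s < u \<Longrightarrow> ?l s \<notin> - D"
    using first_hit[of 0 b ?l "- D" b] D(1) b out by (metis atLeastAtMost_iff closed_Compl order_refl)
  have u0: "0 < u" using u(1,2) x by (cases "u = 0") auto
  have "\<exists>t\<in>{0..<u}. ?l t \<notin> K"
  proof (rule ccontr)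
    assume "\<not> ?thesis"
    then have "?l ` {0..<u} \<subseteq> K" by auto
    moreover have "continuous_on {0..u} ?l" by (intro continuous_intros)
    ultimately have "?l ` closure {0..<u} \<subseteq> K"
      using u0 compact_imp_closed[OF K(1)] by (intro image_closure_subset) auto
    moreover have "?l u \<in> ?l ` closure {0..<u}" using u0 by (intro imageI) simp
    ultimately have "?l u \<in> K" by blast
    then show False using u(2) K(2) by auto
  qed
  then obtain t where t: "t \<in> {0..<u}" "?l t \<notin> K" by blast
  show thesis
  proof (rule that[of t])
    show "?l ` {0..t} \<subseteq> D" using u(3) t(1) by auto
  qed (use t in auto)
qed

text \<open>\<open>U\<close> and \<eta> serve all mappings; only the continua depend on
  \<open>f\<close>. The given pair \<open>g0\<close>, \<open>f0\<close> ensures that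
  \<open>A\<close> is infinite, as the connections to \<open>A\<close> require.\<close>

lemma separating_continua:
  assumes y0: "y0 \<in> closure D'" and \<epsilon>: "0 < \<epsilon>" and nonempty: "admitted g0 f0"
  obtains U \<eta> where "open U" "y0 \<in> U" "0 < \<eta>"
    "\<And>g f x x'. admitted g f \<Longrightarrow> x \<in> D \<Longrightarrow> x' \<in> D \<Longrightarrow> \<epsilon> \<le> dist x x' \<Longrightarrow>
      \<exists>E F. continuum E \<and> continuum F \<and> E \<subseteq> D \<and> F \<subseteq> D \<and> x \<in> E \<and> x' \<in> F \<and>
        \<not> f ` E \<subseteq> U \<and> \<not> f ` F \<subseteq> U \<and> (\<forall>u\<in>E. \<forall>v\<in>F. \<eta> \<le> dist u v)"
proof (cases "y0 \<in> D'")
  case False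
  then have "y0 \<in> frontier D'" using y0 D' by (simp add: frontier_def interior_open)
  then obtain V where V: "open V" "y0 \<in> V" "\<And>g f. admitted g f \<Longrightarrow> f ` A \<inter> V = {}"
    using image_avoids_boundary_point by blast
  obtain \<eta> where \<eta>: "0 < \<eta>"
    "\<And>y y'. y \<in> D \<Longrightarrow> y' \<in> D \<Longrightarrow> \<epsilon> \<le> dist y y' \<Longrightarrow> \<exists>E F. continuum E \<and> continuum F \<and> E \<subseteq> D \<and> F \<subseteq> D \<and>
      y \<in> E \<and> y' \<in> F \<and> E \<inter> A \<noteq> {} \<and> F \<inter> A \<noteq> {} \<and> (\<forall>u\<in>E. \<forall>v\<in>F. \<eta> \<le> dist u v)"
    using separated_connection[OF dim D(1,2) bounded lc infinite_A[OF nonempty] A(2) \<epsilon>] by blast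
  show thesis
  proof (rule that[OF V(1,2) \<eta>(1)])
    fix g f x x' assume adm: "admitted g f" and x: "x \<in> D" "x' \<in> D" "\<epsilon> \<le> dist x x'"
    have "\<not> f ` E \<subseteq> V" if "E \<inter> A \<noteq> {}" for E using V(3)[OF adm] that by blast
    then show "\<exists>E F. continuum E \<and> continuum F \<and> E \<subseteq> D \<and> F \<subseteq> D \<and> x \<in> E \<and> x' \<in> F \<and>
        \<not> f ` E \<subseteq> V \<and> \<not> f ` F \<subseteq> V \<and> (\<forall>u\<in>E. \<forall>v\<in>F. \<eta> \<le> dist u v)"
      using \<eta>(2)[OF x] by blast
  qed
next
  case True
  then obtain r where r: "0 < r" "cball y0 r \<subseteq> D'" using D' open_contains_cball by blast
  have cb: "compact (cball y0 r)" using compact_Int_closed[OF compact_onept closed_cball[of y0 r]] by simp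
  show thesis
  proof (rule that[of "ball y0 r" \<epsilon>])
    fix g f x x' assume adm: "admitted g f" and x: "x \<in> D" "x' \<in> D" "\<epsilon> \<le> dist x x'"
    note f = admittedD[OF adm]
    let ?K = "g ` cball y0 r"
    have K: "compact ?K" "?K \<subseteq> D"
      using cb r(2) f(4,6) by (auto intro: compact_continuous_image continuous_on_subset)
    have away: "\<not> f ` E \<subseteq> ball y0 r" if "z \<in> E" "z \<notin> ?K" "z \<in> D" for z E
      using that f(1)[of z] by (metis ball_subset_cball imageI subsetD)
    have ne: "x - x' \<noteq> 0" "x' - x \<noteq> 0" using x(3) \<epsilon> by auto
    obtain t where t: "0 \<le> t" "(\<lambda>s. x + s *\<^sub>R (x - x')) ` {0..t} \<subseteq> D" "x + t *\<^sub>R (x - x') \<notin> ?K"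
      using ray_leaves_compact[OF x(1) ne(1) K] .
    obtain t' where t': "0 \<le> t'" "(\<lambda>s. x' + s *\<^sub>R (x' - x)) ` {0..t'} \<subseteq> D" "x' + t' *\<^sub>R (x' - x) \<notin> ?K"
      using ray_leaves_compact[OF x(2) ne(2) K] .
    let ?E = "(\<lambda>s. x + s *\<^sub>R (x - x')) ` {0..t}" and ?F = "(\<lambda>s. x' + s *\<^sub>R (x' - x)) ` {0..t'}"
    have far: "\<epsilon> \<le> dist u v" if uv: "u \<in> ?E" "v \<in> ?F" for u v
    proof -
      obtain a b where ab: "0 \<le> a" "0 \<le> b" "u = x + a *\<^sub>R (x - x')" "v = x' + b *\<^sub>R (x' - x)"
        using uv by auto
      \<comment> \<open>Moving apart along the line through \<open>x\<close> and \<open>x'\<close>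
        only increases the distance, so \<epsilon> itself serves as the separation.\<close>
      have "u - v = (1 + a + b) *\<^sub>R (x - x')" by (simp add: ab algebra_simps)
      then have "dist u v = (1 + a + b) * dist x x'" using ab by (simp add: dist_norm)
      also have "\<dots> \<ge> 1 * dist x x'" using ab by (intro mult_right_mono) auto
      finally show ?thesis using x(3) by simp
    qed
    have cont: "continuum ?E" "continuum ?F"
      unfolding continuum_def
      by (auto intro!: compact_continuous_image connected_continuous_image continuous_intros)
    have mem: "x \<in> ?E" "x' \<in> ?F" using t(1) t'(1) by force+
    have aE: "\<not> f ` ?E \<subseteq> ball y0 r"
    proof -
      have z: "x + t *\<^sub>R (x - x') \<in> ?E" using t(1) by (intro image_eqI[of _ _ t]) auto
      show ?thesis by (rule away[OF z t(3) subsetD[OF t(2) z]])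
    qed
    have aF: "\<not> f ` ?F \<subseteq> ball y0 r"
    proof -
      have z: "x' + t' *\<^sub>R (x' - x) \<in> ?F" using t'(1) by (intro image_eqI[of _ _ t']) auto
      show ?thesis by (rule away[OF z t'(3) subsetD[OF t'(2) z]])
    qed
    show "\<exists>E F. continuum E \<and> continuum F \<and> E \<subseteq> D \<and> F \<subseteq> D \<and> x \<in> E \<and> x' \<in> F \<and>
        \<not> f ` E \<subseteq> ball y0 r \<and> \<not> f ` F \<subseteq> ball y0 r \<and> (\<forall>u\<in>E. \<forall>v\<in>F. \<epsilon> \<le> dist u v)"
      by (intro exI[of _ ?E] exI[of _ ?F] conjI ballI cont t(2) t'(2) mem aE aF far)
  qed (use r \<epsilon> in auto)
qed

text \<open>If the values were \<epsilon> apart, the images of the separating continua would have a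
  joining family of modulus both above and at most \<open>C\<close>. Two points of \<open>D'\<close>
  near \<open>y0\<close> are compared, rather than one point with \<open>y0\<close>, since
  \<open>g\<close> has no value yet at a boundary point.\<close>

lemma equicontinuous_at:
  assumes y0: "y0 \<in> closure D'" and \<epsilon>: "0 < \<epsilon>"
  obtains V where "open V" "y0 \<in> V"
    "\<And>g u u'. g \<in> inverse_family \<delta> A Q D D' \<Longrightarrow> u \<in> V \<inter> D' \<Longrightarrow> u' \<in> V \<inter> D' \<Longrightarrow> dist (g u) (g u') < \<epsilon>"
proof (cases "inverse_family \<delta> A Q D D' = {}")
  case True
  then show thesis using that[of UNIV] by simp
next
  case False
  then obtain g0 f0 where "admitted g0 f0" using inverse_family_admitted by blast
  then obtain U \<eta> where U: "open U" "y0 \<in> U" and \<eta>: "0 < \<eta>"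
    and sep: "\<And>g f x x'. admitted g f \<Longrightarrow> x \<in> D \<Longrightarrow> x' \<in> D \<Longrightarrow> \<epsilon> \<le> dist x x' \<Longrightarrow>
      \<exists>E F. continuum E \<and> continuum F \<and> E \<subseteq> D \<and> F \<subseteq> D \<and> x \<in> E \<and> x' \<in> F \<and>
        \<not> f ` E \<subseteq> U \<and> \<not> f ` F \<subseteq> U \<and> (\<forall>u\<in>E. \<forall>v\<in>F. \<eta> \<le> dist u v)"
    using separating_continua[OF y0 \<epsilon>, of g0 f0] by metis
  obtain C where C: "0 < C" "\<forall>D' f g E F. homeomorphism D' D g f \<longrightarrow> ring_Q_mapping_in Q D f (closure D) \<longrightarrow> E \<subseteq> D \<longrightarrow> F \<subseteq> D \<longrightarrow>
      (\<forall>x\<in>E. \<forall>y\<in>F. \<eta> \<le> dist x y) \<longrightarrow> modulus (joining (f ` E) (f ` F) D') \<le> ennreal C"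
    by (rule image_joining_modulus_bounded[OF bounded D(1) Q \<eta>])
  have "weakly_flat_at D' y0"
  proof (cases "y0 \<in> D'")
    case True
    then show ?thesis using interior_weakly_flat dim D' by blast
  next
    case False
    then show ?thesis
      using wf y0 D' by (simp add: weakly_flat_boundary_def frontier_def interior_open)
  qed
  then obtain V where V: "open V" "y0 \<in> V" "V \<subseteq> U"
    and flat: "\<forall>E F. crosses D' U V E \<longrightarrow> crosses D' U V F \<longrightarrow> ennreal C < modulus (joining E F D')"
    by (rule weakly_flat_crossing[OF _ U C(1)])
  show thesis
  proof (rule that[OF V(1,2)])
    fix g u u' assume g: "g \<in> inverse_family \<delta> A Q D D'" and u: "u \<in> V \<inter> D'" "u' \<in> V \<inter> D'"
    obtain f where adm: "admitted g f" using inverse_family_admitted[OF g] by blast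
    note f = admittedD[OF adm]
    show "dist (g u) (g u') < \<epsilon>"
    proof (rule ccontr)
      assume "\<not> ?thesis"
      then obtain E F where E: "continuum E" "E \<subseteq> D" "g u \<in> E" "\<not> f ` E \<subseteq> U"
        and F: "continuum F" "F \<subseteq> D" "g u' \<in> F" "\<not> f ` F \<subseteq> U"
        and EF: "\<forall>u\<in>E. \<forall>v\<in>F. \<eta> \<le> dist u v"
        using sep[OF adm, of "g u" "g u'"] u f(4) by (metis IntD2 imageI not_less)
      have "crosses D' U V (f ` X)"
        if "continuum X" "X \<subseteq> D" "g w \<in> X" "w \<in> V \<inter> D'" "\<not> f ` X \<subseteq> U" for X w
      proof -
        have "w \<in> f ` X" using that(3,4) f(2)[of w] by (metis IntD2 imageI)
        then show ?thesis
          unfolding crosses_def using continuum_image[OF adm that(1,2)] that(4,5) by blast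
      qed
      then have "ennreal C < modulus (joining (f ` E) (f ` F) D')"
        using flat E F u by blast
      moreover have "modulus (joining (f ` E) (f ` F) D') \<le> ennreal C"
        using adm EF by (intro C(2)[rule_format] E F) (auto simp: admitted_def)
      ultimately show False by simp
    qed
  qed
qed

section \<open>Passage to the closure\<close>

lemma extension_equicontinuous_at:
  assumes y0: "y0 \<in> closure D'" and \<epsilon>: "0 < \<epsilon>"
  obtains d where "0 < d"
    "\<And>gb y. gb \<in> extended_inverse_family \<delta> A Q D D' \<Longrightarrow> y \<in> closure D' \<Longrightarrow> dist y y0 < d \<Longrightarrow>
      norm (gb y - gb y0) < \<epsilon>"
proof -
  obtain V where V: "open V" "y0 \<in> V"
    "\<And>g u u'. g \<in> inverse_family \<delta> A Q D D' \<Longrightarrow> u \<in> V \<inter> D' \<Longrightarrow> u' \<in> V \<inter> D' \<Longrightarrow> dist (g u) (g u') < \<epsilon> / 2"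
    using equicontinuous_at[OF y0, of "\<epsilon> / 2"] \<epsilon> by auto
  obtain d where d: "0 < d" "ball y0 d \<subseteq> V" using V openE by blast
  show thesis
  proof (rule that[OF d(1)])
    fix gb y assume gb: "gb \<in> extended_inverse_family \<delta> A Q D D'" and y: "y \<in> closure D'" "dist y y0 < d"
    obtain g where g: "g \<in> inverse_family \<delta> A Q D D'" "continuous_on (closure D') gb" "\<And>y. y \<in> D' \<Longrightarrow> gb y = g y"
      using gb by (auto simp: extended_inverse_family_def continuous_extension_def)
    \<comment> \<open>Values of \<open>gb\<close> on the closure are approximated within
      \<open>\<epsilon> / 4\<close> by values at points of \<open>V \<inter> D'\<close>, where the
      estimate \<open>\<epsilon> / 2\<close> applies; the three errors add up to \<epsilon>.\<close>
    have near: "\<exists>u\<in>V \<inter> D'. dist (gb u) (gb z) < \<epsilon> / 4" if z: "z \<in> closure D'" "z \<in> V" for z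
    proof -
      obtain e where e: "0 < e" "\<And>u. u \<in> closure D' \<Longrightarrow> dist u z < e \<Longrightarrow> dist (gb u) (gb z) < \<epsilon> / 4"
        using g(2) z(1) \<epsilon> unfolding continuous_on_iff by (metis zero_less_divide_iff zero_less_numeral)
      have "open (V \<inter> ball z e)" "z \<in> V \<inter> ball z e" using V z e(1) by auto
      then have "V \<inter> ball z e \<inter> D' \<noteq> {}" using z(1) open_Int_closure_eq_empty[of "V \<inter> ball z e" D'] by blast
      then obtain u where "u \<in> V" "u \<in> D'" "dist u z < e" by (auto simp: dist_commute)
      then show ?thesis using e(2)[of u] closure_subset by blast
    qed
    have "y \<in> V" using y(2) d(2) by (auto simp: dist_commute)
    then obtain u where u: "u \<in> V \<inter> D'" "dist (gb u) (gb y) < \<epsilon> / 4"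
      using near[OF y(1)] by blast
    obtain u' where u': "u' \<in> V \<inter> D'" "dist (gb u') (gb y0) < \<epsilon> / 4"
      using near[OF y0 V(2)] by blast
    have "dist (gb u) (gb u') < \<epsilon> / 2" using V(3)[OF g(1) u(1) u'(1)] u(1) u'(1) by (simp add: g(3))
    then have "dist (gb y) (gb y0) < \<epsilon>"
      using u(2) u'(2) dist_triangle[of "gb y" "gb y0" "gb u"] dist_triangle[of "gb u" "gb y0" "gb u'"]
      by (simp add: dist_commute)
    then show "norm (gb y - gb y0) < \<epsilon>" by (simp add: dist_norm)
  qed
qed

text \<open>A Lebesgue number of the cover of the compact closure of \<open>D'\<close> by the
  neighborhoods from \<open>equicontinuous_at\<close>.\<close>

lemma uniformly_continuous_inverse:
  assumes g: "g \<in> inverse_family \<delta> A Q D D'"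
  shows "uniformly_continuous_on D' g"
  unfolding uniformly_continuous_on_def
proof (intro allI impI)
  fix \<epsilon> :: real assume \<epsilon>: "0 < \<epsilon>"
  have "\<exists>V. open V \<and> y \<in> V \<and> (\<forall>u\<in>V \<inter> D'. \<forall>u'\<in>V \<inter> D'. dist (g u) (g u') < \<epsilon>)" if "y \<in> closure D'" for y
    using equicontinuous_at[OF that \<epsilon>] g by metis
  then obtain V where V: "\<And>y. y \<in> closure D' \<Longrightarrow> open (V y)" "\<And>y. y \<in> closure D' \<Longrightarrow> y \<in> V y"
    "\<And>y u u'. y \<in> closure D' \<Longrightarrow> u \<in> V y \<inter> D' \<Longrightarrow> u' \<in> V y \<inter> D' \<Longrightarrow> dist (g u) (g u') < \<epsilon>"
    by metis
  have "compact (closure D')" using compact_Int_closed[OF compact_onept closed_closure[of D']] by simp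
  then obtain d where d: "0 < d" "\<And>y. y \<in> closure D' \<Longrightarrow> \<exists>G\<in>V ` closure D'. ball y d \<subseteq> G"
    by (rule Heine_Borel_lemma[of "closure D'" "V ` closure D'"]) (use V in auto)
  show "\<exists>d>0. \<forall>x\<in>D'. \<forall>x'\<in>D'. dist x' x < d \<longrightarrow> dist (g x') (g x) < \<epsilon>"
  proof (intro exI[of _ d] conjI ballI impI)
    fix x x' assume x: "x \<in> D'" "x' \<in> D'" "dist x' x < d"
    obtain y where "y \<in> closure D'" "ball x d \<subseteq> V y" using d(2)[of x] x(1) closure_subset by blast
    moreover have "x \<in> ball x d" "x' \<in> ball x d" using x(3) d(1) by (simp_all add: dist_commute)
    ultimately show "dist (g x') (g x) < \<epsilon>" using V(3)[of y x' x] x(1,2) by blast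
  qed (rule d)
qed

text \<open>Uniform continuity yields the extension. The image of the compact closure of
  \<open>D'\<close> is closed and contains \<open>D\<close>, so it contains the closure of
  \<open>D\<close>; continuity gives the other inclusion.\<close>

lemma extension_exists:
  assumes g: "g \<in> inverse_family \<delta> A Q D D'"
  obtains gb where "continuous_extension D' g gb" "gb ` closure D' = closure D"
proof -
  obtain gb where gb: "uniformly_continuous_on (closure D') gb" "\<And>x. x \<in> D' \<Longrightarrow> g x = gb x"
    using uniformly_continuous_on_extension_on_closure[OF uniformly_continuous_inverse[OF g]] by metis
  then have c: "continuous_on (closure D') gb" by (simp add: uniformly_continuous_imp_continuous)
  have "g ` D' = D" using inverse_family_admitted[OF g] admittedD(4) by blast
  then have im: "gb ` D' = D" using gb(2) by auto
  have "compact (closure D')" using compact_Int_closed[OF compact_onept closed_closure[of D']] by simp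
  then have "closed (gb ` closure D')" using c compact_continuous_image compact_imp_closed by blast
  moreover have "D \<subseteq> gb ` closure D'" using im closure_subset by blast
  ultimately have "closure D \<subseteq> gb ` closure D'" by (rule closure_minimal[rotated])
  moreover have "gb ` closure D' \<subseteq> closure D"
    by (rule image_closure_subset[OF c]) (simp_all add: im closure_subset)
  ultimately have "gb ` closure D' = closure D" by blast
  moreover have "continuous_extension D' g gb" using c gb(2) by (simp add: continuous_extension_def)
  ultimately show thesis using that by blast
qed

end

theorem theorem1p2:
  fixes D A :: "(real ^ 'n) set"
    and D' :: "(real ^ 'n) onept set"
    and \<delta> :: real
    and Q :: "real ^ 'n \<Rightarrow> ennreal"
  assumes "CARD('n) \<ge> 2"
    and "is_domain D" and "bounded D"
    and "is_domain D'"
    and "\<delta> > 0"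
    and "continuum A" and "A \<subseteq> D"
    and "Q \<in> borel_measurable lebesgue" and "\<And>x. x \<notin> D \<Longrightarrow> Q x = 0"
    and "locally_connected_on_boundary D"
    and "weakly_flat_boundary D'"
    and "\<And>C p. C \<in> components (frontier D') \<Longrightarrow> C \<noteq> {p}"
    and "(\<integral>\<^sup>+ x \<in> D. Q x \<partial>lebesgue) < \<infinity>"
  shows "(\<forall>g\<in>inverse_family \<delta> A Q D D'.
            \<exists>gb. continuous_extension D' g gb \<and> gb ` closure D' = closure D) \<and>
         (\<forall>y0\<in>closure D'. \<forall>\<epsilon>>0. \<exists>d>0.
            \<forall>gb\<in>extended_inverse_family \<delta> A Q D D'. \<forall>y\<in>closure D'.
              dist y y0 < d \<longrightarrow> norm (gb y - gb y0) < \<epsilon>)"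
proof -
  interpret inverse_setting D A D' \<delta> Q
    by unfold_locales (use assms in auto)
  show ?thesis
  proof (intro conjI ballI allI impI)
    fix g assume "g \<in> inverse_family \<delta> A Q D D'"
    then show "\<exists>gb. continuous_extension D' g gb \<and> gb ` closure D' = closure D"
      using extension_exists by metis
  next
    fix y0 and \<epsilon> :: real assume "y0 \<in> closure D'" "0 < \<epsilon>"
    then show "\<exists>d>0. \<forall>gb\<in>extended_inverse_family \<delta> A Q D D'. \<forall>y\<in>closure D'.
        dist y y0 < d \<longrightarrow> norm (gb y - gb y0) < \<epsilon>"
      using extension_equicontinuous_at by metis
  qed
qed

end
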